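(* Let $(M_t)_{t\in[0,T)}$ be an axially symmetric volume preserving mean curvature flow with Neumann boundary conditions as described in the context. For given $\epsilon>0$, let $S_t\subset M_t$ and $S=\bigcup_{t<T}S_t$ be such that $y|_S\ge\epsilon>0$ for all $t<T$. Then the norm $|A|$ of the second fundamental form is bounded in the region $S$.
   Context: Setting. Let $0<a<b$ and let $\rho_0:[a,b]\to\mathbb{R}$ be smooth and positive with $\rho_0'(a)=\rho_0'(b)=0$. $M_0\subset\mathbb{R}^{n+1}$ is the $n$-dimensional hypersurface generated by rotating the graph of $\rho_0$ about the $x_1$-axis; it lies in $D=\{a\le x_1\le b\}$ with $\partial M_0\subset\partial D$. The smooth immersions $\mathbf{x}(\cdot,t):M^n\to\mathbb{R}^{n+1}$, $M_t=\mathbf{x}(M^n,t)$, $t\in[0,T)$, start at $M_0$ and solve $$\frac{d}{dt}\mathbf{x}=-(H-h)\nu,\qquad h(t)=\frac{\int_{M_t}H\,dg_t}{\int_{M_t}dg_t},$$ with $\nu$ the outer unit normal (pointing away from the axis), $H$ the mean curvature (sum of principal curvatures), and Neumann boundary conditions ($M_t\subset D$, $\partial M_t\subset\partial D$, $M_t$ meets $\partial D$ orthogonally). The flow preserves axial symmetry; $M_t$ is generated by rotating the graph of $\rho(\cdot,t)>0$ on $[a,b]$. $T<\infty$ is the first time at which a singularity develops. By a known result there are constants $c_2,c_3$ depending on $M_0$ with $0<c_2\le h(t)\le c_3$ for all $t\in[0,T)$. The height function $y(l,t)$ is the distance of $\mathbf{x}(l,t)$ from the $x_1$-axis (the axis of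 rotation). $S$ is regarded as a space-time region, and "bounded in $S$" means bounded by a constant uniformly over all points of $S_t$ and all $t<T$. *)

theory Defs
  imports "HOL-Analysis.Analysis"
begin

section \<open>Smooth maps on subsets of Euclidean space\<close>

text \<open>Meant for open \<open>U\<close>: all iterated partial derivatives up to order \<open>k\<close> exist and are
  continuous on \<open>U\<close>.\<close>

primrec Ck_on ::
  "nat \<Rightarrow> 'p::euclidean_space set \<Rightarrow> ('p \<Rightarrow> 'q::euclidean_space) \<Rightarrow> bool" where
  "Ck_on 0 U f = continuous_on U f"
| "Ck_on (Suc k) U f =
    (\<exists>f'. (\<forall>p\<in>U. (f has_derivative f' p) (at p)) \<and> (\<forall>v. Ck_on k U (\<lambda>p. f' p v)))"

text \<open>On an arbitrary set \<open>Q\<close>, smooth means: locally the restriction of a \<open>C\<close>-infinity map defined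
  on an open set.  This covers manifolds with boundary embedded in Euclidean space.\<close>

definition smooth_on ::
  "'p::euclidean_space set \<Rightarrow> ('p \<Rightarrow> 'q::euclidean_space) \<Rightarrow> bool" where
  "smooth_on Q f \<longleftrightarrow>
    (\<forall>p\<in>Q. \<exists>U g. open U \<and> p \<in> U \<and> (\<forall>k. Ck_on k U g) \<and> (\<forall>q\<in>Q \<inter> U. g q = f q))"

section \<open>Hypersurfaces with boundary\<close>

text \<open>The tangent space of an embedded submanifold \<open>Q\<close> at \<open>p\<close>.  The curves are one-sided and the
  span is taken so that boundary points get the full tangent space.\<close>

definition tangent_space :: "'p::euclidean_space set \<Rightarrow> 'p \<Rightarrow> 'p set" where
  "tangent_space Q p =
    span {u. \<exists>c. c 0 = p \<and> (\<forall>\<tau>\<in>{0..1}. c \<tau> \<in> Q) \<and>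
              (c has_vector_derivative u) (at 0 within {0..1::real})}"

text \<open>A Frechet derivative within a submanifold \<open>Q\<close> is determined only on tangent vectors of
  \<open>Q\<close>; all definitions below apply it to tangent vectors only.\<close>

definition smooth_immersion ::
  "'p::euclidean_space set \<Rightarrow> ('p \<Rightarrow> 'q::euclidean_space) \<Rightarrow> bool" where
  "smooth_immersion Q F \<longleftrightarrow>
    smooth_on Q F \<and>
    (\<forall>l\<in>Q. inj_on (frechet_derivative F (at l within Q)) (tangent_space Q l))"

text \<open>The ambient space of dimension \<open>n + 1\<close>, where \<open>n\<close> is \<open>CARD('n)\<close>; the first component is the
  coordinate along the axis of rotation.\<close>

type_synonym 'n space = "real \<times> (real ^ 'n)"

definition axis_of_rotation :: "'n::finite space set" where
  "axis_of_rotation = {(s, 0) | s. True}"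

definition height :: "'n::finite space \<Rightarrow> real" where
  "height p = infdist p axis_of_rotation"

text \<open>An orthonormal basis of the \<open>n\<close>-dimensional tangent space of a hypersurface \<open>Q\<close>.  The
  quantities defined from it do not depend on the choice.\<close>

definition tangent_frame :: "'n::finite space set \<Rightarrow> 'n space \<Rightarrow> 'n \<Rightarrow> 'n space" where
  "tangent_frame Q p =
    (SOME e. (\<forall>i. e i \<in> tangent_space Q p) \<and>
             (\<forall>i j. e i \<bullet> e j = (if i = j then 1 else 0)))"

text \<open>Pointing away from the axis: \<open>(0, snd p)\<close> is the vector from the nearest point of the axis
  to \<open>p\<close>.\<close>

definition outer_normal :: "'n::finite space set \<Rightarrow> 'n space \<Rightarrow> 'n space" where
  "outer_normal Q p =
    (THE N. norm N = 1 \<and> (\<forall>u\<in>tangent_space Q p. N \<bullet> u = 0) \<and> N \<bullet> (0, snd p) > 0)"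

text \<open>Sign convention: round spheres have positive principal curvatures.\<close>

definition second_fundamental_form ::
  "'n::finite space set \<Rightarrow> 'n space \<Rightarrow> 'n space \<Rightarrow> 'n space \<Rightarrow> real" where
  "second_fundamental_form Q p u w =
    frechet_derivative (outer_normal Q) (at p within Q) u \<bullet> w"

definition mean_curvature :: "'n::finite space set \<Rightarrow> 'n space \<Rightarrow> real" where
  "mean_curvature Q p =
    (\<Sum>i\<in>UNIV. second_fundamental_form Q p (tangent_frame Q p i) (tangent_frame Q p i))"

definition norm_A :: "'n::finite space set \<Rightarrow> 'n space \<Rightarrow> real" where
  "norm_A Q p =
    sqrt (\<Sum>i\<in>UNIV. \<Sum>j\<in>UNIV.
      (second_fundamental_form Q p (tangent_frame Q p i) (tangent_frame Q p j))\<^sup>2)"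

section \<open>Hypersurfaces of revolution\<close>

text \<open>The parameter manifold: the cylinder over the unit sphere of dimension \<open>n - 1\<close>.\<close>

definition cylinder :: "real \<Rightarrow> real \<Rightarrow> 'n::finite space set" where
  "cylinder a b = {a..b} \<times> sphere 0 1"

definition cylinder_boundary :: "real \<Rightarrow> real \<Rightarrow> 'n::finite space set" where
  "cylinder_boundary a b = {a, b} \<times> sphere 0 1"

definition rotate_graph :: "(real \<Rightarrow> real) \<Rightarrow> 'n::finite space \<Rightarrow> 'n space" where
  "rotate_graph r l = (fst l, r (fst l) *\<^sub>R snd l)"

text \<open>Integration over the unit sphere of dimension \<open>n - 1\<close>, via polar coordinates: the integral
  over the unit ball of the radially constant extension of \<open>\<phi>\<close> is \<open>1 / n\<close> times the integral of
  \<open>\<phi>\<close> over the sphere.\<close>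

definition sphere_integral :: "(real ^ 'n::finite \<Rightarrow> real) \<Rightarrow> real" where
  "sphere_integral \<phi> = CARD('n) * (LINT w:ball 0 1|lborel. \<phi> (sgn w))"

text \<open>The density of the induced metric of \<open>F\<close> with respect to the round metric of the cylinder:
  the square root of the determinant of the Gram matrix.\<close>

definition area_density ::
  "real \<Rightarrow> real \<Rightarrow> ('n::finite space \<Rightarrow> 'n space) \<Rightarrow> 'n space \<Rightarrow> real" where
  "area_density a b F l =
    (let dF = frechet_derivative F (at l within cylinder a b);
         e = tangent_frame (cylinder a b) l
     in sqrt (det ((\<chi> i j. dF (e i) \<bullet> dF (e j)) :: real ^ 'n ^ 'n)))"

definition hypersurface_integral ::
  "real \<Rightarrow> real \<Rightarrow> ('n::finite space \<Rightarrow> 'n space) \<Rightarrow> ('n space \<Rightarrow> real) \<Rightarrow> real" where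
  "hypersurface_integral a b F f =
    (LINT s:{a..b}|lborel. sphere_integral (\<lambda>w. f (F (s, w)) * area_density a b F (s, w)))"

section \<open>The flow\<close>

text \<open>The average of the mean curvature over the hypersurface generated by \<open>r\<close>.\<close>

definition average_mean_curvature :: "'n::finite itself \<Rightarrow> real \<Rightarrow> real \<Rightarrow> (real \<Rightarrow> real) \<Rightarrow> real" where
  "average_mean_curvature _ a b r =
    (let F = (rotate_graph r :: 'n space \<Rightarrow> 'n space)
     in hypersurface_integral a b F (mean_curvature (F ` cylinder a b)) /
        hypersurface_integral a b F (\<lambda>_. 1))"

definition slab :: "real \<Rightarrow> real \<Rightarrow> 'n::finite space set" where
  "slab a b = {p. a \<le> fst p \<and> fst p \<le> b}"

definition neumann_condition ::
  "real \<Rightarrow> real \<Rightarrow> ('n::finite space \<Rightarrow> 'n space) \<Rightarrow> bool" where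
  "neumann_condition a b F \<longleftrightarrow>
    F ` cylinder a b \<subseteq> slab a b \<and>
    F ` cylinder_boundary a b \<subseteq> frontier (slab a b) \<and>
    (\<forall>p \<in> F ` cylinder a b \<inter> frontier (slab a b).
       outer_normal (F ` cylinder a b) p \<bullet> (1, 0) = 0)"

text \<open>Regularity of the generating functions \<open>\<rho> t\<close>: smooth for positive times, and with spatial
  derivatives up to order two continuous up to time \<open>0\<close>.  Joint smoothness up to time \<open>0\<close>
  would force compatibility conditions of higher order on the initial function at \<open>a\<close> and \<open>b\<close>,
  beyond the vanishing of its first derivative.\<close>

definition regular_family :: "real \<Rightarrow> real \<Rightarrow> real \<Rightarrow> (real \<Rightarrow> real \<Rightarrow> real) \<Rightarrow> bool" where
  "regular_family a b T \<rho> \<longleftrightarrow>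
    smooth_on ({0<..<T} \<times> {a..b}) (\<lambda>(t, s). \<rho> t s) \<and>
    (\<exists>\<rho>1 \<rho>2.
      (\<forall>t\<in>{0..<T}. \<forall>s\<in>{a..b}.
         (\<rho> t has_real_derivative \<rho>1 t s) (at s within {a..b}) \<and>
         (\<rho>1 t has_real_derivative \<rho>2 t s) (at s within {a..b})) \<and>
      continuous_on ({0..<T} \<times> {a..b}) (\<lambda>(t, s). \<rho> t s) \<and>
      continuous_on ({0..<T} \<times> {a..b}) (\<lambda>(t, s). \<rho>1 t s) \<and>
      continuous_on ({0..<T} \<times> {a..b}) (\<lambda>(t, s). \<rho>2 t s))"

text \<open>\<open>x t\<close> is the immersion at time \<open>t\<close>, with image the hypersurface generated by \<open>\<rho> t\<close>.  No
  relation is imposed between the immersion \<open>x t\<close> and the parametrization \<open>rotate_graph (\<rho> t)\<close>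
  of its image.\<close>

definition axisymmetric_vpmcf ::
  "real \<Rightarrow> real \<Rightarrow> (real \<Rightarrow> real) \<Rightarrow> (real \<Rightarrow> real \<Rightarrow> real) \<Rightarrow>
   (real \<Rightarrow> 'n::finite space \<Rightarrow> 'n space) \<Rightarrow> real \<Rightarrow> bool" where
  "axisymmetric_vpmcf a b \<rho>0 \<rho> x T \<longleftrightarrow>
    (\<forall>s\<in>{a..b}. \<rho> 0 s = \<rho>0 s) \<and>
    regular_family a b T \<rho> \<and>
    smooth_on ({0<..<T} \<times> cylinder a b) (\<lambda>(t, l). x t l) \<and>
    continuous_on ({0..<T} \<times> cylinder a b) (\<lambda>(t, l). x t l) \<and>
    (\<forall>t\<in>{0..<T}.
      smooth_immersion (cylinder a b) (x t) \<and>
      (\<forall>s\<in>{a..b}. \<rho> t s > 0) \<and>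
      x t ` cylinder a b = rotate_graph (\<rho> t) ` cylinder a b \<and>
      neumann_condition a b (x t) \<and>
      (\<forall>l\<in>cylinder a b.
        ((\<lambda>\<tau>. x \<tau> l) has_vector_derivative
           - (mean_curvature (x t ` cylinder a b) (x t l)
              - average_mean_curvature TYPE('n) a b (\<rho> t))
             *\<^sub>R outer_normal (x t ` cylinder a b) (x t l))
          (at t within {0..<T})))"

text \<open>The first singular time: the flow exists on \<open>[0, T)\<close> and has no continuation to a longer
  time interval.\<close>

definition first_singular_time ::
  "real \<Rightarrow> real \<Rightarrow> (real \<Rightarrow> real) \<Rightarrow> (real \<Rightarrow> real \<Rightarrow> real) \<Rightarrow>
   (real \<Rightarrow> 'n::finite space \<Rightarrow> 'n space) \<Rightarrow> real \<Rightarrow> bool" where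
  "first_singular_time a b \<rho>0 \<rho> x T \<longleftrightarrow>
    0 < T \<and> axisymmetric_vpmcf a b \<rho>0 \<rho> x T \<and>
    \<not> (\<exists>T' \<rho>' x'. T < T' \<and> axisymmetric_vpmcf a b \<rho>0 \<rho>' x' T' \<and>
         (\<forall>t\<in>{0..<T}. \<forall>l\<in>cylinder a b. x' t l = x t l))"

end

theory Submission
  imports Defs
begin

text \<open>
  Write \<open>u(t, s)\<close> for the profile, \<open>w\<close> for its slope, \<open>v = sqrt (1 + w\<^sup>2)\<close> and \<open>m = n - 1\<close>.  The
  principal curvatures are \<open>1 / (u v)\<close>, with multiplicity \<open>m\<close>, and \<open>- psi / v\<close>, where
  \<open>psi = u'' / (1 + w\<^sup>2)\<close> is the derivative of the angle \<open>arctan w\<close>.  Where \<open>u \<ge> \<epsilon>\<close> the first one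
  is at most \<open>1 / \<epsilon>\<close>, so the point is to bound \<open>psi\<close> there.  Following a point of the parameter
  manifold shows that the profile solves
  \<open>u_t = psi - m / u + h v\<close> with \<open>w = 0\<close> at both ends (lemma \<open>graph_speed\<close>), and \<open>h\<close> is the average
  that makes \<open>\<integral> u^m u_t\<close> vanish.

  The forcing \<open>h\<close> is controlled in \<open>L\<^sup>2\<close> in time, which is a consequence of the gradient flow
  structure.  The volume is constant and the area decreases at the rate
  \<open>\<integral> (H - h)\<^sup>2\<close>.  Testing the first variation of area with the radial field gives
  \<open>h * Volume = \<integral> u^n H - \<integral> u^n (H - h)\<close>, whence \<open>h\<^sup>2 \<le> c (1 + \<integral> (H - h)\<^sup>2)\<close>.  So \<open>h\<^sup>2\<close> is
  dominated by the derivative of the bounded function \<open>c (t + Area 0 - Area t)\<close>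
  (lemma \<open>energy_barrier\<close>), and exponentials of it are barriers that stay finite up to \<open>T\<close>.

  Two maximum principle arguments follow.  For the slope one compares \<open>v (u - d)\<close>
  with such a barrier: at a touching point the cut-off terms cancel exactly, and what is left grows
  at most like \<open>m / d\<^sup>2\<close> times the quantity itself, plus \<open>h\<close>.  Hence \<open>v\<close> is bounded where \<open>u - d\<close>
  is bounded below by a positive constant (lemma \<open>gradient_bound\<close>).  For the curvature
  (lemma \<open>psi_bound_one_sided\<close>) one compares \<open>\<plusminus> psi (u - d)\<close> with \<open>K(t) (E0 - w\<^sup>2)\<close>: the reaction
  term of \<open>psi\<close> is \<open>h psi\<^sup>2 / v\<close>, and the concavity of \<open>E0 - w\<^sup>2\<close> in \<open>w\<close> produces a negative multiple of
  \<open>K psi\<^sup>2\<close> that absorbs it, at the price of \<open>h\<^sup>2\<close> in the growth rate of \<open>K\<close>.  The Neumann condition,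
  differentiated in time, makes the spatial derivative of \<open>psi\<close> vanish at the ends, so that boundary
  maxima obey the same first and second order conditions as interior ones.
\<close>

section \<open>Hypersurfaces of revolution\<close>

lemma subspace_tangent_space: "subspace (tangent_space Q p)"
  unfolding tangent_space_def by (rule subspace_span)

lemma tangent_space_curveI:
  assumes "c 0 = p" "\<And>\<tau>. \<tau> \<in> {0..1} \<Longrightarrow> c \<tau> \<in> Q"
    and "(c has_vector_derivative u) (at 0 within {0..1::real})"
  shows "u \<in> tangent_space Q p"
  unfolding tangent_space_def using assms by (intro span_base) blast

text \<open>Along a curve in \<open>Q\<close> the chain rule determines the derivative on its velocity; linearity extends
  this to the span of the velocities.  This is what makes the frame-based definitions computable
  from any derivative that happens to be at hand.\<close>

lemma derivative_within_unique_on_tangent_space: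
  fixes f :: "'p::euclidean_space \<Rightarrow> 'q::euclidean_space"
  assumes D: "(f has_derivative D) (at p within Q)" and D': "(f has_derivative D') (at p within Q)"
    and x: "x \<in> tangent_space Q p"
  shows "D x = D' x"
proof -
  have lin: "linear D" "linear D'"
    using D D' by (auto intro: has_derivative_linear)
  have curve: "D u = D' u"
    if c: "c 0 = p" "\<forall>\<tau>\<in>{0..1}. c \<tau> \<in> Q" "(c has_vector_derivative u) (at 0 within {0..1::real})"
    for c u
  proof -
    have chain: "((\<lambda>\<tau>. f (c \<tau>)) has_vector_derivative L u) (at 0 within {0..1})"
      if L: "(f has_derivative L) (at p within Q)" for L
    proof -
      have "((\<lambda>\<tau>. f (c \<tau>)) has_derivative (\<lambda>h. L (h *\<^sub>R u))) (at 0 within {0..1})"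
        using c L
        by (intro has_derivative_in_compose[OF c(3)[unfolded has_vector_derivative_def]])
           (auto intro: has_derivative_subset)
      then show ?thesis
        using has_derivative_linear[OF L] by (simp add: has_vector_derivative_def linear_cmul)
    qed
    have "at (0::real) within {0..1} \<noteq> bot"
      by (simp add: at_within_Icc_at_right)
    then show ?thesis
      using vector_derivative_unique_within chain[OF D] chain[OF D'] by blast
  qed
  show ?thesis
    using x unfolding tangent_space_def
    by (rule linear_eq_on_span[OF lin, rotated]) (auto intro: curve)
qed

lemma frechet_derivative_within_eq_on_tangent_space:
  fixes f :: "'p::euclidean_space \<Rightarrow> 'q::euclidean_space"
  assumes D: "(f has_derivative D) (at p within Q)" and x: "x \<in> tangent_space Q p"
  shows "frechet_derivative f (at p within Q) x = D x"
proof (rule derivative_within_unique_on_tangent_space[OF _ D x])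
  show "(f has_derivative frechet_derivative f (at p within Q)) (at p within Q)"
    using D by (metis differentiableI frechet_derivative_works)
qed

text \<open>A profile function on \<open>[a, b]\<close> with its first two derivatives.  The type argument fixes the
  dimension of the ambient space.\<close>

locale profile =
  fixes a b :: real and r r1 r2 :: "real \<Rightarrow> real" and ty :: "'n::finite itself"
  assumes ab: "a < b"
    and r_pos: "s \<in> {a..b} \<Longrightarrow> r s > 0"
    and r_deriv: "s \<in> {a..b} \<Longrightarrow> (r has_real_derivative r1 s) (at s within {a..b})"
    and r1_deriv: "s \<in> {a..b} \<Longrightarrow> (r1 has_real_derivative r2 s) (at s within {a..b})"
begin

definition surf :: "'n space set" where
  "surf = rotate_graph r ` cylinder a b"

definition slope :: "real \<Rightarrow> real" where
  "slope s = sqrt (1 + (r1 s)\<^sup>2)"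

lemma slope_pos: "slope s > 0"
  unfolding slope_def by (simp add: add_pos_nonneg)

lemma slope_sq: "(slope s)\<^sup>2 = 1 + (r1 s)\<^sup>2"
  unfolding slope_def by simp

lemma surf_iff: "(s, y) \<in> surf \<longleftrightarrow> s \<in> {a..b} \<and> norm y = r s"
proof
  assume "s \<in> {a..b} \<and> norm y = r s"
  moreover from this have "(s, y) = rotate_graph r (s, (1 / r s) *\<^sub>R y)" "norm ((1 / r s) *\<^sub>R y) = 1"
    using r_pos[of s] by (auto simp: rotate_graph_def)
  ultimately show "(s, y) \<in> surf"
    unfolding surf_def cylinder_def by (auto simp: image_iff) force
qed (use r_pos in \<open>force simp: surf_def cylinder_def rotate_graph_def\<close>)

lemma r_compose_derivative:
  assumes s: "s \<in> {a..b}" and c: "(c has_derivative c') (at x within X)"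
    and "c x = s" "c ` X \<subseteq> {a..b}"
  shows "((\<lambda>\<tau>. r (c \<tau>)) has_derivative (\<lambda>h. r1 s * c' h)) (at x within X)"
  using assms r_deriv[OF s]
  by (intro has_derivative_in_compose[OF c, where g' = "(*) (r1 s)"])
     (auto simp: has_field_derivative_def intro: has_derivative_subset)

text \<open>One inclusion differentiates the defining equation \<open>|y|\<^sup>2 = r(s)\<^sup>2\<close> along curves.  For the other, a
  vector orthogonal to the normal is split into a part along the profile curve and a part tangent to the sphere of
  rotation, and each part is realized by a one-sided curve inside the surface.\<close>

lemma tangent_space_surf:
  fixes w :: "real ^ 'n"
  assumes s: "s \<in> {a..b}" and w: "norm w = 1"
  shows "tangent_space surf (s, r s *\<^sub>R w) = {x. (- r1 s, w) \<bullet> x = 0}"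
proof
  let ?p = "(s, r s *\<^sub>R w)" and ?N = "(- r1 s, w)"
  have rs: "r s > 0" using r_pos s by blast
  have sub: "subspace {x. ?N \<bullet> x = 0}"
    by (rule subspace_hyperplane)
  show "tangent_space surf ?p \<subseteq> {x. ?N \<bullet> x = 0}"
    unfolding tangent_space_def
  proof (rule span_minimal[OF _ sub], safe)
    fix c :: "real \<Rightarrow> 'n space" and u1 u2
    assume c0: "c 0 = ?p" and cQ: "\<forall>\<tau>\<in>{0..1}. c \<tau> \<in> surf"
      and c': "(c has_vector_derivative (u1, u2)) (at 0 within {0..1})"
    have d: "(c has_derivative (\<lambda>h. h *\<^sub>R (u1, u2))) (at 0 within {0..1})"
      using c' by (simp add: has_vector_derivative_def)
    have d1: "((\<lambda>\<tau>. fst (c \<tau>)) has_derivative (\<lambda>h. h * u1)) (at 0 within {0..1})"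
      and d2: "((\<lambda>\<tau>. snd (c \<tau>)) has_derivative (\<lambda>h. h *\<^sub>R u2)) (at 0 within {0..1})"
      using has_derivative_fst[OF d] has_derivative_snd[OF d] by simp_all
    have im: "fst (c \<tau>) \<in> {a..b} \<and> norm (snd (c \<tau>)) = r (fst (c \<tau>))" if "\<tau> \<in> {0..1}" for \<tau>
      using cQ that surf_iff[of "fst (c \<tau>)" "snd (c \<tau>)"] by auto
    have X: "((\<lambda>\<tau>. r (fst (c \<tau>))) has_derivative (\<lambda>h. r1 s * (h * u1))) (at 0 within {0..1})"
      using im c0 by (intro r_compose_derivative[OF s d1]) auto
    have Y: "((\<lambda>\<tau>. snd (c \<tau>) \<bullet> snd (c \<tau>)) has_derivative
        (\<lambda>h. snd (c 0) \<bullet> (h *\<^sub>R u2) + (h *\<^sub>R u2) \<bullet> snd (c 0))) (at 0 within {0..1})"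
      by (rule has_derivative_inner[OF d2 d2])
    have A: "((\<lambda>\<tau>. snd (c \<tau>) \<bullet> snd (c \<tau>) - r (fst (c \<tau>)) * r (fst (c \<tau>))) has_derivative
        (\<lambda>h. (snd (c 0) \<bullet> (h *\<^sub>R u2) + (h *\<^sub>R u2) \<bullet> snd (c 0)) -
             (r s * (r1 s * (h * u1)) + r1 s * (h * u1) * r s))) (at 0 within {0..1})"
      using has_derivative_diff[OF Y has_derivative_mult[OF X X]] by (simp add: c0)
    have B: "((\<lambda>\<tau>. snd (c \<tau>) \<bullet> snd (c \<tau>) - r (fst (c \<tau>)) * r (fst (c \<tau>))) has_derivative (\<lambda>h. 0))
        (at 0 within {0..1})"
    proof (rule has_derivative_transform[of 0 _ _ "\<lambda>_. 0"])
      fix \<tau> :: real assume "\<tau> \<in> {0..1}"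
      then show "snd (c \<tau>) \<bullet> snd (c \<tau>) - r (fst (c \<tau>)) * r (fst (c \<tau>)) = 0"
        using im[of \<tau>] by (simp add: dot_square_norm power2_eq_square)
    qed auto
    have "(\<lambda>h. (snd (c 0) \<bullet> (h *\<^sub>R u2) + (h *\<^sub>R u2) \<bullet> snd (c 0)) -
             (r s * (r1 s * (h * u1)) + r1 s * (h * u1) * r s)) = (\<lambda>h::real. 0)"
      by (rule frechet_derivative_unique_within_closed_interval[of 0 "1::real" 0]) (use A B in auto)
    from fun_cong[OF this, of 1] have "2 * (r s * (w \<bullet> u2 - r1 s * u1)) = 0"
      by (simp add: c0 inner_commute algebra_simps)
    then show "?N \<bullet> (u1, u2) = 0"
      using rs by simp
  qed
  show "{x. ?N \<bullet> x = 0} \<subseteq> tangent_space surf ?p"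
  proof safe
    fix \<sigma> \<eta> assume N: "?N \<bullet> (\<sigma>, \<eta>) = 0"
    define \<zeta> where "\<zeta> = \<eta> - (r1 s * \<sigma>) *\<^sub>R w"
    have ww: "w \<bullet> w = 1" using w by (simp add: dot_square_norm)
    have wz: "w \<bullet> \<zeta> = 0" using N ww by (simp add: \<zeta>_def inner_diff_right)
    \<comment> \<open>direction along the profile curve, pointing into the interval\<close>
    define d where "d = (if s < b then b - s else a - s)"
    have d0: "d \<noteq> 0" using ab s by (auto simp: d_def)
    have dI: "s + \<tau> * d \<in> {a..b}" if "\<tau> \<in> {0..1}" for \<tau>
    proof -
      have "s + \<tau> * d = (1 - \<tau>) * s + \<tau> * (s + d)" by (simp add: algebra_simps)
      also have "\<dots> \<in> {a..b}"
        using s that ab convexD[OF convex_real_interval(5)[of a b], of s "s + d" "1 - \<tau>" \<tau>] by (auto simp: d_def)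
      finally show ?thesis .
    qed
    let ?c = "\<lambda>\<tau>. (s + \<tau> * d, r (s + \<tau> * d) *\<^sub>R w)"
    have l: "((\<lambda>\<tau>. s + \<tau> * d) has_derivative (\<lambda>h. h * d)) (at 0 within {0..1})"
      by (auto intro!: derivative_eq_intros)
    have "((\<lambda>\<tau>. r (s + \<tau> * d)) has_derivative (\<lambda>h. r1 s * (h * d))) (at 0 within {0..1})"
      using dI by (intro r_compose_derivative[OF s l]) auto
    then have "(?c has_vector_derivative (d, (r1 s * d) *\<^sub>R w)) (at 0 within {0..1})"
      unfolding has_vector_derivative_def
      by (auto intro!: derivative_eq_intros simp: algebra_simps)
    then have "(d, (r1 s * d) *\<^sub>R w) \<in> tangent_space surf ?p"
      using dI w r_pos by (intro tangent_space_curveI[of ?c]) (auto simp: surf_iff abs_of_pos)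
    then have "(\<sigma> / d) *\<^sub>R (d, (r1 s * d) *\<^sub>R w) \<in> tangent_space surf ?p"
      by (rule subspace_scale[OF subspace_tangent_space])
    then have t1: "(\<sigma>, (r1 s * \<sigma>) *\<^sub>R w) \<in> tangent_space surf ?p"
      using d0 by (simp add: mult.commute)
    \<comment> \<open>direction along the sphere of rotation\<close>
    let ?g = "\<lambda>\<tau>. w + \<tau> *\<^sub>R \<zeta>" and ?e = "\<lambda>\<tau>. (s, (r s / norm (w + \<tau> *\<^sub>R \<zeta>)) *\<^sub>R (w + \<tau> *\<^sub>R \<zeta>))"
    have nz: "w + \<tau> *\<^sub>R \<zeta> \<noteq> 0" for \<tau>
    proof
      assume "w + \<tau> *\<^sub>R \<zeta> = 0"
      then have "w \<bullet> (w + \<tau> *\<^sub>R \<zeta>) = 0" by simp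
      then show False using ww wz by (simp add: inner_add_right)
    qed
    have g: "(?g has_derivative (\<lambda>h. h *\<^sub>R \<zeta>)) (at 0 within {0..1})"
      by (auto intro!: derivative_eq_intros)
    have "((\<lambda>\<tau>. norm (?g \<tau>)) has_derivative (\<lambda>h. (h *\<^sub>R \<zeta>) \<bullet> sgn (?g 0))) (at 0 within {0..1})"
      using has_derivative_compose[OF g has_derivative_norm[of "?g 0"]] nz[of 0] by simp
    then have n: "((\<lambda>\<tau>. norm (?g \<tau>)) has_derivative (\<lambda>h. 0)) (at 0 within {0..1})"
      using wz w by (simp add: sgn_div_norm inner_commute)
    have "(?e has_vector_derivative (0, r s *\<^sub>R \<zeta>)) (at 0 within {0..1})"
      unfolding has_vector_derivative_def
      using nz w wz by (auto intro!: derivative_eq_intros n g simp: algebra_simps)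
    then have "(0, r s *\<^sub>R \<zeta>) \<in> tangent_space surf ?p"
      using s w nz rs by (intro tangent_space_curveI[of ?e]) (auto simp: surf_iff)
    then have "(1 / r s) *\<^sub>R (0, r s *\<^sub>R \<zeta>) \<in> tangent_space surf ?p"
      by (rule subspace_scale[OF subspace_tangent_space])
    then have t2: "(0, \<zeta>) \<in> tangent_space surf ?p"
      using rs by simp
    have "(\<sigma>, \<eta>) = (\<sigma>, (r1 s * \<sigma>) *\<^sub>R w) + (0, \<zeta>)"
      by (simp add: \<zeta>_def)
    then show "(\<sigma>, \<eta>) \<in> tangent_space surf ?p"
      using subspace_add[OF subspace_tangent_space t1 t2] by simp
  qed
qed

end

lemma tangent_frame_orthonormal:
  fixes Q :: "'n::finite space set"
  assumes T: "tangent_space Q p = {x. N \<bullet> x = 0}" and N: "N \<noteq> 0"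
  shows "tangent_frame Q p i \<in> tangent_space Q p"
    and "tangent_frame Q p i \<bullet> tangent_frame Q p j = (if i = j then 1 else 0)"
proof -
  have "dim {x. N \<bullet> x = 0} = CARD('n)"
    using dim_hyperplane[OF N] by simp
  moreover obtain B where B: "B \<subseteq> {x. N \<bullet> x = 0}" "pairwise orthogonal B"
    "\<And>x. x \<in> B \<Longrightarrow> norm x = 1" "independent B" "card B = dim {x. N \<bullet> x = 0}"
    using orthonormal_basis_subspace[OF subspace_hyperplane[of N]] by metis
  ultimately have "finite B" "card B = card (UNIV :: 'n set)"
    by (auto intro: independent_imp_finite)
  then obtain f where f: "bij_betw f (UNIV :: 'n set) B"
    by (metis finite_same_card_bij finite_class.finite_UNIV)
  have "\<exists>e :: 'n \<Rightarrow> 'n space. (\<forall>i. e i \<in> tangent_space Q p) \<and>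
             (\<forall>i j. e i \<bullet> e j = (if i = j then 1 else 0))"
  proof (intro exI[of _ f] conjI allI)
    show "f i \<in> tangent_space Q p" for i
      using f B T by (auto simp: bij_betw_def)
    show "f i \<bullet> f j = (if i = j then 1 else 0)" for i j
    proof (cases "i = j")
      case True
      have "f i \<in> B" using f by (auto simp: bij_betw_def)
      then have "norm (f i) = 1" by (rule B(3))
      then show ?thesis using True by (simp add: dot_square_norm)
    next
      case False
      then have "f i \<noteq> f j" "f i \<in> B" "f j \<in> B"
        using f by (auto simp: bij_betw_def inj_on_def)
      then show ?thesis
        using B(2) False by (auto simp: pairwise_def orthogonal_def)
    qed
  qed
  from someI_ex[OF this, folded tangent_frame_def]
  show "tangent_frame Q p i \<in> tangent_space Q p"
    and "tangent_frame Q p i \<bullet> tangent_frame Q p j = (if i = j then 1 else 0)" by auto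
qed

text \<open>The frame is an orthonormal basis of the hyperplane, since it has as many elements as the
  dimension.\<close>

lemma tangent_frame_parseval:
  fixes Q :: "'n::finite space set"
  assumes T: "tangent_space Q p = {x. N \<bullet> x = 0}" and N: "N \<noteq> 0" and x: "N \<bullet> x = 0"
  shows "(\<Sum>i\<in>UNIV. (tangent_frame Q p i \<bullet> x)\<^sup>2) = (norm x)\<^sup>2"
proof -
  let ?e = "tangent_frame Q p"
  note e = tangent_frame_orthonormal[OF T N]
  have inj: "inj ?e"
  proof (rule injI)
    fix i j assume "?e i = ?e j"
    then show "i = j" using e(2)[of i j] e(2)[of i i] by (auto split: if_splits)
  qed
  have orth: "pairwise orthogonal (range ?e)"
    using e(2) by (auto simp: pairwise_def orthogonal_def)
  have n1: "norm y = 1" if "y \<in> range ?e" for y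
    using that e(2) by (auto simp: norm_eq_sqrt_inner)
  have ind: "independent (range ?e)"
    using orth n1 by (intro pairwise_orthogonal_independent) (metis n1 norm_zero zero_neq_one)+
  have "range ?e \<subseteq> {x. N \<bullet> x = 0}"
    using e(1) T by auto
  moreover have "card (range ?e) \<ge> dim {x. N \<bullet> x = 0}"
    using dim_hyperplane[OF N] inj by (simp add: card_image)
  ultimately have "x \<in> span (range ?e)"
    using card_ge_dim_independent[of "range ?e" "{x. N \<bullet> x = 0}"] ind x by auto
  then have "(\<Sum>b\<in>range ?e. (b \<bullet> x) *\<^sub>R b) = x"
    using orthonormal_basis_expand[OF orth n1, of x] by (simp add: inner_commute[of _ x])
  then have xe: "(\<Sum>i\<in>UNIV. (?e i \<bullet> x) *\<^sub>R ?e i) = x"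
    using inj by (simp add: sum.reindex)
  have "(norm x)\<^sup>2 = (\<Sum>i\<in>UNIV. (?e i \<bullet> x) *\<^sub>R ?e i) \<bullet> x"
    by (simp add: xe dot_square_norm)
  also have "\<dots> = (\<Sum>i\<in>UNIV. (?e i \<bullet> x)\<^sup>2)"
    by (simp add: inner_sum_left power2_eq_square)
  finally show ?thesis by simp
qed

context profile
begin

text \<open>The principal curvatures, along the profile curve and along the spheres of rotation.\<close>

definition prin_k :: "real \<Rightarrow> real" where
  "prin_k s = - r2 s / slope s ^ 3"

definition prin_p :: "real \<Rightarrow> real" where
  "prin_p s = 1 / (r s * slope s)"

text \<open>Only multiples of \<open>(- r1, w)\<close> are orthogonal to the tangent hyperplane; norm and sign leave one.\<close>

lemma outer_normal_surf:
  fixes w :: "real ^ 'n"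
  assumes s: "s \<in> {a..b}" and w: "norm w = 1"
  shows "outer_normal surf (s, r s *\<^sub>R w) = (1 / slope s) *\<^sub>R (- r1 s, w)"
proof -
  let ?N = "(- r1 s, w)"
  have rs: "r s > 0" using r_pos s by blast
  have ww: "w \<bullet> w = 1" using w by (simp add: dot_square_norm)
  then have NN: "?N \<bullet> ?N = (slope s)\<^sup>2"
    unfolding slope_sq by (simp add: power2_eq_square)
  note T = tangent_space_surf[OF s w]
  show ?thesis
    unfolding outer_normal_def T
  proof (rule the_equality)
    have "norm ?N = slope s"
      using NN slope_pos[of s] by (simp add: norm_eq_sqrt_inner del: inner_Pair)
    then show "norm ((1 / slope s) *\<^sub>R ?N) = 1 \<and> (\<forall>u\<in>{x. ?N \<bullet> x = 0}. (1 / slope s) *\<^sub>R ?N \<bullet> u = 0) \<and>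
        0 < (1 / slope s) *\<^sub>R ?N \<bullet> (0, snd (s, r s *\<^sub>R w))"
      using rs slope_pos[of s] ww by (auto simp del: inner_Pair scaleR_Pair) (simp add: inner_Pair)
  next
    fix M :: "'n space"
    assume M: "norm M = 1 \<and> (\<forall>u\<in>{x. ?N \<bullet> x = 0}. M \<bullet> u = 0) \<and> 0 < M \<bullet> (0, snd (s, r s *\<^sub>R w))"
    define c where "c = (?N \<bullet> M) / (slope s)\<^sup>2"
    have "?N \<bullet> (M - c *\<^sub>R ?N) = 0"
      using slope_pos[of s] by (simp add: inner_diff_right NN c_def del: inner_Pair scaleR_Pair)
    moreover from this have "M \<bullet> (M - c *\<^sub>R ?N) = 0"
      by (intro bspec[OF conjunct1[OF conjunct2[OF M]]] CollectI)
    ultimately have "(M - c *\<^sub>R ?N) \<bullet> (M - c *\<^sub>R ?N) = 0"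
      by (simp only: inner_diff_left[of M] inner_scaleR_left)
    then have Mc: "M = c *\<^sub>R ?N"
      by (simp only: inner_eq_zero_iff right_minus_eq)
    have "0 < c * r s"
      using conjunct2[OF conjunct2[OF M]] ww by (simp add: Mc mult.commute)
    then have "c > 0" using rs by (simp add: zero_less_mult_iff)
    moreover have "(c * slope s)\<^sup>2 = 1"
    proof -
      have "(norm M)\<^sup>2 = c\<^sup>2 * (?N \<bullet> ?N)"
        by (simp only: power2_norm_eq_inner Mc inner_scaleR_left inner_scaleR_right) (simp add: power2_eq_square)
      then show ?thesis by (simp only: conjunct1[OF M] NN power_mult_distrib one_power2)
    qed
    moreover have "c * slope s > 0"
      using \<open>c > 0\<close> slope_pos[of s] by (rule mult_pos_pos)
    ultimately have "c * slope s = 1"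
      unfolding power2_eq_1_iff by linarith
    then have "c = 1 / slope s"
      using slope_pos[of s] by (simp add: field_simps)
    then show "M = (1 / slope s) *\<^sub>R ?N"
      by (simp only: Mc)
  qed
qed

lemma slope_deriv:
  assumes "s \<in> {a..b}"
  shows "(slope has_real_derivative r1 s * r2 s / slope s) (at s within {a..b})"
proof -
  have "((\<lambda>s. 1 + (r1 s)\<^sup>2) has_real_derivative 2 * r1 s * r2 s) (at s within {a..b})"
    by (auto intro!: derivative_eq_intros r1_deriv[OF assms])
  from DERIV_chain2[OF DERIV_real_sqrt this] show ?thesis
    unfolding slope_def by (simp add: add_pos_nonneg divide_simps)
qed

lemma normal_components_deriv:
  assumes s: "s \<in> {a..b}"
  shows "((\<lambda>s. - r1 s / slope s) has_real_derivative prin_k s) (at s within {a..b})"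
    and "((\<lambda>s. 1 / (slope s * r s)) has_real_derivative
           - (r1 s / ((r s)\<^sup>2 * slope s) + r1 s * r2 s / (r s * slope s ^ 3))) (at s within {a..b})"
proof -
  have p: "slope s > 0" "r s > 0" "(slope s)\<^sup>2 = 1 + (r1 s)\<^sup>2"
    using slope_pos slope_sq r_pos s by auto
  have "(- r2 s * slope s - - r1 s * (r1 s * r2 s / slope s)) / (slope s * slope s) = prin_k s"
  proof -
    have "- r2 s * slope s - - r1 s * (r1 s * r2 s / slope s) = - r2 s * ((slope s)\<^sup>2 - (r1 s)\<^sup>2) / slope s"
      using p by (simp add: field_simps power2_eq_square)
    then show ?thesis using p(1) unfolding p(3) prin_k_def by (simp add: power3_eq_cube)
  qed
  then show "((\<lambda>s. - r1 s / slope s) has_real_derivative prin_k s) (at s within {a..b})"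
    using DERIV_divide[OF DERIV_minus[OF r1_deriv[OF s]] slope_deriv[OF s]] p(1) by simp
  show "((\<lambda>s. 1 / (slope s * r s)) has_real_derivative
           - (r1 s / ((r s)\<^sup>2 * slope s) + r1 s * r2 s / (r s * slope s ^ 3))) (at s within {a..b})"
    using DERIV_divide[OF DERIV_const[of 1] DERIV_mult[OF slope_deriv[OF s] r_deriv[OF s]]] p(1,2)
    by (simp add: field_simps power2_eq_square power3_eq_cube)
qed

lemma compose_fst_deriv:
  fixes w :: "real ^ 'n"
  assumes s: "s \<in> {a..b}" and g: "(g has_real_derivative g') (at s within {a..b})"
  shows "((\<lambda>q. g (fst q)) has_derivative (\<lambda>x. g' * fst x)) (at (s, r s *\<^sub>R w) within surf)"
proof -
  have "fst ` surf \<subseteq> {a..b}"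
    using surf_iff by force
  then show ?thesis
    using g unfolding has_field_derivative_def
    by (intro has_derivative_in_compose[OF has_derivative_fst[OF has_derivative_ident], where g' = "(*) g'"])
       (simp add: has_derivative_subset)
qed

text \<open>On the surface the unit normal at \<open>(s, y)\<close> is \<open>(- r1 / slope, y / (r * slope))\<close>, where \<open>y / r\<close> replaces
  the direction of \<open>y\<close>.  This expression is differentiable within the surface, and its derivative acts
  as \<open>prin_k\<close> on the direction of the profile curve and as \<open>prin_p\<close> on its complement.\<close>

lemma second_fundamental_form_surf:
  fixes w :: "real ^ 'n"
  assumes s: "s \<in> {a..b}" and w: "norm w = 1"
    and x: "(- r1 s, w) \<bullet> x = 0" and y: "(- r1 s, w) \<bullet> y = 0"
  shows "second_fundamental_form surf (s, r s *\<^sub>R w) x y =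
    prin_p s * (x \<bullet> y) + (prin_k s - prin_p s) * (slope s)\<^sup>2 * (fst x * fst y)"
proof -
  let ?p = "(s, r s *\<^sub>R w)"
  let ?g1 = "\<lambda>s. - r1 s / slope s" and ?g2 = "\<lambda>s. 1 / (slope s * r s)"
  let ?g2' = "- (r1 s / ((r s)\<^sup>2 * slope s) + r1 s * r2 s / (r s * slope s ^ 3))"
  let ?D = "\<lambda>x. (prin_k s * fst x, ?g2 s *\<^sub>R snd x + (?g2' * fst x) *\<^sub>R (r s *\<^sub>R w))"
  have pos: "slope s > 0" "r s > 0" "(slope s)\<^sup>2 = 1 + (r1 s)\<^sup>2"
    using slope_pos slope_sq r_pos s by auto
  have ps: "?p \<in> surf" using s w pos by (simp add: surf_iff)
  have normal: "outer_normal surf q = (?g1 (fst q), ?g2 (fst q) *\<^sub>R snd q)" if "q \<in> surf" for q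
  proof -
    obtain t y where ty: "q = (t, y)" by (cases q)
    then have q: "q = (t, y)" "t \<in> {a..b}" "norm y = r t"
      using that surf_iff by auto
    then have "norm ((1 / r t) *\<^sub>R y) = 1"
      using r_pos[of t] by auto
    then show ?thesis
      using outer_normal_surf[of t "(1 / r t) *\<^sub>R y"] q r_pos[of t] by simp
  qed
  have "((\<lambda>q. (?g1 (fst q), ?g2 (fst q) *\<^sub>R snd q)) has_derivative ?D) (at ?p within surf)"
    using has_derivative_Pair[OF compose_fst_deriv[OF s normal_components_deriv(1)[OF s], of w]
        has_derivative_scaleR[OF compose_fst_deriv[OF s normal_components_deriv(2)[OF s], of w]
          has_derivative_snd[OF has_derivative_ident]]]
    by (simp only: fst_conv snd_conv)
  then have "(outer_normal surf has_derivative ?D) (at ?p within surf)"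
    by (rule has_derivative_transform[OF ps, rotated]) (auto simp: normal)
  then have II: "second_fundamental_form surf ?p x y = ?D x \<bullet> y"
    unfolding second_fundamental_form_def
    by (subst frechet_derivative_within_eq_on_tangent_space) (simp_all only: tangent_space_surf[OF s w] mem_Collect_eq x)
  obtain x1 x2 y1 y2 where xy: "x = (x1, x2)" "y = (y1, y2)"
    by (cases x, cases y)
  have wx: "w \<bullet> x2 = r1 s * x1" and wy: "w \<bullet> y2 = r1 s * y1"
    using x y xy by auto
  have "?D x \<bullet> y = prin_k s * x1 * y1 + ?g2 s * (x2 \<bullet> y2) + ?g2' * x1 * (r s * (r1 s * y1))"
    by (simp add: xy wy algebra_simps)
  also have "\<dots> = prin_p s * (x1 * y1 + x2 \<bullet> y2) + (prin_k s - prin_p s) * (slope s)\<^sup>2 * (x1 * y1)"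
  proof -
    define v c q where "v = slope s" and "c = 1 / v" and "q = 1 / r s"
    have v: "v \<noteq> 0" "v * c = 1" "v * v = 1 + r1 s * r1 s" and q: "q * r s = 1"
      using pos by (auto simp: v_def c_def q_def power2_eq_square)
    have e: "prin_k s = - r2 s * c * c * c" "?g2 s = q * c" "prin_p s = q * c"
      "?g2' = - (r1 s * q * q * c + r1 s * r2 s * q * c * c * c)"
      by (simp_all add: prin_k_def prin_p_def v_def c_def q_def power2_eq_square power3_eq_cube)
    show ?thesis
      unfolding e unfolding v_def[symmetric] power2_eq_square using v q by algebra
  qed
  finally show ?thesis
    unfolding II by (simp only: xy fst_conv snd_conv inner_Pair inner_real_def)
qed

text \<open>The trace is \<open>n * prin_p + (prin_k - prin_p) * |\<tau>|\<^sup>2\<close> for the unit tangent \<open>\<tau>\<close> of the profile curve,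
  and Parseval's identity evaluates the last factor.\<close>

lemma mean_curvature_surf:
  fixes w :: "real ^ 'n"
  assumes s: "s \<in> {a..b}" and w: "norm w = 1"
  shows "mean_curvature surf (s, r s *\<^sub>R w) = prin_k s + (CARD('n) - 1) * prin_p s"
proof -
  let ?p = "(s, r s *\<^sub>R w)" and ?N = "(- r1 s, w)"
  let ?e = "tangent_frame surf ?p"
  have N0: "?N \<noteq> 0" using w by (auto simp: zero_prod_def)
  note T = tangent_space_surf[OF s w]
  note e = tangent_frame_orthonormal[OF T N0]
  have eN: "?N \<bullet> ?e i = 0" for i using e(1)[of i] unfolding T by simp
  let ?\<tau> = "(1 :: real, r1 s *\<^sub>R w)"
  have ww: "w \<bullet> w = 1" using w by (simp add: dot_square_norm)
  have tau: "?e i \<bullet> ?\<tau> = (slope s)\<^sup>2 * fst (?e i)" for i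
    using eN[of i] unfolding slope_sq
    by (cases "?e i") (simp add: inner_commute power2_eq_square algebra_simps)
  have nt: "(norm ?\<tau>)\<^sup>2 = (slope s)\<^sup>2"
    by (simp add: power2_norm_eq_inner ww slope_sq) (simp add: power2_eq_square)
  have "(\<Sum>i\<in>UNIV. (?e i \<bullet> ?\<tau>)\<^sup>2) = (norm ?\<tau>)\<^sup>2"
    by (rule tangent_frame_parseval[OF T N0]) (simp add: ww)
  then have "(slope s)\<^sup>2 * ((slope s)\<^sup>2 * (\<Sum>i\<in>UNIV. (fst (?e i))\<^sup>2)) = (slope s)\<^sup>2"
    unfolding tau
    by (simp add: power_mult_distrib sum_distrib_left nt power2_eq_square[of "(slope s)\<^sup>2"] mult.assoc)
  then have par: "(slope s)\<^sup>2 * (\<Sum>i\<in>UNIV. (fst (?e i))\<^sup>2) = 1"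
    using slope_pos[of s] by (metis mult_cancel_left2 less_irrefl power_not_zero)
  have "mean_curvature surf ?p = (\<Sum>i\<in>UNIV. prin_p s + (prin_k s - prin_p s) * ((slope s)\<^sup>2 * (fst (?e i))\<^sup>2))"
    unfolding mean_curvature_def
    by (rule sum.cong[OF refl], subst second_fundamental_form_surf[OF s w eN eN])
       (simp add: e(2) power2_eq_square)
  also have "\<dots> = CARD('n) * prin_p s + (prin_k s - prin_p s) * ((slope s)\<^sup>2 * (\<Sum>i\<in>UNIV. (fst (?e i))\<^sup>2))"
    by (simp add: sum.distrib sum_distrib_left)
  finally show ?thesis
    by (simp add: par algebra_simps of_nat_diff)
qed

text \<open>Each matrix entry is bounded separately; the loss of a constant does not affect boundedness.\<close>

lemma norm_A_surf_le:
  fixes w :: "real ^ 'n"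
  assumes s: "s \<in> {a..b}" and w: "norm w = 1"
  shows "norm_A surf (s, r s *\<^sub>R w) \<le> CARD('n) * (2 * \<bar>prin_p s\<bar> + \<bar>prin_k s\<bar>)"
proof -
  let ?p = "(s, r s *\<^sub>R w)" and ?N = "(- r1 s, w)"
  let ?e = "tangent_frame surf ?p"
  have N0: "?N \<noteq> 0" using w by (auto simp: zero_prod_def)
  note T = tangent_space_surf[OF s w]
  note e = tangent_frame_orthonormal[OF T N0]
  have eN: "?N \<bullet> ?e i = 0" for i using e(1)[of i] unfolding T by simp
  have fst_le: "\<bar>slope s * fst (?e i)\<bar> \<le> 1" for i
  proof -
    have "w \<bullet> snd (?e i) = r1 s * fst (?e i)"
      using eN[of i] by (cases "?e i") simp
    moreover have "\<bar>w \<bullet> snd (?e i)\<bar> \<le> norm (snd (?e i))"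
      using Cauchy_Schwarz_ineq2[of w "snd (?e i)"] w by simp
    ultimately have "(r1 s * fst (?e i))\<^sup>2 \<le> (norm (snd (?e i)))\<^sup>2"
      by (metis abs_le_square_iff abs_norm_cancel)
    moreover have "(fst (?e i))\<^sup>2 + (norm (snd (?e i)))\<^sup>2 = 1"
      using e(2)[of i i] by (cases "?e i") (simp add: power2_norm_eq_inner, simp add: power2_eq_square)
    ultimately have "(slope s * fst (?e i))\<^sup>2 \<le> 1"
      by (simp add: power_mult_distrib slope_sq distrib_right)
    then show ?thesis by (simp add: abs_square_le_1)
  qed
  let ?B = "2 * \<bar>prin_p s\<bar> + \<bar>prin_k s\<bar>"
  have sum_le: "\<lbrakk>\<bar>A\<bar> \<le> \<bar>p\<bar> * 1; \<bar>B\<bar> \<le> \<bar>k - p\<bar> * 1\<rbrakk> \<Longrightarrow> \<bar>A + B\<bar> \<le> 2 * \<bar>p\<bar> + \<bar>k\<bar>" for A B p k :: real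
    by (smt (verit))
  have II: "\<bar>second_fundamental_form surf ?p (?e i) (?e j)\<bar> \<le> ?B" for i j
  proof -
    have "\<bar>(slope s * fst (?e i)) * (slope s * fst (?e j))\<bar> \<le> 1"
      using mult_mono[OF fst_le[of i] fst_le[of j]] by (simp add: abs_mult)
    then have f: "\<bar>(slope s)\<^sup>2 * (fst (?e i) * fst (?e j))\<bar> \<le> 1"
      by (simp only: power2_eq_square mult_ac)
    have d: "\<bar>?e i \<bullet> ?e j\<bar> \<le> 1"
      by (simp add: e(2))
    have "\<bar>prin_p s * (?e i \<bullet> ?e j)\<bar> \<le> \<bar>prin_p s\<bar> * 1"
      unfolding abs_mult[of "prin_p s"] using d by (rule mult_left_mono) simp
    moreover have "\<bar>(prin_k s - prin_p s) * ((slope s)\<^sup>2 * (fst (?e i) * fst (?e j)))\<bar> \<le> \<bar>prin_k s - prin_p s\<bar> * 1"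
      unfolding abs_mult[of "prin_k s - prin_p s"] using f by (rule mult_left_mono) simp
    ultimately show ?thesis
      unfolding second_fundamental_form_surf[OF s w eN eN] mult.assoc by (rule sum_le)
  qed
  have "(\<Sum>i\<in>UNIV. \<Sum>j\<in>UNIV. (second_fundamental_form surf ?p (?e i) (?e j))\<^sup>2)
     \<le> (\<Sum>i\<in>(UNIV::'n set). \<Sum>j\<in>(UNIV::'n set). ?B\<^sup>2)"
    using II by (intro sum_mono) (simp add: abs_le_square_iff[symmetric])
  also have "\<dots> = (CARD('n) * ?B)\<^sup>2"
    by (simp add: power2_eq_square)
  finally show ?thesis
    unfolding norm_A_def by (intro real_le_lsqrt) (auto simp: sum_nonneg)
qed

end

section \<open>Area and average mean curvature\<close>

text \<open>An orthogonal matrix whose column \<open>k\<close> is \<open>\<sigma>\<close> conjugates \<open>c I + d \<sigma> \<sigma>\<^sup>T\<close> to a diagonal matrix.\<close>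

lemma det_scalar_plus_rank_one:
  fixes \<sigma> :: "real ^ 'n"
  assumes \<sigma>: "(\<Sum>i\<in>UNIV. (\<sigma> $ i)\<^sup>2) = 1"
  shows "det (\<chi> i j. c * (if i = j then 1 else 0) + d * (\<sigma> $ i * \<sigma> $ j)) = c ^ (CARD('n) - 1) * (c + d)"
proof -
  let ?M = "(\<chi> i j. c * (if i = j then 1 else 0) + d * (\<sigma> $ i * \<sigma> $ j)) :: real ^ 'n ^ 'n"
  define k :: 'n where "k = undefined"
  have "norm \<sigma> = 1"
    using \<sigma> by (simp add: norm_vec_def L2_set_def)
  then obtain A where A: "orthogonal_matrix A" "A *v axis k 1 = \<sigma>"
    using orthogonal_matrix_exists_basis by metis
  let ?D = "(\<chi> i j. if i = j then (if i = k then c + d else c) else 0) :: real ^ 'n ^ 'n"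
  have Ak: "\<sigma> $ l = A $ l $ k" for l
    by (simp add: A(2)[symmetric] matrix_vector_mul_component row_def inner_axis)
  have "(transpose A ** A) $ k $ j = mat 1 $ k $ j" for j
    using A(1) by (simp add: orthogonal_matrix_def)
  then have orth: "(\<Sum>l\<in>UNIV. \<sigma> $ l * A $ l $ j) = (if k = j then 1 else 0)" for j
    by (simp add: matrix_matrix_mult_def transpose_def mat_def Ak)
  have "(?M ** A) $ i $ j = (A ** ?D) $ i $ j" for i j
  proof -
    have "(?M ** A) $ i $ j = (\<Sum>l\<in>UNIV. (if i = l then c * A $ l $ j else 0) + d * \<sigma> $ i * (\<sigma> $ l * A $ l $ j))"
      by (simp add: matrix_matrix_mult_def) (intro sum.cong refl, auto simp: algebra_simps)
    also have "\<dots> = c * A $ i $ j + d * \<sigma> $ i * (if k = j then 1 else 0)"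
      unfolding sum.distrib sum_distrib_left[symmetric] orth by simp
    also have "\<dots> = (\<Sum>l\<in>UNIV. if l = j then A $ i $ l * (if l = k then c + d else c) else 0)"
      by (simp add: Ak algebra_simps)
    also have "\<dots> = (A ** ?D) $ i $ j"
      unfolding matrix_matrix_mult_def vec_lambda_beta by (intro sum.cong refl) auto
    finally show ?thesis .
  qed
  then have "?M ** A = A ** ?D" by (simp add: vec_eq_iff)
  then have "det (?M ** A) = det (A ** ?D)" by (rule arg_cong)
  then have "det ?M * det A = det A * det ?D" by (simp only: det_mul)
  moreover have "det A \<noteq> 0"
    using det_orthogonal_matrix[OF A(1)] by auto
  ultimately have "det ?M = det ?D" by simp
  also have "\<dots> = (\<Prod>i\<in>UNIV. if i = k then c + d else c)"
    by (subst det_diagonal) auto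
  also have "\<dots> = (c + d) * (\<Prod>i\<in>UNIV - {k}. c)"
    by (subst prod.remove[of _ k]) (auto intro!: prod.cong)
  finally show ?thesis by (simp add: card_Diff_singleton)
qed

text \<open>The extension \<open>\<phi> (sgn w)\<close> is constant except possibly at the centre of the ball, where \<open>sgn\<close>
  leaves the sphere.\<close>

lemma sphere_integral_const:
  fixes \<phi> :: "real ^ 'n::finite \<Rightarrow> real"
  assumes "\<And>w. norm w = 1 \<Longrightarrow> \<phi> w = K"
  shows "sphere_integral \<phi> = CARD('n) * measure lborel (ball (0 :: real ^ 'n) 1) * K"
proof -
  have sgn: "\<phi> (sgn w) = K + (\<phi> 0 - K) * indicator {0} w" for w
    using assms[of "sgn w"] by (cases "w = 0") (auto simp: norm_sgn)
  have "AE w :: real ^ 'n in lborel. w \<noteq> 0"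
    using AE_lborel_singleton[of "0 :: real ^ 'n"] by simp
  then have "(LINT w:ball 0 1|lborel. \<phi> (sgn w)) = (LINT w:ball (0 :: real ^ 'n) 1|lborel. K)"
    unfolding set_lebesgue_integral_def sgn
    by (intro integral_cong_AE borel_measurable_scaleR borel_measurable_add borel_measurable_times
          borel_measurable_const borel_measurable_indicator) (auto elim!: eventually_mono)
  also have "\<dots> = measure lborel (ball (0 :: real ^ 'n) 1) * K"
    unfolding set_lebesgue_integral_def by simp
  finally show ?thesis by (simp add: sphere_integral_def)
qed

context profile
begin

text \<open>The cylinder is the surface of revolution with constant profile \<open>1\<close>.\<close>

lemma tangent_space_cylinder:
  fixes w :: "real ^ 'n"
  assumes s: "s \<in> {a..b}" and w: "norm w = 1"
  shows "tangent_space (cylinder a b) (s, w) = {x. (0, w) \<bullet> x = 0}"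
proof -
  interpret C: profile a b "\<lambda>_. 1" "\<lambda>_. 0" "\<lambda>_. 0" ty
    by unfold_locales (use ab in auto)
  have "C.surf = cylinder a b"
    unfolding C.surf_def by (simp add: rotate_graph_def)
  then show ?thesis
    using C.tangent_space_surf[OF s w] by simp
qed

text \<open>In an orthonormal frame of the cylinder the Gram matrix is \<open>r\<^sup>2 I\<close> plus a rank one matrix whose
  vector collects the axial components of the frame.\<close>

lemma area_density_rotate_graph:
  fixes w :: "real ^ 'n"
  assumes s: "s \<in> {a..b}" and w: "norm w = 1"
  shows "area_density a b (rotate_graph r) (s, w) = r s ^ (CARD('n) - 1) * slope s"
proof -
  let ?N = "(0 :: real, w)"
  let ?e = "tangent_frame (cylinder a b) (s, w)"
  let ?D = "\<lambda>x :: 'n space. (fst x, r s *\<^sub>R snd x + (r1 s * fst x) *\<^sub>R w)"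
  have ww: "w \<bullet> w = 1" using w by (simp add: dot_square_norm)
  have N0: "?N \<noteq> 0" using w by (auto simp: zero_prod_def)
  note T = tangent_space_cylinder[OF s w]
  note e = tangent_frame_orthonormal[OF T N0]
  have eN: "w \<bullet> snd (?e i) = 0" for i
    using e(1)[of i] unfolding T by (cases "?e i") simp
  define \<sigma> where "\<sigma> = (\<chi> i. fst (?e i))"
  have "(\<Sum>i\<in>UNIV. (?e i \<bullet> (1, 0))\<^sup>2) = (norm (1 :: real, 0 :: real ^ 'n))\<^sup>2"
    by (rule tangent_frame_parseval[OF T N0]) simp
  moreover have "?e i \<bullet> (1, 0) = \<sigma> $ i" for i
    by (cases "?e i") (simp add: \<sigma>_def)
  ultimately have \<sigma>: "(\<Sum>i\<in>UNIV. (\<sigma> $ i)\<^sup>2) = 1"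
    by (simp add: norm_Pair)
  have "((\<lambda>q. r (fst q)) has_derivative (\<lambda>x. r1 s * fst x)) (at (s, w) within cylinder a b)"
    by (rule r_compose_derivative[OF s has_derivative_fst[OF has_derivative_ident]])
       (auto simp: cylinder_def)
  from has_derivative_Pair[OF has_derivative_fst[OF has_derivative_ident]
      has_derivative_scaleR[OF this has_derivative_snd[OF has_derivative_ident]]]
  have "(rotate_graph r has_derivative ?D) (at (s, w) within cylinder a b)"
    unfolding rotate_graph_def[abs_def] by (simp only: fst_conv snd_conv)
  then have dF: "frechet_derivative (rotate_graph r) (at (s, w) within cylinder a b) (?e i) = ?D (?e i)" for i
    using e(1) by (rule frechet_derivative_within_eq_on_tangent_space)
  have "?D (?e i) \<bullet> ?D (?e j) =
      (r s)\<^sup>2 * (if i = j then 1 else 0) + ((slope s)\<^sup>2 - (r s)\<^sup>2) * (\<sigma> $ i * \<sigma> $ j)" for i j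
  proof -
    have "?D (?e i) \<bullet> ?D (?e j) = (r s)\<^sup>2 * (?e i \<bullet> ?e j) + ((slope s)\<^sup>2 - (r s)\<^sup>2) * (fst (?e i) * fst (?e j))"
    proof -
      obtain x1 x2 y1 y2 where xy: "?e i = (x1, x2)" "?e j = (y1, y2)"
        by (cases "?e i", cases "?e j")
      have "w \<bullet> x2 = 0" "w \<bullet> y2 = 0" "x2 \<bullet> w = 0" "y2 \<bullet> w = 0"
        using eN[of i] eN[of j] xy by (simp_all add: inner_commute)
      then show ?thesis
        unfolding slope_sq xy fst_conv snd_conv inner_Pair
        by (simp add: inner_add_left inner_add_right ww) (simp add: power2_eq_square algebra_simps)
    qed
    then show ?thesis by (simp only: e(2) \<sigma>_def vec_lambda_beta)
  qed
  then have "area_density a b (rotate_graph r) (s, w) =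
      sqrt (det (\<chi> i j. (r s)\<^sup>2 * (if i = j then 1 else 0) + ((slope s)\<^sup>2 - (r s)\<^sup>2) * (\<sigma> $ i * \<sigma> $ j)))"
    unfolding area_density_def Let_def dF by simp
  also have "\<dots> = sqrt (((r s)\<^sup>2) ^ (CARD('n) - 1) * (slope s)\<^sup>2)"
    unfolding det_scalar_plus_rank_one[OF \<sigma>] by simp
  also have "\<dots> = sqrt ((r s ^ (CARD('n) - 1) * slope s)\<^sup>2)"
    by (simp add: power_mult_distrib power_mult[symmetric] mult.commute)
  finally show ?thesis
    using r_pos[OF s] slope_pos[of s] by simp
qed

lemma hypersurface_integral_rotate_graph:
  assumes f: "\<And>s w. s \<in> {a..b} \<Longrightarrow> norm w = 1 \<Longrightarrow> f (s, r s *\<^sub>R w :: real ^ 'n) = g s"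
    and cont: "continuous_on {a..b} g"
  shows "hypersurface_integral a b (rotate_graph r :: 'n space \<Rightarrow> 'n space) f =
    CARD('n) * measure lborel (ball (0 :: real ^ 'n) 1) *
    integral {a..b} (\<lambda>s. g s * (r s ^ (CARD('n) - 1) * slope s))"
proof -
  let ?c = "CARD('n) * measure lborel (ball (0 :: real ^ 'n) 1)"
  let ?h = "\<lambda>s. g s * (r s ^ (CARD('n) - 1) * slope s)"
  have "continuous_on {a..b} r" "continuous_on {a..b} slope"
    using DERIV_continuous_on[OF r_deriv] DERIV_continuous_on[OF slope_deriv] by auto
  then have "continuous_on {a..b} ?h"
    using cont by (intro continuous_intros)
  then have int: "set_integrable lborel {a..b} ?h"
    by (rule borel_integrable_atLeastAtMost')
  have "hypersurface_integral a b (rotate_graph r :: 'n space \<Rightarrow> 'n space) f = (LINT s:{a..b}|lborel. ?c * ?h s)"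
    unfolding hypersurface_integral_def
  proof (rule set_lebesgue_integral_cong, simp, safe)
    fix s assume s: "s \<in> {a..b}"
    show "sphere_integral (\<lambda>w. f (rotate_graph r (s, w)) * area_density a b (rotate_graph r) (s, w :: real ^ 'n)) = ?c * ?h s"
      by (rule sphere_integral_const)
         (simp only: area_density_rotate_graph[OF s] f[OF s] rotate_graph_def fst_conv snd_conv)
  qed
  also have "\<dots> = ?c * (LINT s:{a..b}|lborel. ?h s)"
    by (rule set_integral_mult_right)
  finally show ?thesis
    using set_borel_integral_eq_integral(2)[OF int] by simp
qed

lemma average_mean_curvature_eq:
  assumes "continuous_on {a..b} r2"
  shows "average_mean_curvature TYPE('n) a b r =
    integral {a..b} (\<lambda>s. (prin_k s + (CARD('n) - 1) * prin_p s) * (r s ^ (CARD('n) - 1) * slope s)) /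
    integral {a..b} (\<lambda>s. r s ^ (CARD('n) - 1) * slope s)"
proof -
  have c: "continuous_on {a..b} r" "continuous_on {a..b} slope"
    using DERIV_continuous_on[OF r_deriv] DERIV_continuous_on[OF slope_deriv] by auto
  have "slope s \<noteq> 0" for s using slope_pos[of s] by simp
  then have "continuous_on {a..b} (\<lambda>s. prin_k s + (CARD('n) - 1) * prin_p s)"
    unfolding prin_k_def prin_p_def using assms c r_pos by (intro continuous_intros) force+
  note A = hypersurface_integral_rotate_graph[OF _ this, of "mean_curvature surf"]
  note B = hypersurface_integral_rotate_graph[of "\<lambda>_. 1" "\<lambda>_. 1"]
  have "measure lborel (ball (0 :: real ^ 'n) 1) > 0"
    by simp
  then show ?thesis
    unfolding average_mean_curvature_def Let_def surf_def[symmetric]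
    by (subst A, simp add: mean_curvature_surf, subst B) auto
qed

end

section \<open>Smooth functions on a space-time strip\<close>

lemma Ck_on_cong:
  assumes "open U" "\<And>p. p \<in> U \<Longrightarrow> f p = g p" "Ck_on k U f"
  shows "Ck_on k U g"
proof (cases k)
  case 0
  then show ?thesis using assms by (simp cong: continuous_on_cong)
next
  case (Suc k')
  then obtain f' where f': "\<And>p. p \<in> U \<Longrightarrow> (f has_derivative f' p) (at p)" "\<And>v. Ck_on k' U (\<lambda>p. f' p v)"
    using assms(3) by auto
  have "(g has_derivative f' p) (at p)" if "p \<in> U" for p
    using has_derivative_transform_within_open[OF f'(1) assms(1)] that assms(2) by blast
  then show ?thesis using f'(2) Suc by auto
qed

text \<open>Each \<open>k\<close> comes with its own choice of derivative; uniqueness on open sets allows one derivative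
  to serve all \<open>k\<close>.\<close>

lemma Ck_on_frechet_derivative:
  assumes U: "open U" and g: "\<And>k. Ck_on k U g"
  shows "p \<in> U \<Longrightarrow> (g has_derivative frechet_derivative g (at p)) (at p)"
    and "Ck_on k U (\<lambda>p. frechet_derivative g (at p) v)"
proof -
  have D: "\<exists>g'. (\<forall>p\<in>U. (g has_derivative g' p) (at p)) \<and> (\<forall>v. Ck_on k U (\<lambda>p. g' p v))" for k
    using g[of "Suc k"] by simp
  then show "p \<in> U \<Longrightarrow> (g has_derivative frechet_derivative g (at p)) (at p)"
    by (metis frechet_derivative_at)
  obtain g' where g': "\<And>p. p \<in> U \<Longrightarrow> (g has_derivative g' p) (at p)" "\<And>v. Ck_on k U (\<lambda>p. g' p v)"
    using D[of k] by blast
  have "g' p v = frechet_derivative g (at p) v" if "p \<in> U" for p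
    using frechet_derivative_at[OF g'(1)[OF that]] by simp
  then show "Ck_on k U (\<lambda>p. frechet_derivative g (at p) v)"
    by (intro Ck_on_cong[OF U _ g'(2)])
qed

lemma smooth_on_imp_continuous_on:
  assumes "smooth_on Q f"
  shows "continuous_on Q f"
  unfolding continuous_on_eq_continuous_within
proof
  fix p assume p: "p \<in> Q"
  then obtain U g where U: "open U" "p \<in> U" and g: "\<And>k. Ck_on k U g" and fg: "\<And>q. q \<in> Q \<inter> U \<Longrightarrow> g q = f q"
    using assms unfolding smooth_on_def by metis
  have "continuous_on U g" using g[of 0] by simp
  then have "continuous (at p) g"
    using U by (simp add: continuous_on_eq_continuous_at)
  then have "continuous (at p within Q \<inter> U) g"
    by (rule continuous_at_imp_continuous_at_within)
  then have "continuous (at p within Q \<inter> U) f"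
  proof -
    have "(g \<longlongrightarrow> f p) (at p within Q \<inter> U) \<longleftrightarrow> (f \<longlongrightarrow> f p) (at p within Q \<inter> U)"
      by (rule Lim_cong_within) (use fg in auto)
    then show "continuous (at p within Q \<inter> U) g \<Longrightarrow> continuous (at p within Q \<inter> U) f"
      using p U fg by (simp add: continuous_within)
  qed
  moreover have "at p within Q = at p within Q \<inter> U"
    using U by (intro at_within_nhd[of p U]) auto
  ultimately show "continuous (at p within Q) f" by simp
qed

text \<open>The condition on \<open>Q\<close> makes derivatives within \<open>Q\<close> unique, so the derivatives of the local smooth
  extensions patch together on \<open>Q\<close>, boundary points included.\<close>

lemma smooth_on_derivative:
  fixes f :: "'p::euclidean_space \<Rightarrow> 'q::euclidean_space"
  assumes f: "smooth_on Q f"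
    and Q: "\<And>p i e. p \<in> Q \<Longrightarrow> i \<in> Basis \<Longrightarrow> e > 0 \<Longrightarrow> \<exists>d. 0 < \<bar>d\<bar> \<and> \<bar>d\<bar> < e \<and> p + d *\<^sub>R i \<in> Q"
  shows "p \<in> Q \<Longrightarrow> (f has_derivative frechet_derivative f (at p within Q)) (at p within Q)"
    and "smooth_on Q (\<lambda>p. frechet_derivative f (at p within Q) v)"
proof -
  have loc: "\<exists>U g. open U \<and> p \<in> U \<and> (\<forall>k. Ck_on k U (\<lambda>q. frechet_derivative g (at q) v)) \<and>
      (\<forall>q\<in>Q \<inter> U. (f has_derivative frechet_derivative f (at q within Q)) (at q within Q) \<and>
        frechet_derivative g (at q) v = frechet_derivative f (at q within Q) v)" if p: "p \<in> Q" for p v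
  proof -
    obtain U g where U: "open U" "p \<in> U" and g: "\<And>k. Ck_on k U g" and fg: "\<And>q. q \<in> Q \<inter> U \<Longrightarrow> g q = f q"
      using f p unfolding smooth_on_def by metis
    note gd = Ck_on_frechet_derivative[OF U(1) g]
    have fd: "(f has_derivative frechet_derivative g (at q)) (at q within Q)" if q: "q \<in> Q \<inter> U" for q
    proof -
      have "(g has_derivative frechet_derivative g (at q)) (at q within Q \<inter> U)"
        using gd(1) q by (auto intro: has_derivative_at_withinI)
      then have "(f has_derivative frechet_derivative g (at q)) (at q within Q \<inter> U)"
        by (rule has_derivative_transform[OF q, rotated]) (simp add: fg)
      moreover have "at q within Q = at q within Q \<inter> U"
        using U q by (intro at_within_nhd[of q U]) auto
      ultimately show ?thesis by simp
    qed
    have fd': "(f has_derivative frechet_derivative f (at q within Q)) (at q within Q)" if q: "q \<in> Q \<inter> U" for q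
      using fd[OF q] by (metis differentiableI frechet_derivative_works)
    have "frechet_derivative g (at q) = frechet_derivative f (at q within Q)" if q: "q \<in> Q \<inter> U" for q
      using q by (intro frechet_derivative_unique_within[OF fd fd'] Q) auto
    then show ?thesis
      using U gd(2) fd' by (intro exI[of _ U] exI[of _ g]) auto
  qed
  show "p \<in> Q \<Longrightarrow> (f has_derivative frechet_derivative f (at p within Q)) (at p within Q)"
    using loc by blast
  show "smooth_on Q (\<lambda>p. frechet_derivative f (at p within Q) v)"
    unfolding smooth_on_def
  proof
    fix p assume "p \<in> Q"
    from loc[OF this, of v] obtain U g where
      "open U \<and> p \<in> U \<and> (\<forall>k. Ck_on k U (\<lambda>q. frechet_derivative g (at q) v)) \<and>
        (\<forall>q\<in>Q \<inter> U. (f has_derivative frechet_derivative f (at q within Q)) (at q within Q) \<and>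
          frechet_derivative g (at q) v = frechet_derivative f (at q within Q) v)"
      by (elim exE)
    then show "\<exists>U g. open U \<and> p \<in> U \<and> (\<forall>k. Ck_on k U g) \<and>
        (\<forall>q\<in>Q \<inter> U. g q = frechet_derivative f (at q within Q) v)"
      by (intro exI[of _ U] exI[of _ "\<lambda>q. frechet_derivative g (at q) v"]) simp
  qed
qed

locale strip =
  fixes a b T :: real
  assumes ab: "a < b"
begin

definition smooth2 :: "(real \<Rightarrow> real \<Rightarrow> real) \<Rightarrow> bool" where
  "smooth2 f \<longleftrightarrow> smooth_on ({0<..<T} \<times> {a..b}) (\<lambda>(t, s). f t s)"

definition d_space :: "(real \<Rightarrow> real \<Rightarrow> real) \<Rightarrow> (real \<Rightarrow> real \<Rightarrow> real) \<Rightarrow> bool" where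
  "d_space f g \<longleftrightarrow> (\<forall>t\<in>{0<..<T}. \<forall>s\<in>{a..b}. (f t has_real_derivative g t s) (at s within {a..b}))"

definition d_time :: "(real \<Rightarrow> real \<Rightarrow> real) \<Rightarrow> (real \<Rightarrow> real \<Rightarrow> real) \<Rightarrow> bool" where
  "d_time f g \<longleftrightarrow> (\<forall>t\<in>{0<..<T}. \<forall>s\<in>{a..b}. ((\<lambda>\<tau>. f \<tau> s) has_real_derivative g t s) (at t))"

definition d_total :: "(real \<Rightarrow> real \<Rightarrow> real) \<Rightarrow> (real \<Rightarrow> real \<Rightarrow> real) \<Rightarrow> (real \<Rightarrow> real \<Rightarrow> real) \<Rightarrow> bool" where
  "d_total f ft fs \<longleftrightarrow> (\<forall>t\<in>{0<..<T}. \<forall>s\<in>{a..b}.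
    ((\<lambda>(t, s). f t s) has_derivative (\<lambda>x. fst x * ft t s + snd x * fs t s)) (at (t, s) within {0<..<T} \<times> {a..b}))"

lemma smooth2_cong:
  assumes "\<And>t s. t \<in> {0<..<T} \<Longrightarrow> s \<in> {a..b} \<Longrightarrow> f t s = g t s" "smooth2 f"
  shows "smooth2 g"
proof -
  have "(\<lambda>(t, s). g t s) q = (\<lambda>(t, s). f t s) q" if "q \<in> {0<..<T} \<times> {a..b}" for q
    using assms(1) that by auto
  then show ?thesis
    using assms(2) unfolding smooth2_def smooth_on_def by (metis (no_types, lifting) IntD1)
qed

lemma d_space_cong:
  assumes eq: "\<And>t s. t \<in> {0<..<T} \<Longrightarrow> s \<in> {a..b} \<Longrightarrow> f t s = g t s" and f: "d_space f f'"
  shows "d_space g f'"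
  unfolding d_space_def
proof (intro ballI)
  fix t s assume t: "t \<in> {0<..<T}" and s: "s \<in> {a..b}"
  have "(f t has_real_derivative f' t s) (at s within {a..b})"
    using f t s unfolding d_space_def by blast
  then show "(g t has_real_derivative f' t s) (at s within {a..b})"
    by (rule has_field_derivative_transform_within[OF _ zero_less_one s]) (rule eq[OF t])
qed

lemma smooth2_continuous: "smooth2 f \<Longrightarrow> continuous_on ({0<..<T} \<times> {a..b}) (\<lambda>(t, s). f t s)"
  unfolding smooth2_def by (rule smooth_on_imp_continuous_on)

lemma smooth2_total_derivative:
  assumes f: "smooth2 f"
  obtains ft fs where "smooth2 ft" "smooth2 fs" "d_total f ft fs"
proof -
  let ?Q = "{0<..<T} \<times> {a..b}"
  let ?f = "\<lambda>(t, s). f t s"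
  have nbh: "\<exists>d. 0 < \<bar>d\<bar> \<and> \<bar>d\<bar> < e \<and> p + d *\<^sub>R i \<in> ?Q"
    if p: "p \<in> ?Q" and i: "i \<in> Basis" and e: "e > 0" for p i and e :: real
  proof -
    obtain t s where ts: "p = (t, s)" "0 < t" "t < T" "a \<le> s" "s \<le> b"
      using p by auto
    from i consider "i = (1, 0)" | "i = (0, 1)"
      by (auto simp: Basis_prod_def)
    then show ?thesis
    proof cases
      case 1
      then show ?thesis
        using ts e by (intro exI[of _ "min (e / 2) ((T - t) / 2)"]) (auto simp: min_def field_simps)
    next
      case 2
      show ?thesis
      proof (cases "s < b")
        case True
        then show ?thesis
          using ts e 2 by (intro exI[of _ "min (e / 2) ((b - s) / 2)"]) (auto simp: min_def field_simps)
      next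
        case False
        then show ?thesis
          using ts e 2 ab by (intro exI[of _ "- min (e / 2) ((b - a) / 2)"]) (auto simp: min_def field_simps)
      qed
    qed
  qed
  let ?D = "\<lambda>p. frechet_derivative ?f (at p within ?Q)"
  note D = smooth_on_derivative[OF f[unfolded smooth2_def] nbh]
  show ?thesis
  proof (rule that[of "\<lambda>t s. ?D (t, s) (1, 0)" "\<lambda>t s. ?D (t, s) (0, 1)"])
    show "smooth2 (\<lambda>t s. ?D (t, s) (1, 0))" "smooth2 (\<lambda>t s. ?D (t, s) (0, 1))"
      unfolding smooth2_def using D(2) by (simp_all add: case_prod_beta')
    show "d_total f (\<lambda>t s. ?D (t, s) (1, 0)) (\<lambda>t s. ?D (t, s) (0, 1))"
      unfolding d_total_def
    proof (intro ballI)
      fix t s assume "t \<in> {0<..<T}" "s \<in> {a..b}"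
      then have d: "(?f has_derivative ?D (t, s)) (at (t, s) within ?Q)"
        using D(1)[of "(t, s)"] by simp
      have "?D (t, s) x = fst x * ?D (t, s) (1, 0) + snd x * ?D (t, s) (0, 1)" for x
      proof -
        have "x = fst x *\<^sub>R (1, 0) + snd x *\<^sub>R (0, 1)" by (cases x) simp
        then have "?D (t, s) x = ?D (t, s) (fst x *\<^sub>R (1, 0) + snd x *\<^sub>R (0, 1))" by simp
        also have "\<dots> = fst x * ?D (t, s) (1, 0) + snd x * ?D (t, s) (0, 1)"
          using has_derivative_linear[OF d] by (simp only: linear_add linear_cmul real_scaleR_def)
        finally show ?thesis .
      qed
      then have "?D (t, s) = (\<lambda>x. fst x * ?D (t, s) (1, 0) + snd x * ?D (t, s) (0, 1))"
        by (rule ext)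
      then show "(?f has_derivative (\<lambda>x. fst x * ?D (t, s) (1, 0) + snd x * ?D (t, s) (0, 1))) (at (t, s) within ?Q)"
        using d by simp
    qed
  qed
qed

lemma d_total_imp_partials:
  assumes f: "d_total f ft fs"
  shows "d_time f ft" "d_space f fs"
proof -
  have "((\<lambda>\<tau>. f \<tau> s) has_real_derivative ft t s) (at t) \<and> (f t has_real_derivative fs t s) (at s within {a..b})"
    if t: "t \<in> {0<..<T}" and s: "s \<in> {a..b}" for t s
  proof
    have d: "((\<lambda>(t, s). f t s) has_derivative (\<lambda>x. fst x * ft t s + snd x * fs t s)) (at (t, s) within {0<..<T} \<times> {a..b})"
      using f t s unfolding d_total_def by blast
    have l: "((\<lambda>\<tau>. (\<tau>, s)) has_derivative (\<lambda>h. (h, 0))) (at t within {0<..<T})"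
      by (auto intro!: derivative_eq_intros)
    have "(\<lambda>\<tau>. (\<tau>, s)) ` {0<..<T} \<subseteq> {0<..<T} \<times> {a..b}" using s by auto
    from has_derivative_in_compose[OF l has_derivative_subset[OF d this]]
    have "((\<lambda>\<tau>. f \<tau> s) has_real_derivative ft t s) (at t within {0<..<T})"
      by (simp add: has_field_derivative_def mult_commute_abs)
    then show "((\<lambda>\<tau>. f \<tau> s) has_real_derivative ft t s) (at t)"
      using t at_within_open[OF t open_greaterThanLessThan] by simp
    have l: "((\<lambda>\<sigma>. (t, \<sigma>)) has_derivative (\<lambda>h. (0, h))) (at s within {a..b})"
      by (auto intro!: derivative_eq_intros)
    have "(\<lambda>\<sigma>. (t, \<sigma>)) ` {a..b} \<subseteq> {0<..<T} \<times> {a..b}" using t by auto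
    from has_derivative_in_compose[OF l has_derivative_subset[OF d this]]
    show "(f t has_real_derivative fs t s) (at s within {a..b})"
      by (simp add: has_field_derivative_def mult_commute_abs)
  qed
  then show "d_time f ft" "d_space f fs"
    unfolding d_time_def d_space_def by blast+
qed

lemma smooth2_partials:
  assumes "smooth2 f"
  obtains ft fs where "smooth2 ft" "smooth2 fs" "d_time f ft" "d_space f fs"
  using smooth2_total_derivative[OF assms] d_total_imp_partials by metis

lemma d_time_unique:
  assumes "d_time f g" "d_time f g'" "t \<in> {0<..<T}" "s \<in> {a..b}"
  shows "g t s = g' t s"
  using assms DERIV_unique unfolding d_time_def by blast

lemma d_space_unique:
  assumes "d_space f g" "d_space f g'" "t \<in> {0<..<T}" and s: "s \<in> {a..b}"
  shows "g t s = g' t s"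
proof -
  have "at s within {a..b} \<noteq> bot"
    using ab s by (simp add: trivial_limit_within islimpt_Icc)
  then show ?thesis
    using assms has_field_derivative_unique unfolding d_space_def by blast
qed

lemma continuous_slice:
  assumes "continuous_on (X \<times> {a..b}) (\<lambda>(t, s). f t s)" "t \<in> X"
  shows "continuous_on {a..b} (f t)"
proof -
  have "continuous_on {a..b} ((\<lambda>(t, s). f t s) \<circ> (\<lambda>s. (t, s)))"
    using assms by (intro continuous_on_compose continuous_intros) (auto elim: continuous_on_subset)
  then show ?thesis by (simp add: o_def)
qed

text \<open>Differentiating \<open>f(t, s) - f(t, a) = \<integral> fs\<close> under the integral sign gives \<open>ft\<close> as an integral of
  the mixed derivative, and the fundamental theorem of calculus differentiates it back.  This works up
  to the ends of the interval, where symmetry of second Frechet derivatives on open sets does not apply.\<close>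

lemma mixed_partials_commute:
  assumes fs: "d_space f fs" and ft: "d_time f ft" and fst: "d_time fs fst'"
    and c: "smooth2 fs" and c': "smooth2 fst'"
  shows "d_space ft fst'"
  unfolding d_space_def
proof (intro ballI)
  fix t s assume t: "t \<in> {0<..<T}" and s: "s \<in> {a..b}"
  have cf: "continuous_on {a..b} (fs t)" "continuous_on {a..b} (fst' t)" if "t \<in> {0<..<T}" for t
    using continuous_slice smooth2_continuous c c' that by blast+
  have I: "integral {a..\<sigma>} (fs \<tau>) = f \<tau> \<sigma> - f \<tau> a" if \<tau>: "\<tau> \<in> {0<..<T}" and \<sigma>: "\<sigma> \<in> {a..b}" for \<tau> \<sigma>
  proof (rule integral_unique, rule fundamental_theorem_of_calculus)
    show "a \<le> \<sigma>" using \<sigma> by simp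
    fix x assume "x \<in> {a..\<sigma>}"
    then have "(f \<tau> has_real_derivative fs \<tau> x) (at x within {a..b})"
      using fs \<tau> \<sigma> by (simp add: d_space_def)
    then show "(f \<tau> has_vector_derivative fs \<tau> x) (at x within {a..\<sigma>})"
      unfolding has_real_derivative_iff_has_vector_derivative
      by (rule has_vector_derivative_within_subset) (use \<sigma> in auto)
  qed
  have J: "ft t \<sigma> - ft t a = integral {a..\<sigma>} (fst' t)" if \<sigma>: "\<sigma> \<in> {a..b}" for \<sigma>
  proof -
    have "((\<lambda>\<tau>. integral (cbox a \<sigma>) (fs \<tau>)) has_field_derivative integral (cbox a \<sigma>) (fst' t)) (at t within {0<..<T})"
    proof (rule leibniz_rule_field_derivative)
      show "((\<lambda>\<tau>. fs \<tau> x) has_field_derivative fst' \<tau> x) (at \<tau> within {0<..<T})"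
        if "\<tau> \<in> {0<..<T}" "x \<in> cbox a \<sigma>" for \<tau> x
        using fst that \<sigma> unfolding d_time_def by (auto intro: has_field_derivative_at_within)
      show "fs \<tau> integrable_on cbox a \<sigma>" if "\<tau> \<in> {0<..<T}" for \<tau>
        using cf(1)[OF that] \<sigma> by (intro integrable_continuous) (auto elim: continuous_on_subset)
      show "continuous_on ({0<..<T} \<times> cbox a \<sigma>) (\<lambda>(x, t). fst' x t)"
        using smooth2_continuous[OF c'] \<sigma> by (auto elim!: continuous_on_subset)
    qed (use t in auto)
    then have "((\<lambda>\<tau>. integral {a..\<sigma>} (fs \<tau>)) has_real_derivative integral {a..\<sigma>} (fst' t)) (at t)"
      using t at_within_open[OF t open_greaterThanLessThan] by simp
    then have "((\<lambda>\<tau>. f \<tau> \<sigma> - f \<tau> a) has_real_derivative integral {a..\<sigma>} (fst' t)) (at t)"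
      by (rule has_field_derivative_transform_within_open[OF _ open_greaterThanLessThan t]) (rule I[OF _ \<sigma>])
    moreover have "((\<lambda>\<tau>. f \<tau> \<sigma> - f \<tau> a) has_real_derivative ft t \<sigma> - ft t a) (at t)"
      using ft t \<sigma> ab unfolding d_time_def by (intro DERIV_diff) auto
    ultimately show ?thesis by (rule DERIV_unique[symmetric])
  qed
  have "((\<lambda>\<sigma>. ft t a + integral {a..\<sigma>} (fst' t)) has_real_derivative fst' t s) (at s within {a..b})"
    using integral_has_real_derivative[OF cf(2)[OF t] s] by (auto intro!: derivative_eq_intros)
  then show "(ft t has_real_derivative fst' t s) (at s within {a..b})"
  proof (rule has_field_derivative_transform_within[OF _ zero_less_one s])
    fix \<sigma> assume "\<sigma> \<in> {a..b}"
    then show "ft t a + integral {a..\<sigma>} (fst' t) = ft t \<sigma>" using J[of \<sigma>] by linarith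
  qed
qed

end

section \<open>Algebra of the barriers\<close>

text \<open>Pointwise part of the gradient estimate: \<open>G0\<close>, \<open>G1\<close>, \<open>G2\<close>, \<open>Gt\<close> express that \<open>v (u - d)\<close> touches the
  barrier \<open>K\<close> from below.  The vanishing first derivative factors as \<open>w v (psi (u - d) + 1) = 0\<close>, and
  with \<open>psi (u - d) = - 1\<close> the reaction, cut-off and forcing terms of the evolution equation collapse.\<close>

lemma gradient_barrier_contradiction:
  fixes u w psi psi1 v h K K' d m ut wt :: real
  assumes v: "v > 0" "v\<^sup>2 = 1 + w\<^sup>2" and d: "0 < d" "d < u" and m: "m \<ge> 0" and K: "K \<ge> 1"
    and ut: "ut = psi - m / u + h * v"
    and wt: "wt = psi1 + m * w / u\<^sup>2 + h * w * psi * v"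
    and K': "K' > K * (m / d\<^sup>2) + \<bar>h\<bar>"
    and w: "w \<noteq> 0"
    and G0: "v * (u - d) = K"
    and G1: "(w * (psi * v\<^sup>2) / v) * (u - d) + v * w = 0"
    and G2: "(w * (psi1 * v\<^sup>2 + 2 * w * psi * (psi * v\<^sup>2)) / v + (psi * v\<^sup>2)\<^sup>2 / v ^ 3) * (u - d)
        + 2 * (w * (psi * v\<^sup>2) / v * w) + v * (psi * v\<^sup>2) \<le> 0"
    and Gt: "w * wt / v * (u - d) + v * ut - K' \<ge> 0"
  shows False
proof -
  define c r e where "c = 1 / v" and "r = 1 / u" and "e = u - d"
  have vc: "v * c = 1" and ru: "r * u = 1" and e: "e > 0" and c: "c > 0" and r: "r > 0"
    using v d by (auto simp: c_def r_def e_def)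
  have dv: "x / v = x * c" "x / u = x * r" "x / v ^ 3 = x * c ^ 3" "x / u\<^sup>2 = x * r\<^sup>2" for x
    by (simp_all add: c_def r_def power_divide)
  have vv: "v * v = 1 + w * w" using v(2) by (simp add: power2_eq_square)
  note G = G1[unfolded dv e_def[symmetric]] G2[unfolded dv e_def[symmetric]] Gt[unfolded dv e_def[symmetric]]
     ut[unfolded dv] wt[unfolded dv]
  have "w * v * (psi * e + 1) = 0"
    using G(1) vc unfolding power2_eq_square by algebra
  then have pe: "psi * e = -1" using v w by auto
  have "(w * wt * c * e + v * ut - K') -
      c\<^sup>2 * ((w * (psi1 * v\<^sup>2 + 2 * w * psi * (psi * v\<^sup>2)) * c + (psi * v\<^sup>2)\<^sup>2 * c ^ 3) * e
        + 2 * (w * (psi * v\<^sup>2) * c * w) + v * (psi * v\<^sup>2))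
     = m * e * w\<^sup>2 * r\<^sup>2 * c - m * v * r + h + psi * c  - K'"
    using G(4,5) vc vv pe unfolding power2_eq_square power3_eq_cube by algebra
  moreover have "psi * c \<le> 0"
  proof -
    have "psi * e < 0" using pe by simp
    then have "psi < 0" using e by (simp add: mult_less_0_iff)
    then show ?thesis using c by (simp add: mult_nonpos_nonneg)
  qed
  moreover have "m * v * r \<ge> 0" using m v r by simp
  moreover have "c\<^sup>2 * ((w * (psi1 * v\<^sup>2 + 2 * w * psi * (psi * v\<^sup>2)) * c + (psi * v\<^sup>2)\<^sup>2 * c ^ 3) * e
        + 2 * (w * (psi * v\<^sup>2) * c * w) + v * (psi * v\<^sup>2)) \<le> 0"
    using G(2) by (intro mult_nonneg_nonpos) auto
  moreover have "m * e * w\<^sup>2 * r\<^sup>2 * c \<le> K * (m / d\<^sup>2)"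
  proof -
    have "w\<^sup>2 * c \<le> v" 
    proof -
      have "w\<^sup>2 * c \<le> v\<^sup>2 * c"
        using v c by (intro mult_right_mono) auto
      also have "\<dots> = v" using vc by (simp add: power2_eq_square mult.assoc)
      finally show ?thesis .
    qed
    moreover have "r\<^sup>2 \<le> 1 / d\<^sup>2"
      using d by (auto simp: r_def power_divide intro!: divide_left_mono power_mono mult_pos_pos)
    ultimately have "(w\<^sup>2 * c) * r\<^sup>2 \<le> v * (1 / d\<^sup>2)"
      using v by (intro mult_mono) auto
    then have "(m * e) * ((w\<^sup>2 * c) * r\<^sup>2) \<le> (m * e) * (v * (1 / d\<^sup>2))"
      using m e by (intro mult_left_mono) auto
    also have "\<dots> = K * (m / d\<^sup>2)" unfolding G0[folded e_def, symmetric] by simp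
    finally show ?thesis by (simp add: mult_ac)
  qed
  ultimately show False using K' G(3) by linarith
qed

text \<open>Pointwise part of the curvature estimate: \<open>sg * psi * (u - d)\<close> touches \<open>K (E0 - w\<^sup>2)\<close> from below.
  Eliminating \<open>psi1\<close> by the first order condition, the terms \<open>4 K w\<^sup>2 psi\<^sup>2\<close> cancel and the equation keeps
  the good term \<open>- 2 K psi\<^sup>2 v\<^sup>2\<close>.  All other quadratic terms have coefficients bounded independently of
  \<open>K\<close>, apart from the forcing term, which Young's inequality splits into \<open>K psi\<^sup>2\<close> and a multiple of \<open>h\<^sup>2\<close>.\<close>

lemma curvature_barrier_contradiction:
  fixes u w psi psi1 psi2 v h K K' E0 d m ut wt zt psit z z1 sg :: real
  assumes v: "v > 0" "v\<^sup>2 = 1 + w\<^sup>2" and d: "0 < d" "d < u" and m: "m \<ge> 0" and K: "K > 8"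
    and sg: "sg * sg = 1" and E0: "2 * w\<^sup>2 \<le> E0" "1 \<le> E0"
    and z: "z = psi * v\<^sup>2" and z1: "z1 = psi1 * v\<^sup>2 + 2 * w * psi * z"
    and ut: "ut = psi - m / u + h * v"
    and wt: "wt = psi1 + m * w / u\<^sup>2 + h * w * psi * v"
    and zt: "zt = psi2 + m * z / u\<^sup>2 - 2 * m * w\<^sup>2 / u ^ 3 + h * (z * psi * v + w * psi1 * v + w * psi * (w * z / v))"
    and psit: "psit = zt / v\<^sup>2 - 2 * w * z * wt / (v\<^sup>2)\<^sup>2"
    and K': "K' \<ge> K * (5 * m / d\<^sup>2 + E0 * h\<^sup>2)"
    and G0: "sg * psi * (u - d) = K * (E0 - w\<^sup>2)"
    and G1: "sg * psi1 * (u - d) + sg * psi * w + 2 * K * w * z = 0"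
    and G2: "sg * psi2 * (u - d) + 2 * sg * psi1 * w + sg * psi * z + 2 * K * (z\<^sup>2 + w * z1) \<le> 0"
    and Gt: "sg * psit * (u - d) + sg * psi * ut - K' * (E0 - w\<^sup>2) + 2 * K * w * wt \<ge> 0"
  shows False
proof -
  define c r e p p1 E where "c = 1 / v" and "r = 1 / u" and "e = u - d"
    and "p = sg * psi" and "p1 = sg * psi1" and "E = E0 - w\<^sup>2"
  have vc: "v * c = 1" and ru: "r * u = 1" and e: "e > 0" "e < u" and c: "c > 0" and r: "r > 0"
    using v d by (auto simp: c_def r_def e_def)
  have dv: "x / v = x * c" "x / u = x * r" "x / v\<^sup>2 = x * c\<^sup>2" "x / u\<^sup>2 = x * r\<^sup>2" "x / u^3 = x * r^3" 
    "x / (v\<^sup>2)\<^sup>2 = x * (c\<^sup>2)\<^sup>2" for x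
    by (simp_all add: c_def r_def power_divide)
  have vv: "v * v = 1 + w * w" using v(2) by (simp add: power2_eq_square)
  have w2: "w\<^sup>2 \<le> E" "E \<ge> 1/2" "E \<le> E0" using E0 by (auto simp: E_def)
  have pe: "p * e = K * E" using G0 by (simp add: p_def e_def E_def)
  then have p: "p > 0"
  proof -
    have "p * e > 0" unfolding pe using K w2 by simp
    then show ?thesis using e by (simp add: zero_less_mult_iff)
  qed
  note G = G1[unfolded e_def[symmetric]] G2[unfolded e_def[symmetric]] Gt[unfolded e_def[symmetric] E_def[symmetric]]
     ut[unfolded dv] wt[unfolded dv] zt[unfolded dv] psit[unfolded dv]
  have p1: "p1 * e = - p * w - 2 * K * w * z"
    using G(1) by (simp add: p_def p1_def)
  have psit': "psit = psi2 * c\<^sup>2 - 2 * w * c\<^sup>2 * psi * psi1 + h * (psi\<^sup>2 * c + w * c * psi1)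
      + m * r\<^sup>2 * (2 * c\<^sup>2 - 1) * psi - 2 * m * w\<^sup>2 * c\<^sup>2 * r ^ 3"
    using G(5-7) z vc vv unfolding power2_eq_square power3_eq_cube by algebra
  \<comment> \<open>the parabolic operator applied to the compared function; only \<open>p1 * e\<close> is eliminated, and the term
    with \<open>p1 * w\<close> is estimated later through its product with \<open>e\<close>\<close>
  have id: "(sg * psit * e + sg * psi * ut - K' * E + 2 * K * w * wt)
     - c\<^sup>2 * (sg * psi2 * e + 2 * sg * psi1 * w + sg * psi * z + 2 * K * (z\<^sup>2 + w * z1))
     = sg * (2 * w\<^sup>2 * c\<^sup>2 * p\<^sup>2) + h * c * (sg * (p * (p * e)) + p) + m * (p * e) * (2 * c\<^sup>2 - 1) * r\<^sup>2
       - sg * (2 * m * e * w\<^sup>2 * c\<^sup>2 * r ^ 3) - m * p * r - 2 * c\<^sup>2 * p1 * w - K' * E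
       - 2 * K * p\<^sup>2 * v\<^sup>2 + 2 * K * w\<^sup>2 * m * r\<^sup>2"
  proof -
    have pp: "p * p = psi * psi" "sg * p = psi" "psi * psi1 = p * p1"
      using sg unfolding p_def p1_def by algebra+
    have step: "sg * psit * e - c\<^sup>2 * (sg * psi2 * e) = - 2 * w * c\<^sup>2 * sg * p * (p1 * e)
        + h * (sg * (p * (p * e)) * c + w * c * (p1 * e))
        + m * (p * e) * (2 * c\<^sup>2 - 1) * r\<^sup>2 - sg * (2 * m * e * w\<^sup>2 * c\<^sup>2 * r ^ 3)"
      unfolding psit' using pp sg unfolding p_def p1_def power2_eq_square power3_eq_cube by algebra
    have zp: "z = sg * p * v\<^sup>2" using z pp by simp
    have z1': "z1 = psi1 * v\<^sup>2 + 2 * w * psi * z" by (rule z1)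
    have cz: "c\<^sup>2 * z = psi" and c2v: "c\<^sup>2 * v\<^sup>2 = 1"
      using z vc unfolding power2_eq_square by algebra+
    have zz: "c\<^sup>2 * (z\<^sup>2 + w * z1) = p\<^sup>2 * v\<^sup>2 + w * psi1 + 2 * w\<^sup>2 * p\<^sup>2"
      using z1' cz c2v z pp(1) unfolding power2_eq_square by algebra
    have a1: "- 2 * w * c\<^sup>2 * sg * p * (p1 * e) = sg * (2 * w\<^sup>2 * c\<^sup>2 * p\<^sup>2) + 4 * K * w\<^sup>2 * p\<^sup>2"
      unfolding p1 zp using c2v sg unfolding power2_eq_square by algebra
    have a2: "w * c * (p1 * e) = - w\<^sup>2 * c * p - 2 * K * w\<^sup>2 * psi * v"
      unfolding p1 z using vc unfolding power2_eq_square by algebra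
    have b1: "sg * psi * ut = p * psi - p * m * r + p * h * v"
      unfolding G(4) p_def by (simp add: algebra_simps)
    have b2: "2 * K * w * wt = 2 * K * w * psi1 + 2 * K * w\<^sup>2 * m * r\<^sup>2 + 2 * K * h * w\<^sup>2 * psi * v"
      unfolding G(5) by (simp add: algebra_simps power2_eq_square)
    have b3: "c\<^sup>2 * (2 * sg * psi1 * w + sg * psi * z) = 2 * c\<^sup>2 * p1 * w + p * psi"
      using cz unfolding p1_def p_def by (simp add: algebra_simps)
    have b4: "h * p * v - h * p * (w\<^sup>2 * c) = h * c * p"
      using vc vv unfolding power2_eq_square by algebra
    have b5: "2 * K * (c\<^sup>2 * (z\<^sup>2 + w * z1)) = 2 * K * (p\<^sup>2 * v\<^sup>2 + w * psi1 + 2 * w\<^sup>2 * p\<^sup>2)"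
      by (simp only: zz)
    show ?thesis
      using step b5 a1 a2 b1 b2 b3 b4 by (simp only: distrib_left right_diff_distrib) (simp add: algebra_simps)
  qed
  have c1: "c\<^sup>2 \<le> 1" "w\<^sup>2 * c\<^sup>2 \<le> 1" "c \<le> 1"
  proof -
    have "(v * c)\<^sup>2 = 1" using vc by simp
    then have "c\<^sup>2 + w\<^sup>2 * c\<^sup>2 = 1" by (simp add: power_mult_distrib v(2) distrib_right)
    then show "c\<^sup>2 \<le> 1" "w\<^sup>2 * c\<^sup>2 \<le> 1"
      using zero_le_power2[of c] zero_le_power2[of "w * c"] unfolding power_mult_distrib by linarith+
    then show "c \<le> 1" using power2_le_imp_le[of c 1] by simp
  qed
  have sgb: "sg * x \<le> \<bar>x\<bar>" for x
    using sg square_eq_1_iff[of sg] by auto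
  have r2: "r\<^sup>2 \<le> 1 / d\<^sup>2"
    using d by (auto simp: r_def power_divide intro!: divide_left_mono power_mono mult_pos_pos)
  have KE: "K * E \<ge> 1"
    using K w2 mult_mono[of 2 K "1/2" E] by simp
  have T1: "sg * (2 * w\<^sup>2 * c\<^sup>2 * p\<^sup>2) \<le> 2 * p\<^sup>2"
  proof -
    have "(w\<^sup>2 * c\<^sup>2) * p\<^sup>2 \<le> 1 * p\<^sup>2" by (rule mult_right_mono[OF c1(2)]) simp
    then show ?thesis using sgb[of "2 * w\<^sup>2 * c\<^sup>2 * p\<^sup>2"] by (simp add: mult.assoc)
  qed
  have T2: "h * c * (sg * (p * (p * e)) + p) \<le> K * p\<^sup>2 + K * E * (E0 * h\<^sup>2)"
  proof -
    have a: "\<bar>sg * (p * (p * e)) + p\<bar> \<le> 2 * (p * (K * E))"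
    proof -
      have "p * (p * e) = p * (K * E)" by (simp only: pe)
      moreover have "p * 1 \<le> p * (K * E)" using KE p by (intro mult_left_mono) auto
      moreover have "\<bar>sg\<bar> = 1" using sg square_eq_1_iff[of sg] by auto
      moreover have "\<bar>sg * (p * (K * E))\<bar> = p * (K * E)"
      proof -
        have "p * (K * E) \<ge> 0" using p KE by simp
        then show ?thesis using \<open>\<bar>sg\<bar> = 1\<close> by (simp only: abs_mult[of sg] abs_of_nonneg mult_1)
      qed
      ultimately show ?thesis
        using p abs_triangle_ineq[of "sg * (p * (K * E))" p] by (simp only: mult_1_right)
    qed
    have "h * c * (sg * (p * (p * e)) + p) \<le> \<bar>h * c * (sg * (p * (p * e)) + p)\<bar>" by simp
    also have "\<dots> = (\<bar>h\<bar> * c) * \<bar>sg * (p * (p * e)) + p\<bar>" using c by (simp add: abs_mult)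
    also have "\<dots> \<le> (\<bar>h\<bar> * 1) * (2 * (p * (K * E)))"
      using a c1 c by (intro mult_mono mult_left_mono) auto
    also have "\<dots> = K * (2 * p * (\<bar>h\<bar> * E))" by simp
    also have "\<dots> \<le> K * (p\<^sup>2 + (\<bar>h\<bar> * E)\<^sup>2)"
      using K sum_squares_bound[of p "\<bar>h\<bar> * E"] by (intro mult_left_mono) auto
    also have "\<dots> \<le> K * p\<^sup>2 + K * E * (E0 * h\<^sup>2)"
    proof -
      have "K * (E * h\<^sup>2) * E \<le> K * (E * h\<^sup>2) * E0"
        using w2 K by (intro mult_left_mono) auto
      then show ?thesis by (simp add: power_mult_distrib distrib_left power2_eq_square mult_ac)
    qed
    finally show ?thesis .
  qed
  have T3: "m * (p * e) * (2 * c\<^sup>2 - 1) * r\<^sup>2 \<le> m * (K * E) * (1 / d\<^sup>2)"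
  proof -
    have "m * (K * E) * (2 * c\<^sup>2 - 1) \<le> m * (K * E) * 1"
      using c1 m KE by (intro mult_left_mono) auto
    then have "m * (K * E) * (2 * c\<^sup>2 - 1) * r\<^sup>2 \<le> m * (K * E) * 1 * r\<^sup>2"
      by (rule mult_right_mono) simp
    also have "\<dots> \<le> m * (K * E) * (1 / d\<^sup>2)"
      using r2 m KE by (simp only: mult_1_right, intro mult_left_mono) auto
    finally show ?thesis by (simp only: pe)
  qed
  have w2K: "w\<^sup>2 \<le> K * E"
    using w2 K mult_right_mono[of 1 K E] by linarith
  have T4: "- (sg * (2 * m * e * w\<^sup>2 * c\<^sup>2 * r ^ 3)) \<le> 2 * m * (K * E) * (1 / d\<^sup>2)"
  proof -
    have "e * r \<le> 1" using e ru r mult_right_mono[of e u r] by (simp add: mult.commute)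
    then have "(e * r) * c\<^sup>2 \<le> 1 * 1"
      using c1 e r by (intro mult_mono) auto
    then have "w\<^sup>2 * ((e * r) * c\<^sup>2) \<le> (K * E) * (1 * 1)"
      by (rule mult_mono[OF w2K]) (use KE e r in auto)
    then have "(w\<^sup>2 * ((e * r) * c\<^sup>2)) * r\<^sup>2 \<le> (K * E * (1 * 1)) * (1 / d\<^sup>2)"
      by (rule mult_mono[OF _ r2]) (use KE in auto)
    then have le: "(2 * m) * ((w\<^sup>2 * ((e * r) * c\<^sup>2)) * r\<^sup>2) \<le> (2 * m) * ((K * E * (1 * 1)) * (1 / d\<^sup>2))"
      using m by (intro mult_left_mono) auto
    have "- (sg * (2 * m * e * w\<^sup>2 * c\<^sup>2 * r ^ 3)) \<le> \<bar>2 * m * e * w\<^sup>2 * c\<^sup>2 * r ^ 3\<bar>"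
      using sgb[of "- (2 * m * e * w\<^sup>2 * c\<^sup>2 * r ^ 3)"] by simp
    also have "\<dots> = (2 * m) * ((w\<^sup>2 * ((e * r) * c\<^sup>2)) * r\<^sup>2)"
      using m e r by (simp add: abs_mult power3_eq_cube power2_eq_square)
    also note le
    finally show ?thesis
      by (simp only: mult.assoc mult_1_right mult_1_left)
  qed
  have T5: "m * p * r \<ge> 0" using m p r by simp
  have T6: "- 2 * c\<^sup>2 * p1 * w \<le> 6 * p\<^sup>2"
  proof -
    have "(- 2 * c\<^sup>2 * p1 * w) * e = 2 * (w\<^sup>2 * c\<^sup>2) * p + sg * (4 * K * w\<^sup>2 * p)"
    proof -
      have "c\<^sup>2 * z = sg * p" using z vc sg unfolding p_def power2_eq_square by algebra
      then show ?thesis using p1 unfolding power2_eq_square by algebra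
    qed
    also have "\<dots> \<le> 2 * w\<^sup>2 * p + 4 * K * w\<^sup>2 * p"
    proof (rule add_mono)
      have "w\<^sup>2 * c\<^sup>2 \<le> w\<^sup>2 * 1" using c1 by (intro mult_left_mono) auto
      then show "2 * (w\<^sup>2 * c\<^sup>2) * p \<le> 2 * w\<^sup>2 * p" using p by (intro mult_right_mono) auto
      show "sg * (4 * K * w\<^sup>2 * p) \<le> 4 * K * w\<^sup>2 * p" using sgb[of "4 * K * w\<^sup>2 * p"] K p by (simp add: abs_mult)
    qed
    also have "\<dots> \<le> 2 * (K * E) * p + 4 * (K * E) * p"
    proof (rule add_mono)
      show "2 * w\<^sup>2 * p \<le> 2 * (K * E) * p" using w2K p by (intro mult_right_mono) auto
      show "4 * K * w\<^sup>2 * p \<le> 4 * (K * E) * p" using w2 K p by (intro mult_right_mono) auto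
    qed
    also have "\<dots> = (6 * p\<^sup>2) * e" unfolding pe[symmetric] by (simp add: power2_eq_square)
    finally show ?thesis by (rule mult_right_le_imp_le) (rule e(1))
  qed
  \<comment> \<open>the growth of the barrier pays for the positive terms with \<open>m\<close> and for the forcing\<close>
  have T7: "K' * E \<ge> 5 * (m * (K * E) * (1 / d\<^sup>2)) + K * E * (E0 * h\<^sup>2)"
    using mult_right_mono[OF K', of E] w2 by (simp add: algebra_simps)
  have T8: "2 * K * p\<^sup>2 * v\<^sup>2 \<ge> 2 * K * p\<^sup>2"
    using K v mult_left_mono[of 1 "v\<^sup>2" "2 * K * p\<^sup>2"] by simp
  have T9: "2 * K * w\<^sup>2 * m * r\<^sup>2 \<le> 2 * (m * (K * E) * (1 / d\<^sup>2))"
  proof -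
    have "(2 * m * (K * w\<^sup>2)) * r\<^sup>2 \<le> (2 * m * (K * E)) * (1 / d\<^sup>2)"
      by (rule mult_mono[OF _ r2]) (use K m w2 in \<open>auto intro!: mult_left_mono\<close>)
    then show ?thesis by (simp add: mult_ac)
  qed
  have T10: "8 * p\<^sup>2 < K * p\<^sup>2" using K p by simp
  have fin: "\<lbrakk>t1 \<le> 2 * q; t2 \<le> kq + X; t3 \<le> y; - t4 \<le> 2 * y; 0 \<le> t5; - t6 \<le> 6 * q; 5 * y + X \<le> t7;
      2 * kq \<le> t8; t9 \<le> 2 * y; 8 * q < kq; 0 \<le> t1 + t2 + t3 - t4 - t5 - t6 - t7 - t8 + t9\<rbrakk> \<Longrightarrow> False"
    for t1 t2 t3 t4 t5 t6 t7 t8 t9 q kq X y :: real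
    by linarith
  have "c\<^sup>2 * (sg * psi2 * e + 2 * sg * psi1 * w + sg * psi * z + 2 * K * (z\<^sup>2 + w * z1)) \<le> 0"
    using G(2) by (intro mult_nonneg_nonpos) auto
  with id G(3) have sum: "0 \<le> sg * (2 * w\<^sup>2 * c\<^sup>2 * p\<^sup>2) + h * c * (sg * (p * (p * e)) + p) + m * (p * e) * (2 * c\<^sup>2 - 1) * r\<^sup>2
       - sg * (2 * m * e * w\<^sup>2 * c\<^sup>2 * r ^ 3) - m * p * r - 2 * c\<^sup>2 * p1 * w - K' * E
       - 2 * K * p\<^sup>2 * v\<^sup>2 + 2 * K * w\<^sup>2 * m * r\<^sup>2"
    by linarith
  have T4': "- (sg * (2 * m * e * w\<^sup>2 * c\<^sup>2 * r ^ 3)) \<le> 2 * (m * (K * E) * (1 / d\<^sup>2))"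
    using T4 by (simp only: mult.assoc)
  have T6': "- (2 * c\<^sup>2 * p1 * w) \<le> 6 * p\<^sup>2"
    using T6 by (simp only: mult_minus_left)
  have T8': "2 * (K * p\<^sup>2) \<le> 2 * K * p\<^sup>2 * v\<^sup>2"
    using T8 by (simp only: mult.assoc)
  show False
    by (rule fin[OF T1 T2 T3 T4' T5 T6' T7 T8' T9 T10 sum])
qed

section \<open>A maximum principle by first touching\<close>

text \<open>The set where \<open>F \<ge> 0\<close> up to time \<open>t\<close> is compact, hence has a point of least time; before that time
  \<open>F\<close> is negative, and the intermediate value theorem in time makes it nonpositive then.\<close>

lemma negative_unless_touching_zero:
  fixes F :: "real \<Rightarrow> real \<Rightarrow> real"
  assumes c: "continuous_on ({0..<T} \<times> {a..b}) (\<lambda>(t, s). F t s)"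
    and init: "\<And>s. s \<in> {a..b} \<Longrightarrow> F 0 s < 0"
    and touch: "\<And>t s. \<lbrakk>t \<in> {0<..<T}; s \<in> {a..b}; F t s = 0; \<forall>\<tau>\<in>{0..t}. \<forall>\<sigma>\<in>{a..b}. F \<tau> \<sigma> \<le> 0\<rbrakk> \<Longrightarrow> False"
    and t: "t \<in> {0..<T}" and s: "s \<in> {a..b}"
  shows "F t s < 0"
proof (rule ccontr)
  assume "\<not> F t s < 0"
  let ?K = "{0..t} \<times> {a..b}"
  let ?Z = "?K \<inter> (\<lambda>(t, s). F t s) -` {0..}"
  have cK: "continuous_on ?K (\<lambda>(t, s). F t s)"
    by (rule continuous_on_subset[OF c]) (use t in auto)
  have "closed ?Z"
    by (intro continuous_closed_preimage cK closed_Times closed_atLeastAtMost closed_atLeast)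
  then have "compact (?Z \<inter> ?K)"
    by (intro closed_Int_compact compact_Times compact_Icc)
  then have "compact ?Z" by (simp add: Int_ac)
  moreover have "(t, s) \<in> ?Z" using \<open>\<not> F t s < 0\<close> t s by auto
  ultimately obtain p where p: "p \<in> ?Z" "\<And>q. q \<in> ?Z \<Longrightarrow> fst p \<le> fst q"
    using continuous_attains_inf[of ?Z fst] continuous_on_fst[OF continuous_on_id] by blast
  obtain t0 s0 where ts: "p = (t0, s0)" by (cases p)
  have t0: "0 \<le> t0" "t0 \<le> t" "s0 \<in> {a..b}" "F t0 s0 \<ge> 0" using p(1) ts by auto
  have first: "F \<tau> \<sigma> < 0" if "\<tau> \<in> {0..<t0}" "\<sigma> \<in> {a..b}" for \<tau> \<sigma>
    using p(2)[of "(\<tau>, \<sigma>)"] that t0 ts by force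
  have "t0 \<noteq> 0" using init[of s0] t0 by auto
  then have t0': "t0 \<in> {0<..<T}" using t0 t by auto
  have le: "F t0 \<sigma> \<le> 0" if \<sigma>: "\<sigma> \<in> {a..b}" for \<sigma>
  proof (rule ccontr)
    assume "\<not> F t0 \<sigma> \<le> 0"
    have "continuous_on {0..t0} ((\<lambda>(t, s). F t s) \<circ> (\<lambda>\<tau>. (\<tau>, \<sigma>)))"
      using \<sigma> t0 by (intro continuous_on_compose continuous_intros) (auto intro!: continuous_on_subset[OF cK])
    then have "\<exists>\<tau>\<ge>0. \<tau> \<le> t0 \<and> F \<tau> \<sigma> = 0"
      using init[OF \<sigma>] \<open>\<not> F t0 \<sigma> \<le> 0\<close> t0 by (intro IVT') (auto simp: o_def)
    then obtain \<tau> where "0 \<le> \<tau>" "\<tau> \<le> t0" "F \<tau> \<sigma> = 0" by blast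
    moreover have "\<tau> \<noteq> t0" using \<open>F \<tau> \<sigma> = 0\<close> \<open>\<not> F t0 \<sigma> \<le> 0\<close> by auto
    ultimately show False using first[of \<tau> \<sigma>] \<sigma> by auto
  qed
  show False
  proof (rule touch[OF t0' t0(3)])
    show "F t0 s0 = 0" using le[OF t0(3)] t0 by simp
    show "\<forall>\<tau>\<in>{0..t0}. \<forall>\<sigma>\<in>{a..b}. F \<tau> \<sigma> \<le> 0"
      using le first by (metis atLeastAtMost_iff atLeastLessThan_iff less_eq_real_def)
  qed
qed

text \<open>With a vanishing first derivative the usual second order condition also holds at an end of the
  interval: a positive second derivative would make \<open>f\<close> increase into the interval.\<close>

lemma second_derivative_nonpos_at_local_max:
  fixes f f1 :: "real \<Rightarrow> real"
  assumes ab: "a < b" and s: "s \<in> {a..b}"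
    and f: "\<And>x. x \<in> {a..b} \<Longrightarrow> (f has_real_derivative f1 x) (at x within {a..b})"
    and f2: "(f1 has_real_derivative f2) (at s within {a..b})"
    and f1: "f1 s = 0" and e: "e > 0"
    and le: "\<And>x. x \<in> {a..b} \<Longrightarrow> \<bar>x - s\<bar> < e \<Longrightarrow> f x \<le> f s"
  shows "f2 \<le> 0"
proof (rule ccontr)
  assume "\<not> f2 \<le> 0"
  then have pos: "f2 > 0" by simp
  have D: "(f has_real_derivative f1 x) (at x)" if "a < x" "x < b" for x
    using f[of x] that at_within_Icc_at[of a x b] by simp
  have cont: "continuous_on {x..y} f" if "a \<le> x" "y \<le> b" for x y
    using DERIV_continuous_on[OF f] that by (auto intro: continuous_on_subset)
  show False
  proof (cases "s < b")
    case True
    obtain d where d: "d > 0" "\<forall>h>0. s + h \<in> {a..b} \<longrightarrow> h < d \<longrightarrow> f1 s < f1 (s + h)"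
      using has_real_derivative_pos_inc_right[OF f2 pos] by blast
    define k where "k = min (min d e) (b - s) / 2"
    have k: "k > 0" "k < d" "k < e" "s + k < b" using d(1) e True by (auto simp: k_def min_def field_simps)
    have "f s < f (s + k)"
    proof (rule DERIV_pos_imp_increasing_open[of s "s + k" f])
      fix x assume x: "s < x" "x < s + k"
      then show "\<exists>y. (f has_real_derivative y) (at x) \<and> 0 < y"
        using d(2)[rule_format, of "x - s"] D[of x] s k f1 by (intro exI[of _ "f1 x"]) auto
    qed (use k s cont in auto)
    then show False using le[of "s + k"] k s by auto
  next
    case False
    then have sb: "s = b" using s by simp
    obtain d where d: "d > 0" "\<forall>h>0. s - h \<in> {a..b} \<longrightarrow> h < d \<longrightarrow> f1 (s - h) < f1 s"
      using has_real_derivative_pos_inc_left[OF f2 pos] by blast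
    define k where "k = min (min d e) (b - a) / 2"
    have k: "k > 0" "k < d" "k < e" "a < s - k" using d(1) e ab sb by (auto simp: k_def min_def field_simps)
    have "f (s - k) > f s"
    proof (rule DERIV_neg_imp_decreasing_open[of "s - k" s f])
      fix x assume x: "s - k < x" "x < s"
      then show "\<exists>y. (f has_real_derivative y) (at x) \<and> y < 0"
        using d(2)[rule_format, of "s - x"] D[of x] sb k f1 by (intro exI[of _ "f1 x"]) auto
    qed (use k s cont in auto)
    then show False using le[of "s - k"] k s by auto
  qed
qed

context strip
begin

lemma derivatives_at_touching_point:
  assumes "d_time f ft" and "d_space f f1" and "d_space f1 f2"
    and t: "t \<in> {0<..<T}" and s: "s \<in> {a..b}" and f0: "f t s = 0"
    and e: "e > 0"
    and le: "\<And>\<tau> \<sigma>. \<lbrakk>\<tau> \<in> {0<..t}; \<sigma> \<in> {a..b}; \<bar>\<tau> - t\<bar> < e; \<bar>\<sigma> - s\<bar> < e\<rbrakk> \<Longrightarrow> f \<tau> \<sigma> \<le> 0"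
    and bd: "s = a \<or> s = b \<Longrightarrow> f1 t s = 0"
  shows "ft t s \<ge> 0" "f1 t s = 0" "f2 t s \<le> 0"
proof -
  have D: "((\<lambda>\<tau>. f \<tau> s) has_real_derivative ft t s) (at t)"
    "\<And>x. x \<in> {a..b} \<Longrightarrow> (f t has_real_derivative f1 t x) (at x within {a..b})"
    "(f1 t has_real_derivative f2 t s) (at s within {a..b})"
    using assms unfolding d_time_def d_space_def by blast+
  show "ft t s \<ge> 0"
  proof (rule ccontr)
    assume "\<not> ft t s \<ge> 0"
    then obtain d where d: "d > 0" "\<forall>h>0. h < d \<longrightarrow> f t s < f (t - h) s"
      using DERIV_neg_dec_left[OF D(1)] by auto
    define k where "k = min (min d e) t / 2"
    have k: "k > 0" "k < d" "k < e" "k < t" using d(1) e t by (auto simp: k_def min_def field_simps)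
    then show False using d(2) le[of "t - k" s] f0 s e by force
  qed
  show z: "f1 t s = 0"
  proof (cases "s = a \<or> s = b")
    case False
    then have s': "a < s" "s < b" using s by auto
    then have "(f t has_real_derivative f1 t s) (at s)"
      using D(2)[OF s] at_within_Icc_at[of a s b] by simp
    then show ?thesis
    proof (rule DERIV_local_max)
      show "0 < min e (min (s - a) (b - s))" using e s' by simp
      show "\<forall>y. \<bar>s - y\<bar> < min e (min (s - a) (b - s)) \<longrightarrow> f t y \<le> f t s"
      proof (intro allI impI)
        fix y assume y: "\<bar>s - y\<bar> < min e (min (s - a) (b - s))"
        then have "y \<in> {a..b}" "\<bar>y - s\<bar> < e" by (auto simp: abs_if split: if_splits)
        then show "f t y \<le> f t s" using le[of t y] t f0 e by simp
      qed
    qed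
  qed (rule bd)
  show "f2 t s \<le> 0"
    by (rule second_derivative_nonpos_at_local_max[OF ab s D(2,3) z e]) (use le[of t] t e f0 in auto)
qed

lemma continuous_pos_nbhd:
  assumes c: "continuous_on ({0..<T} \<times> {a..b}) (\<lambda>(t, s). f t s)" and t: "t \<in> {0..<T}" and s: "s \<in> {a..b}"
    and pos: "f t s > (0 :: real)"
  obtains e where "e > 0"
    "\<And>\<tau> \<sigma>. \<tau> \<in> {0..<T} \<Longrightarrow> \<sigma> \<in> {a..b} \<Longrightarrow> \<bar>\<tau> - t\<bar> < e \<Longrightarrow> \<bar>\<sigma> - s\<bar> < e \<Longrightarrow> f \<tau> \<sigma> > 0"
proof -
  obtain d where d: "d > 0" "\<forall>q\<in>{0..<T} \<times> {a..b}. dist q (t, s) < d \<longrightarrow> dist (case q of (t, s) \<Rightarrow> f t s) (f t s) < f t s"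
    using c[unfolded continuous_on_iff, rule_format, of "(t, s)" "f t s"] t s pos by auto
  show ?thesis
  proof (rule that[of "d / 2"])
    show "d / 2 > 0" using d by simp
    fix \<tau> \<sigma> assume A: "\<tau> \<in> {0..<T}" "\<sigma> \<in> {a..b}" "\<bar>\<tau> - t\<bar> < d / 2" "\<bar>\<sigma> - s\<bar> < d / 2"
    have "dist (\<tau>, \<sigma>) (t, s) \<le> \<bar>\<tau> - t\<bar> + \<bar>\<sigma> - s\<bar>"
      using sqrt_sum_squares_le_sum_abs[of "\<tau> - t" "\<sigma> - s"] by (simp add: dist_Pair_Pair dist_real_def)
    then have "dist (\<tau>, \<sigma>) (t, s) < d" using A by linarith
    then have "dist (f \<tau> \<sigma>) (f t s) < f t s" using d(2) A by auto
    then show "f \<tau> \<sigma> > 0" by (simp add: dist_real_def abs_less_iff)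
  qed
qed

end

section \<open>Area, volume and the average mean curvature along the flow\<close>

text \<open>The flow as an evolution equation for the profile \<open>u\<close> with spatial derivatives \<open>u1\<close>, \<open>u2\<close>.  The
  forcing \<open>h\<close> is tied to the profile by the volume constraint.\<close>

locale graph_flow = strip a b T for a b T +
  fixes m :: nat and u u1 u2 :: "real \<Rightarrow> real \<Rightarrow> real" and h :: "real \<Rightarrow> real"
  assumes T: "0 < T"
    and u_pos: "t \<in> {0..<T} \<Longrightarrow> s \<in> {a..b} \<Longrightarrow> u t s > 0"
    and u_deriv: "t \<in> {0..<T} \<Longrightarrow> s \<in> {a..b} \<Longrightarrow> (u t has_real_derivative u1 t s) (at s within {a..b})"
    and u1_deriv: "t \<in> {0..<T} \<Longrightarrow> s \<in> {a..b} \<Longrightarrow> (u1 t has_real_derivative u2 t s) (at s within {a..b})"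
    and u_cont: "continuous_on ({0..<T} \<times> {a..b}) (\<lambda>(t, s). u t s)"
    and u1_cont: "continuous_on ({0..<T} \<times> {a..b}) (\<lambda>(t, s). u1 t s)"
    and u2_cont: "continuous_on ({0..<T} \<times> {a..b}) (\<lambda>(t, s). u2 t s)"
    and neumann: "t \<in> {0..<T} \<Longrightarrow> u1 t a = 0" "t \<in> {0..<T} \<Longrightarrow> u1 t b = 0"
    and u_smooth: "smooth2 u"
    and u_flow: "d_time u (\<lambda>t s. u2 t s / (1 + (u1 t s)\<^sup>2) - m / u t s + h t * sqrt (1 + (u1 t s)\<^sup>2))"
    and volume: "t \<in> {0<..<T} \<Longrightarrow> ((\<lambda>s. u t s ^ m *
      (u2 t s / (1 + (u1 t s)\<^sup>2) - m / u t s + h t * sqrt (1 + (u1 t s)\<^sup>2))) has_integral 0) {a..b}"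
begin

definition v :: "real \<Rightarrow> real \<Rightarrow> real" where "v t s = sqrt (1 + (u1 t s)\<^sup>2)"
text \<open>The spatial derivative of the angle \<open>arctan u1\<close>.  In contrast to \<open>u2\<close> itself, its evolution
  equation has no reaction term of third order.\<close>

definition psi :: "real \<Rightarrow> real \<Rightarrow> real" where "psi t s = u2 t s / (1 + (u1 t s)\<^sup>2)"
definition ut :: "real \<Rightarrow> real \<Rightarrow> real" where "ut t s = psi t s - m / u t s + h t * v t s"

lemma v_sq: "(v t s)\<^sup>2 = 1 + (u1 t s)\<^sup>2"
  unfolding v_def by simp

lemma v_ge_1: "v t s \<ge> 1" and v_pos: "v t s > 0"
  unfolding v_def by (simp_all add: add_pos_nonneg)

lemma abs_u1_le_v: "\<bar>u1 t s\<bar> \<le> v t s"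
  unfolding v_def by (intro real_le_rsqrt) simp

lemma psi_eq: "psi t s = u2 t s / (v t s)\<^sup>2" and u2_eq: "u2 t s = psi t s * (v t s)\<^sup>2"
  using v_pos[of t s] by (simp_all add: psi_def v_sq[symmetric])

lemma ut: "d_time u ut"
  using u_flow unfolding ut_def[abs_def] psi_def v_def .

lemma volume_ut: "t \<in> {0<..<T} \<Longrightarrow> ((\<lambda>s. u t s ^ m * ut t s) has_integral 0) {a..b}"
  using volume unfolding ut_def psi_def v_def .

lemma d_space_u: "d_space u u1" and d_space_u1: "d_space u1 u2"
  unfolding d_space_def using u_deriv u1_deriv by auto

lemma smooth_ut: "smooth2 ut"
proof -
  obtain ft fs where f: "smooth2 ft" "d_time u ft" using smooth2_partials[OF u_smooth] by metis
  show ?thesis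
    by (rule smooth2_cong[OF _ f(1)]) (rule d_time_unique[OF f(2) ut])
qed

lemma smooth_u1: "smooth2 u1"
proof -
  obtain ft fs where f: "smooth2 fs" "d_space u fs" using smooth2_partials[OF u_smooth] by metis
  show ?thesis
    by (rule smooth2_cong[OF _ f(1)]) (rule d_space_unique[OF f(2) d_space_u])
qed

lemma smooth_u2: "smooth2 u2"
proof -
  obtain ft fs where f: "smooth2 fs" "d_space u1 fs" using smooth2_partials[OF smooth_u1] by metis
  show ?thesis
    by (rule smooth2_cong[OF _ f(1)]) (rule d_space_unique[OF f(2) d_space_u1])
qed

text \<open>The slope and the speed share their mixed derivative.\<close>

lemma u1_time_derivative:
  obtains u1t where "smooth2 u1t" "d_time u1 u1t" "d_space ut u1t"
proof -
  obtain ft fs where f: "smooth2 ft" "d_time u1 ft" using smooth2_partials[OF smooth_u1] by metis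
  moreover have "d_space ut ft"
    using mixed_partials_commute[OF d_space_u ut f(2) smooth_u1 f(1)] .
  ultimately show ?thesis by (rule that)
qed

lemma slice_cont:
  assumes "t \<in> {0..<T}"
  shows "continuous_on {a..b} (u t)" "continuous_on {a..b} (u1 t)" "continuous_on {a..b} (u2 t)"
    "continuous_on {a..b} (v t)" "continuous_on {a..b} (psi t)"
proof -
  show c: "continuous_on {a..b} (u t)" "continuous_on {a..b} (u1 t)" "continuous_on {a..b} (u2 t)"
    using continuous_slice assms u_cont u1_cont u2_cont by blast+
  have "1 + (u1 t s)\<^sup>2 \<noteq> 0" for s by (simp add: add_nonneg_eq_0_iff)
  then show "continuous_on {a..b} (v t)" "continuous_on {a..b} (psi t)"
    unfolding v_def[abs_def] psi_def[abs_def] using c by (auto intro!: continuous_intros)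
qed

lemma ut_slice_cont: "t \<in> {0<..<T} \<Longrightarrow> continuous_on {a..b} (ut t)"
  using continuous_slice[OF smooth2_continuous[OF smooth_ut]] .

lemma v_space_deriv:
  assumes "t \<in> {0..<T}" "s \<in> {a..b}"
  shows "(v t has_real_derivative u1 t s * u2 t s / v t s) (at s within {a..b})"
proof -
  have "((\<lambda>s. 1 + (u1 t s)\<^sup>2) has_real_derivative 2 * u1 t s * u2 t s) (at s within {a..b})"
    by (auto intro!: derivative_eq_intros u1_deriv[OF assms])
  from DERIV_chain2[OF DERIV_real_sqrt this] show ?thesis
    unfolding v_def by (simp add: add_pos_nonneg divide_simps)
qed

lemma slope_quotient_deriv:
  assumes "t \<in> {0..<T}" "s \<in> {a..b}"
  shows "((\<lambda>s. u1 t s / v t s) has_real_derivative psi t s / v t s) (at s within {a..b})"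
proof -
  have "(u2 t s * v t s - u1 t s * (u1 t s * u2 t s / v t s)) / (v t s * v t s) = psi t s / v t s"
  proof -
    have "u2 t s * v t s - u1 t s * (u1 t s * u2 t s / v t s) = u2 t s * ((v t s)\<^sup>2 - (u1 t s)\<^sup>2) / v t s"
      using v_pos[of t s] by (simp add: field_simps power2_eq_square)
    also have "\<dots> = u2 t s / v t s" unfolding v_sq by simp
    finally show ?thesis unfolding psi_eq by (simp add: power2_eq_square)
  qed
  then show ?thesis
    using DERIV_divide[OF u1_deriv[OF assms] v_space_deriv[OF assms]] v_pos[of t s] by simp
qed

text \<open>Area and enclosed volume up to constant factors.  Since \<open>u_t = v (h - H)\<close>, the dissipation is, up to
  the factor of the area, the integral of \<open>(H - h)\<^sup>2\<close>.\<close>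

definition Area :: "real \<Rightarrow> real" where
  "Area t = integral {a..b} (\<lambda>s. u t s ^ m * v t s)"

definition Volume :: "real \<Rightarrow> real" where
  "Volume t = integral {a..b} (\<lambda>s. u t s ^ Suc m)"

definition Dissipation :: "real \<Rightarrow> real" where
  "Dissipation t = integral {a..b} (\<lambda>s. u t s ^ m * (ut t s)\<^sup>2 / v t s)"

lemma has_integral_Area: "t \<in> {0..<T} \<Longrightarrow> ((\<lambda>s. u t s ^ m * v t s) has_integral Area t) {a..b}"
  unfolding Area_def
  by (intro integrable_integral integrable_continuous_interval continuous_intros slice_cont)

lemma has_integral_Volume: "t \<in> {0..<T} \<Longrightarrow> ((\<lambda>s. u t s ^ Suc m) has_integral Volume t) {a..b}"
  unfolding Volume_def
  by (intro integrable_integral integrable_continuous_interval continuous_intros slice_cont)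

lemma has_integral_Dissipation:
  assumes t: "t \<in> {0<..<T}"
  shows "((\<lambda>s. u t s ^ m * (ut t s)\<^sup>2 / v t s) has_integral Dissipation t) {a..b}"
proof -
  have "v t s \<noteq> 0" for s using v_pos[of t s] by simp
  then show ?thesis
    unfolding Dissipation_def
    using t by (intro integrable_integral integrable_continuous_interval continuous_intros slice_cont ut_slice_cont) auto
qed

lemma has_integral_derivative:
  assumes "\<And>s. s \<in> {a..b} \<Longrightarrow> (f has_real_derivative f' s) (at s within {a..b})"
  shows "(f' has_integral f b - f a) {a..b}"
  using ab assms unfolding has_real_derivative_iff_has_vector_derivative
  by (intro fundamental_theorem_of_calculus) auto

lemma deriv_under_integral:
  assumes F: "d_time F Ft" and c: "continuous_on ({0<..<T} \<times> {a..b}) (\<lambda>(t, s). Ft t s)"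
    and i: "\<And>t. t \<in> {0<..<T} \<Longrightarrow> F t integrable_on {a..b}" and t: "t \<in> {0<..<T}"
  shows "((\<lambda>t. integral {a..b} (F t)) has_real_derivative integral {a..b} (Ft t)) (at t)"
proof -
  have "((\<lambda>t. integral (cbox a b) (F t)) has_field_derivative integral (cbox a b) (Ft t)) (at t within {0<..<T})"
    using F i c t
    by (intro leibniz_rule_field_derivative) (auto simp: d_time_def intro: has_field_derivative_at_within)
  then show ?thesis using at_within_open[OF t open_greaterThanLessThan] by simp
qed

lemma power_time_deriv:
  assumes t: "t \<in> {0<..<T}" and s: "s \<in> {a..b}"
  shows "((\<lambda>\<tau>. u \<tau> s ^ k) has_real_derivative k * u t s ^ (k - 1) * ut t s) (at t)"
proof -
  have "((\<lambda>\<tau>. u \<tau> s) has_real_derivative ut t s) (at t)"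
    using ut t s unfolding d_time_def by blast
  from DERIV_power[OF this, of k] show ?thesis by (simp add: mult_ac)
qed

lemma Volume_deriv:
  assumes t: "t \<in> {0<..<T}"
  shows "(Volume has_real_derivative 0) (at t)"
proof -
  let ?Ft = "\<lambda>t s. Suc m * u t s ^ m * ut t s"
  have "((\<lambda>t. integral {a..b} (\<lambda>s. u t s ^ Suc m)) has_real_derivative integral {a..b} (?Ft t)) (at t)"
  proof (rule deriv_under_integral[OF _ _ _ t])
    show "d_time (\<lambda>t s. u t s ^ Suc m) ?Ft"
      unfolding d_time_def using power_time_deriv[of _ _ "Suc m"] by simp
    show "continuous_on ({0<..<T} \<times> {a..b}) (\<lambda>(t, s). ?Ft t s)"
      using smooth2_continuous[OF u_smooth] smooth2_continuous[OF smooth_ut]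
      unfolding case_prod_beta' by (intro continuous_intros)
    show "(\<lambda>s. u t s ^ Suc m) integrable_on {a..b}" if "t \<in> {0<..<T}" for t
      using has_integral_Volume[of t] that by (auto simp: has_integral_integrable)
  qed
  moreover have "integral {a..b} (?Ft t) = 0"
    using integral_unique[OF has_integral_mult_right[OF volume_ut[OF t], of "real (Suc m)"]] by (simp only: mult.assoc mult_zero_right)
  ultimately show ?thesis by (simp add: Volume_def[abs_def])
qed

text \<open>After integration by parts, the boundary term vanishing by the Neumann condition, the derivative is
  \<open>\<integral> u^m H u_t\<close>, and subtracting \<open>h\<close> times the volume constraint turns it into
  \<open>- \<integral> u^m u_t\<^sup>2 / v\<close>.\<close>

lemma Area_deriv:
  assumes t: "t \<in> {0<..<T}"
  shows "(Area has_real_derivative - Dissipation t) (at t)"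
proof -
  obtain u1t where u1t: "smooth2 u1t" "d_time u1 u1t" "d_space ut u1t"
    by (rule u1_time_derivative)
  let ?Ft = "\<lambda>t s. m * u t s ^ (m - 1) * ut t s * v t s + u t s ^ m * (u1 t s / v t s) * u1t t s"
  have nz: "v t s \<noteq> 0" for t s using v_pos[of t s] by simp
  have "((\<lambda>t. integral {a..b} (\<lambda>s. u t s ^ m * v t s)) has_real_derivative integral {a..b} (?Ft t)) (at t)"
  proof (rule deriv_under_integral[OF _ _ _ t])
    show "d_time (\<lambda>t s. u t s ^ m * v t s) ?Ft"
      unfolding d_time_def
    proof (intro ballI)
      fix t s assume ts: "t \<in> {0<..<T}" "s \<in> {a..b}"
      have "((\<lambda>\<tau>. u1 \<tau> s) has_real_derivative u1t t s) (at t)"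
        using u1t(2) ts unfolding d_time_def by blast
      then have "((\<lambda>\<tau>. 1 + (u1 \<tau> s)\<^sup>2) has_real_derivative 2 * u1 t s * u1t t s) (at t)"
        by (auto intro!: derivative_eq_intros)
      from DERIV_chain2[OF DERIV_real_sqrt this]
      have "((\<lambda>\<tau>. v \<tau> s) has_real_derivative u1 t s / v t s * u1t t s) (at t)"
        unfolding v_def by (simp add: add_pos_nonneg divide_simps)
      from DERIV_mult[OF power_time_deriv[OF ts, of m] this]
      show "((\<lambda>\<tau>. u \<tau> s ^ m * v \<tau> s) has_real_derivative ?Ft t s) (at t)"
        by (simp add: algebra_simps)
    qed
    have "continuous_on ({0<..<T} \<times> {a..b}) (\<lambda>(t, s). u1 t s)"
      by (rule smooth2_continuous[OF smooth_u1])
    then have "continuous_on ({0<..<T} \<times> {a..b}) (\<lambda>(t, s). v t s)"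
      unfolding v_def case_prod_beta' by (intro continuous_intros)
    then show "continuous_on ({0<..<T} \<times> {a..b}) (\<lambda>(t, s). ?Ft t s)"
      using smooth2_continuous[OF u_smooth] smooth2_continuous[OF smooth_ut] smooth2_continuous[OF smooth_u1]
        smooth2_continuous[OF u1t(1)] nz
      unfolding case_prod_beta' by (intro continuous_intros) auto
    show "(\<lambda>s. u t s ^ m * v t s) integrable_on {a..b}" if "t \<in> {0<..<T}" for t
      using has_integral_Area[of t] that by (auto simp: has_integral_integrable)
  qed
  moreover have "(?Ft t has_integral - Dissipation t) {a..b}"
  proof -
    have t0: "t \<in> {0..<T}" using t by auto
    let ?P = "\<lambda>s. u t s ^ m * (u1 t s / v t s) * ut t s"
    let ?P' = "\<lambda>s. (m * u t s ^ (m - 1) * u1 t s * (u1 t s / v t s) + u t s ^ m * (psi t s / v t s)) * ut t s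
        + u t s ^ m * (u1 t s / v t s) * u1t t s"
    have "(?P' has_integral ?P b - ?P a) {a..b}"
    proof (rule has_integral_derivative)
      fix s assume s: "s \<in> {a..b}"
      have "(ut t has_real_derivative u1t t s) (at s within {a..b})"
        using u1t(3) t s unfolding d_space_def by blast
      from DERIV_mult[OF DERIV_mult[OF DERIV_power[OF u_deriv[OF t0 s], of m] slope_quotient_deriv[OF t0 s]] this]
      show "(?P has_real_derivative ?P' s) (at s within {a..b})"
        by (simp add: algebra_simps)
    qed
    then have P: "(?P' has_integral 0) {a..b}" using neumann t0 by simp
    have eq: "?Ft t s = ?P' s + (h t * (u t s ^ m * ut t s) - u t s ^ m * (ut t s)\<^sup>2 / v t s)" if s: "s \<in> {a..b}" for s
    proof -
      define c where "c = 1 / v t s"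
      have vc: "v t s * c = 1" "x / v t s = x * c" for x using v_pos[of t s] by (simp_all add: c_def)
      have vv: "v t s * v t s = 1 + u1 t s * u1 t s" using v_sq[of t s] by (simp add: power2_eq_square)
      have uu: "m * u t s ^ (m - 1) = u t s ^ m * (m / u t s)"
        using u_pos[OF t0 s] by (cases m) simp_all
      have "P * q * y * w + P * (x * c) * X =
          (P * q * x * (x * c) + P * (p * c)) * y + P * (x * c) * X + (k * (P * y) - P * (y * y) * c)"
        if "w * c = 1" "w * w = 1 + x * x" "y = p - q + k * w" for P q y w x X p k c :: real
        using that by algebra
      from this[OF vc(1) vv ut_def] show ?thesis
        unfolding uu vc(2) power2_eq_square .
    qed
    have "((\<lambda>s. ?P' s + (h t * (u t s ^ m * ut t s) - u t s ^ m * (ut t s)\<^sup>2 / v t s)) has_integral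
        0 + (h t * 0 - Dissipation t)) {a..b}"
      by (intro has_integral_add has_integral_diff P has_integral_mult_right volume_ut[OF t] has_integral_Dissipation[OF t])
    then show ?thesis using eq by (subst has_integral_cong[OF eq]) auto
  qed
  ultimately show ?thesis by (simp add: Area_def[abs_def] integral_unique)
qed

end

context graph_flow
begin

lemma Area_Volume_continuous: "continuous_on {0..<T} Area" "continuous_on {0..<T} Volume"
proof -
  have "continuous_on {0..<T} (\<lambda>t. integral (cbox a b) (\<lambda>s. u t s ^ m * v t s))"
    using u_cont u1_cont unfolding v_def case_prod_beta'
    by (intro integral_continuous_on_param) (auto simp: case_prod_beta' intro!: continuous_intros)
  then show "continuous_on {0..<T} Area" by (simp add: Area_def[abs_def])
  have "continuous_on {0..<T} (\<lambda>t. integral (cbox a b) (\<lambda>s. u t s ^ Suc m))"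
    using u_cont unfolding case_prod_beta'
    by (intro integral_continuous_on_param) (auto simp: case_prod_beta' intro!: continuous_intros)
  then show "continuous_on {0..<T} Volume" by (simp add: Volume_def[abs_def])
qed

lemma Dissipation_nonneg:
  assumes "t \<in> {0<..<T}"
  shows "Dissipation t \<ge> 0"
proof (rule has_integral_nonneg[OF has_integral_Dissipation[OF assms]])
  fix s assume "s \<in> {a..b}"
  then show "0 \<le> u t s ^ m * (ut t s)\<^sup>2 / v t s"
    using u_pos[of t s] v_pos[of t s] assms by simp
qed

lemma Area_le_initial:
  assumes t: "t \<in> {0..<T}"
  shows "Area t \<le> Area 0"
proof (rule DERIV_nonpos_imp_decreasing_open[of 0 t Area])
  show "0 \<le> t" using t by simp
  show "continuous_on {0..t} Area"
    using Area_Volume_continuous(1) t by (auto elim!: continuous_on_subset)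
  fix x assume "0 < x" "x < t"
  then have "x \<in> {0<..<T}" using t by auto
  then show "\<exists>y. (Area has_real_derivative y) (at x) \<and> y \<le> 0"
    using Area_deriv Dissipation_nonneg by (intro exI[of _ "- Dissipation x"]) auto
qed

lemma Volume_eq_initial:
  assumes t: "t \<in> {0..<T}"
  shows "Volume t = Volume 0"
proof (cases "t = 0")
  case False
  then have "0 < t" using t by simp
  then show ?thesis
  proof (rule DERIV_isconst_end)
    show "continuous_on {0..t} Volume"
      using Area_Volume_continuous(2) t by (auto elim!: continuous_on_subset)
    show "(Volume has_real_derivative 0) (at x)" if "0 < x" "x < t" for x
      using that t by (intro Volume_deriv) auto
  qed
qed simp

lemma Area_nonneg: "t \<in> {0..<T} \<Longrightarrow> Area t \<ge> 0"
  using has_integral_Area u_pos v_pos less_imp_le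
  by (intro has_integral_nonneg[of "\<lambda>s. u t s ^ m * v t s" "Area t" "{a..b}"]) (auto intro!: mult_nonneg_nonneg zero_le_power simp: less_imp_le)

lemma Volume_pos: "Volume 0 > 0"
proof -
  have T0: "0 \<in> {0..<T}" using T by simp
  obtain s0 where s0: "s0 \<in> {a..b}" "\<And>s. s \<in> {a..b} \<Longrightarrow> u 0 s0 \<le> u 0 s"
    using continuous_attains_inf[OF compact_Icc _ slice_cont(1)[OF T0]] ab by (metis atLeastAtMost_iff empty_iff less_eq_real_def)
  have "((\<lambda>s. u 0 s0 ^ Suc m) has_integral (b - a) * u 0 s0 ^ Suc m) {a..b}"
    using has_integral_const_real[of "u 0 s0 ^ Suc m" a b] ab by simp
  from has_integral_le[OF this has_integral_Volume[OF T0]]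
  have "(b - a) * u 0 s0 ^ Suc m \<le> Volume 0"
    using s0 u_pos[OF T0] by (auto intro!: power_mono simp del: power_Suc simp: less_imp_le)
  moreover have "(b - a) * u 0 s0 ^ Suc m > 0"
    using ab u_pos[OF T0 s0(1)] by simp
  ultimately show ?thesis by linarith
qed

text \<open>\<open>(u^n)' = n u^m w\<close>, and \<open>|w| \<le> v\<close>, so area controls the oscillation of \<open>u^n\<close>.\<close>

lemma power_oscillation:
  assumes t: "t \<in> {0..<T}" and xy: "a \<le> x" "x \<le> y" "y \<le> b"
  shows "\<bar>u t y ^ Suc m - u t x ^ Suc m\<bar> \<le> Suc m * Area t"
proof -
  let ?g = "\<lambda>s. Suc m * u t s ^ m * u1 t s" and ?k = "\<lambda>s. Suc m * (u t s ^ m * v t s)"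
  have "(?g has_integral u t y ^ Suc m - u t x ^ Suc m) {x..y}"
  proof (rule fundamental_theorem_of_calculus[OF xy(2)])
    fix s assume s: "s \<in> {x..y}"
    then have sab: "s \<in> {a..b}" using xy by auto
    from DERIV_power[OF u_deriv[OF t sab], of "Suc m"]
    have "((\<lambda>s. u t s ^ Suc m) has_real_derivative ?g s) (at s within {a..b})" by (simp add: mult_ac)
    then show "((\<lambda>s. u t s ^ Suc m) has_vector_derivative ?g s) (at s within {x..y})"
      unfolding has_real_derivative_iff_has_vector_derivative
      by (rule has_vector_derivative_within_subset) (use xy in auto)
  qed
  then have g: "integral {x..y} ?g = u t y ^ Suc m - u t x ^ Suc m" "?g integrable_on {x..y}"
    by (auto simp: integral_unique has_integral_integrable)
  have k: "(?k has_integral Suc m * Area t) {a..b}"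
    by (rule has_integral_mult_right[OF has_integral_Area[OF t]])
  then have kx: "?k integrable_on {x..y}"
    by (rule integrable_on_subinterval[OF has_integral_integrable]) (use xy in auto)
  have pos: "u t s > 0" if "s \<in> {a..b}" for s using u_pos[OF t that] .
  have "norm (integral {x..y} ?g) \<le> integral {x..y} ?k"
  proof (rule integral_norm_bound_integral[OF g(2) kx])
    fix s assume "s \<in> {x..y}"
    then have "s \<in> {a..b}" using xy by auto
    then have "u t s ^ m \<ge> 0" using pos by (simp add: less_imp_le)
    then have "u t s ^ m * \<bar>u1 t s\<bar> \<le> u t s ^ m * v t s" by (rule mult_left_mono[OF abs_u1_le_v])
    then have "Suc m * (u t s ^ m * \<bar>u1 t s\<bar>) \<le> Suc m * (u t s ^ m * v t s)" by (rule mult_left_mono) simp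
    moreover have "norm (?g s) = Suc m * (u t s ^ m * \<bar>u1 t s\<bar>)"
      using \<open>u t s ^ m \<ge> 0\<close> by (simp add: abs_mult)
    ultimately show "norm (?g s) \<le> ?k s" by simp
  qed
  also have "\<dots> \<le> integral {a..b} ?k"
  proof (rule integral_subset_le[OF _ kx has_integral_integrable[OF k]])
    show "{x..y} \<subseteq> {a..b}" using xy by auto
    show "\<forall>s\<in>{a..b}. 0 \<le> ?k s"
    proof
      fix s assume "s \<in> {a..b}"
      then show "0 \<le> ?k s" using pos[of s] v_pos[of t s] by simp
    qed
  qed
  also have "\<dots> = Suc m * Area t" using k by (rule integral_unique)
  finally show ?thesis using g by simp
qed

text \<open>An upper bound for the profile.  The value \<open>1\<close> allows passing from a bound on \<open>u^n\<close> to one on \<open>u\<close>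
  without roots.\<close>

definition U :: real where
  "U = max 1 (Volume 0 / (b - a) + Suc m * Area 0)"

text \<open>The minimum of \<open>u^n\<close> is at most its mean, which the volume controls, and the oscillation is
  controlled by the area.\<close>

lemma u_le_U:
  assumes t: "t \<in> {0..<T}" and s: "s \<in> {a..b}"
  shows "u t s \<le> U"
proof -
  obtain s0 where s0: "s0 \<in> {a..b}" "\<And>s. s \<in> {a..b} \<Longrightarrow> u t s0 \<le> u t s"
    using continuous_attains_inf[OF compact_Icc _ slice_cont(1)[OF t]] ab by (metis atLeastAtMost_iff empty_iff less_eq_real_def)
  have "((\<lambda>s. u t s0 ^ Suc m) has_integral (b - a) * u t s0 ^ Suc m) {a..b}"
    using has_integral_const_real[of "u t s0 ^ Suc m" a b] ab by simp
  from has_integral_le[OF this has_integral_Volume[OF t]]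
  have "(b - a) * u t s0 ^ Suc m \<le> Volume t"
    using s0 u_pos[OF t] by (auto intro!: power_mono simp del: power_Suc simp: less_imp_le)
  then have 1: "u t s0 ^ Suc m \<le> Volume 0 / (b - a)"
    using ab Volume_eq_initial[OF t] by (simp add: field_simps)
  have "\<bar>u t s ^ Suc m - u t s0 ^ Suc m\<bar> \<le> Suc m * Area t"
    using power_oscillation[OF t, of s s0] power_oscillation[OF t, of s0 s] s s0(1)
    by (cases "s \<le> s0") (auto simp del: power_Suc simp: abs_minus_commute)
  also have "\<dots> \<le> Suc m * Area 0" using Area_le_initial[OF t] by (intro mult_left_mono) auto
  finally have le: "u t s ^ Suc m \<le> Volume 0 / (b - a) + Suc m * Area 0"
    using 1 by linarith
  show ?thesis
  proof (cases "u t s \<le> 1")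
    case False
    then have "u t s \<le> u t s ^ Suc m" by (intro self_le_power) auto
    then show ?thesis using le unfolding U_def by linarith
  qed (simp add: U_def)
qed

text \<open>The first variation of area tested with the radial field.  The integrand of \<open>u^n H\<close> differs from
  the first summand by the derivative of \<open>u^n w / v\<close>, which vanishes at both ends.\<close>

lemma radial_first_variation:
  assumes t: "t \<in> {0<..<T}"
  shows "((\<lambda>s. u t s ^ m * ((m + Suc m * (u1 t s)\<^sup>2) / v t s) + u t s ^ Suc m * (ut t s / v t s))
    has_integral h t * Volume t) {a..b}"
proof -
  have t0: "t \<in> {0..<T}" using t by auto
  let ?R = "\<lambda>s. u t s ^ Suc m * (u1 t s / v t s)"
  let ?R' = "\<lambda>s. Suc m * u t s ^ m * u1 t s * (u1 t s / v t s) + u t s ^ Suc m * (psi t s / v t s)"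
  have "(?R' has_integral ?R b - ?R a) {a..b}"
  proof (rule has_integral_derivative)
    fix s assume s: "s \<in> {a..b}"
    from DERIV_mult[OF DERIV_power[OF u_deriv[OF t0 s], of "Suc m"] slope_quotient_deriv[OF t0 s]]
    show "(?R has_real_derivative ?R' s) (at s within {a..b})"
      by (simp add: algebra_simps)
  qed
  then have R: "(?R' has_integral 0) {a..b}" using neumann t0 by simp
  have eq: "u t s ^ m * ((m + Suc m * (u1 t s)\<^sup>2) / v t s) + u t s ^ Suc m * (ut t s / v t s) =
      ?R' s + h t * u t s ^ Suc m" if s: "s \<in> {a..b}" for s
  proof -
    define c where "c = 1 / v t s"
    have vc: "v t s * c = 1" "x / v t s = x * c" for x using v_pos[of t s] by (simp_all add: c_def)
    have uu: "u t s * (m / u t s) = m"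
      using u_pos[OF t0 s] by simp
    have "P * ((r + n * x\<^sup>2) * c) + (y * P) * (z * c) = n * P * x * (x * c) + (y * P) * (p * c) + k * (y * P)"
      if "w * c = 1" "y * q = r" "z = p - q + k * w" for P q y z w x r n p k c :: real
      using that unfolding power2_eq_square by algebra
    from this[OF vc(1) uu ut_def] show ?thesis
      unfolding vc(2) power_Suc .
  qed
  show ?thesis
    using has_integral_add[OF R has_integral_mult_right[OF has_integral_Volume[OF t0], of "h t"]]
    by (subst has_integral_cong[OF eq]) (auto simp del: power_Suc)
qed

text \<open>The identity is multiplied by \<open>h\<close> so that Young's inequality, with weight \<open>\<mu>\<close>, can be applied under
  the integral; \<open>\<mu>\<close> is chosen so that a quarter of \<open>h\<^sup>2 Volume\<close> can be absorbed on the left.\<close>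

lemma h_sq_le:
  assumes t: "t \<in> {0<..<T}"
  shows "(h t)\<^sup>2 \<le> 2 * Area 0 / (Volume 0)\<^sup>2 * ((real (Suc m))\<^sup>2 * Area 0 + U\<^sup>2) * (1 + Dissipation t)"
proof -
  have t0: "t \<in> {0..<T}" using t by auto
  have V: "Volume t = Volume 0" "Volume 0 > 0" using Volume_eq_initial[OF t0] Volume_pos by auto
  have U: "U \<ge> 1" by (simp add: U_def)
  have A: "Area t \<le> Area 0" "0 \<le> Area t" using Area_le_initial[OF t0] Area_nonneg[OF t0] by auto
  have A0: "Area 0 > 0"
  proof -
    have "u t s ^ Suc m \<le> U * (u t s ^ m * v t s)" if s: "s \<in> {a..b}" for s
    proof -
      have "u t s * u t s ^ m * 1 \<le> U * u t s ^ m * v t s"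
        using u_le_U[OF t0 s] u_pos[OF t0 s] v_ge_1[of t s] U by (intro mult_mono mult_right_mono) auto
      then show ?thesis by (simp add: mult_ac)
    qed
    then have "Volume t \<le> U * Area t"
      using has_integral_le[OF has_integral_Volume[OF t0] has_integral_mult_right[OF has_integral_Area[OF t0]]] by blast
    then have "Area t \<noteq> 0" using V by auto
    then show ?thesis using A by linarith
  qed
  define \<mu> where "\<mu> = Volume 0 / (2 * Area 0)"
  have \<mu>: "\<mu> > 0" using V A0 by (simp add: \<mu>_def)
  have "h t * (h t * Volume t) \<le> (\<bar>h t\<bar> * Suc m + \<mu> / 2 * (h t)\<^sup>2) * Area t + U\<^sup>2 / (2 * \<mu>) * Dissipation t"
  proof (rule has_integral_le[OF has_integral_mult_right[OF radial_first_variation[OF t]]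
        has_integral_add[OF has_integral_mult_right[OF has_integral_Area[OF t0]]
          has_integral_mult_right[OF has_integral_Dissipation[OF t]]]])
    fix s assume s: "s \<in> {a..b}"
    let ?u = "u t s" and ?v = "v t s" and ?w = "u1 t s" and ?y = "ut t s"
    have u: "0 < ?u" "?u \<le> U" using u_pos[OF t0 s] u_le_U[OF t0 s] by auto
    have v: "?v \<ge> 1" "?v > 0" by (rule v_ge_1, rule v_pos)
    have P: "?u ^ m \<ge> 0" using u by simp
    have q: "0 \<le> (m + Suc m * ?w\<^sup>2) / ?v" "(m + Suc m * ?w\<^sup>2) / ?v \<le> Suc m * ?v"
    proof -
      show "0 \<le> (m + Suc m * ?w\<^sup>2) / ?v" using v by simp
      have "m + Suc m * ?w\<^sup>2 \<le> Suc m * ?v\<^sup>2" unfolding v_sq by (simp add: algebra_simps)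
      then show "(m + Suc m * ?w\<^sup>2) / ?v \<le> Suc m * ?v" using v by (simp add: divide_le_eq power2_eq_square mult.assoc)
    qed
    have 1: "h t * ((m + Suc m * ?w\<^sup>2) / ?v) \<le> \<bar>h t\<bar> * (Suc m * ?v)"
      using q by (intro mult_mono) auto
    have 2: "h t * (?u * (?y / ?v)) \<le> \<mu> / 2 * (h t)\<^sup>2 * ?v + U\<^sup>2 / (2 * \<mu>) * (?y\<^sup>2 / ?v)"
    proof -
      have "2 * (\<mu> * h t) * (?u * (?y / ?v)) \<le> (\<mu> * h t)\<^sup>2 + (?u * (?y / ?v))\<^sup>2"
        by (rule sum_squares_bound)
      also have "\<dots> \<le> \<mu>\<^sup>2 * (h t)\<^sup>2 * ?v + U\<^sup>2 * (?y\<^sup>2 / ?v)"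
      proof (rule add_mono)
        show "(\<mu> * h t)\<^sup>2 \<le> \<mu>\<^sup>2 * (h t)\<^sup>2 * ?v"
          using mult_left_mono[OF v(1), of "(\<mu> * h t)\<^sup>2"] by (simp add: power_mult_distrib)
        have "?y\<^sup>2 / ?v\<^sup>2 \<le> ?y\<^sup>2 / ?v"
          using v by (intro divide_left_mono) (auto simp: power2_eq_square)
        moreover have "?u\<^sup>2 \<le> U\<^sup>2" using u by (intro power_mono) auto
        ultimately show "(?u * (?y / ?v))\<^sup>2 \<le> U\<^sup>2 * (?y\<^sup>2 / ?v)"
          unfolding power_mult_distrib power_divide using v by (intro mult_mono) auto
      qed
      finally have "(2 * (\<mu> * h t) * (?u * (?y / ?v))) / (2 * \<mu>) \<le> (\<mu>\<^sup>2 * (h t)\<^sup>2 * ?v + U\<^sup>2 * (?y\<^sup>2 / ?v)) / (2 * \<mu>)"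
        using \<mu> by (intro divide_right_mono) auto
      then show ?thesis using \<mu> by (simp add: add_divide_distrib power2_eq_square mult_ac)
    qed
    have "h t * (?u ^ m * ((m + Suc m * ?w\<^sup>2) / ?v) + ?u ^ Suc m * (?y / ?v)) =
        ?u ^ m * (h t * ((m + Suc m * ?w\<^sup>2) / ?v) + h t * (?u * (?y / ?v)))"
      by (simp add: algebra_simps)
    also have "\<dots> \<le> ?u ^ m * (\<bar>h t\<bar> * (Suc m * ?v) + (\<mu> / 2 * (h t)\<^sup>2 * ?v + U\<^sup>2 / (2 * \<mu>) * (?y\<^sup>2 / ?v)))"
      by (rule mult_left_mono[OF add_mono[OF 1 2] P])
    also have "\<dots> = (\<bar>h t\<bar> * Suc m + \<mu> / 2 * (h t)\<^sup>2) * (?u ^ m * ?v) + U\<^sup>2 / (2 * \<mu>) * (?u ^ m * ?y\<^sup>2 / ?v)"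
      by (simp add: algebra_simps)
    finally show "h t * (?u ^ m * ((m + Suc m * ?w\<^sup>2) / ?v) + ?u ^ Suc m * (?y / ?v)) \<le> \<dots>" .
  qed
  also have "\<dots> \<le> (\<bar>h t\<bar> * Suc m + \<mu> / 2 * (h t)\<^sup>2) * Area 0 + U\<^sup>2 / (2 * \<mu>) * Dissipation t"
    using A \<mu> by (intro add_mono mult_left_mono) auto
  finally have main: "(h t)\<^sup>2 * Volume 0 \<le> \<bar>h t\<bar> * Suc m * Area 0 + \<mu> / 2 * (h t)\<^sup>2 * Area 0 + U\<^sup>2 / (2 * \<mu>) * Dissipation t"
    using V by (simp add: power2_eq_square algebra_simps)
  let ?V = "Volume 0" and ?A = "Area 0" and ?n = "real (Suc m)" and ?D = "Dissipation t"
  have e1: "\<mu> / 2 * (h t)\<^sup>2 * ?A = (h t)\<^sup>2 * ?V / 4"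
    using A0 by (simp add: \<mu>_def field_simps)
  have e2: "U\<^sup>2 / (2 * \<mu>) * ?D = U\<^sup>2 * ?A / ?V * ?D"
    using A0 V by (simp add: \<mu>_def field_simps)
  have e3: "\<bar>h t\<bar> * ?n * ?A \<le> (h t)\<^sup>2 * ?V / 4 + ?n\<^sup>2 * ?A\<^sup>2 / ?V"
  proof -
    have "(\<bar>h t\<bar> * ?n * ?A) * ?V = 2 * (\<bar>h t\<bar> * ?V / 2) * (?n * ?A)" by simp
    also have "\<dots> \<le> (\<bar>h t\<bar> * ?V / 2)\<^sup>2 + (?n * ?A)\<^sup>2"
      by (rule sum_squares_bound)
    also have "\<dots> = ((h t)\<^sup>2 * ?V / 4 + ?n\<^sup>2 * ?A\<^sup>2 / ?V) * ?V"
      using V(2) by (simp add: field_simps power_mult_distrib power_divide power2_eq_square[of ?V] del: of_nat_Suc)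
    finally have "(\<bar>h t\<bar> * ?n * ?A) * ?V \<le> ((h t)\<^sup>2 * ?V / 4 + ?n\<^sup>2 * ?A\<^sup>2 / ?V) * ?V" .
    then show ?thesis using V(2) by (rule mult_right_le_imp_le)
  qed
  from main e1 e2 e3 have "(h t)\<^sup>2 * ?V / 2 \<le> ?n\<^sup>2 * ?A\<^sup>2 / ?V + U\<^sup>2 * ?A / ?V * ?D" by linarith
  also have "\<dots> \<le> (?n\<^sup>2 * ?A\<^sup>2 / ?V + U\<^sup>2 * ?A / ?V) * (1 + ?D)"
    using Dissipation_nonneg[OF t] V A0 by (simp add: distrib_left distrib_right)
  finally have "(h t)\<^sup>2 * ?V / 2 * (2 / ?V) \<le> (?n\<^sup>2 * ?A\<^sup>2 / ?V + U\<^sup>2 * ?A / ?V) * (1 + ?D) * (2 / ?V)"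
    using V by (intro mult_right_mono) auto
  then show ?thesis using V by (simp add: field_simps power2_eq_square del: of_nat_Suc)
qed

text \<open>\<open>B\<close> plays the role of \<open>\<integral> h\<^sup>2 dt\<close>: the witness is a multiple of \<open>t + Area 0 - Area t\<close>, whose
  derivative is \<open>1 + Dissipation t\<close>.\<close>

lemma energy_barrier:
  obtains B B' C where "\<And>t. t \<in> {0<..<T} \<Longrightarrow> (B has_real_derivative B' t) (at t)"
    "\<And>t. t \<in> {0<..<T} \<Longrightarrow> (h t)\<^sup>2 \<le> B' t"
    "\<And>t. t \<in> {0..<T} \<Longrightarrow> 0 \<le> B t" "\<And>t. t \<in> {0..<T} \<Longrightarrow> B t \<le> C" "continuous_on {0..<T} B"
proof -
  define c where "c = 2 * Area 0 / (Volume 0)\<^sup>2 * ((real (Suc m))\<^sup>2 * Area 0 + U\<^sup>2)"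
  have A0: "Area 0 \<ge> 0" using Area_nonneg T by simp
  have c: "c \<ge> 0" using A0 unfolding c_def by simp
  show ?thesis
  proof (rule that[of "\<lambda>t. c * (t + (Area 0 - Area t))" "\<lambda>t. c * (1 + Dissipation t)" "c * (T + Area 0)"])
    show "((\<lambda>t. c * (t + (Area 0 - Area t))) has_real_derivative c * (1 + Dissipation t)) (at t)" if "t \<in> {0<..<T}" for t
      using Area_deriv[OF that] by (auto intro!: derivative_eq_intros)
    show "(h t)\<^sup>2 \<le> c * (1 + Dissipation t)" if "t \<in> {0<..<T}" for t
      using h_sq_le[OF that] by (simp only: c_def)
    show "0 \<le> c * (t + (Area 0 - Area t))" if "t \<in> {0..<T}" for t
      using c Area_le_initial[OF that] that by auto
    show "c * (t + (Area 0 - Area t)) \<le> c * (T + Area 0)" if "t \<in> {0..<T}" for t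
      using c Area_nonneg[OF that] that by (intro mult_left_mono) auto
    show "continuous_on {0..<T} (\<lambda>t. c * (t + (Area 0 - Area t)))"
      by (intro continuous_intros Area_Volume_continuous)
  qed
qed

end

section \<open>Evolution of slope and curvature\<close>

context graph_flow
begin

lemma v_d_time:
  assumes "d_time u1 u1t"
  shows "d_time v (\<lambda>t s. u1 t s * u1t t s / v t s)"
  unfolding d_time_def
proof (intro ballI)
  fix t s assume ts: "t \<in> {0<..<T}" "s \<in> {a..b}"
  have "((\<lambda>\<tau>. u1 \<tau> s) has_real_derivative u1t t s) (at t)"
    using assms ts unfolding d_time_def by blast
  then have "((\<lambda>\<tau>. 1 + (u1 \<tau> s)\<^sup>2) has_real_derivative 2 * u1 t s * u1t t s) (at t)"
    by (auto intro!: derivative_eq_intros)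
  from DERIV_chain2[OF DERIV_real_sqrt this]
  show "((\<lambda>\<tau>. v \<tau> s) has_real_derivative u1 t s * u1t t s / v t s) (at t)"
    unfolding v_def by (simp add: add_pos_nonneg divide_simps)
qed

lemma psi_space_deriv_value:
  assumes "(u2 t has_real_derivative z1) (at s within {a..b})" "t \<in> {0..<T}" "s \<in> {a..b}"
  shows "(psi t has_real_derivative (z1 * (v t s)\<^sup>2 - u2 t s * (2 * u1 t s * u2 t s)) / ((v t s)\<^sup>2 * (v t s)\<^sup>2)) (at s within {a..b})"
proof -
  have "((\<lambda>s. 1 + (u1 t s)\<^sup>2) has_real_derivative 2 * u1 t s * u2 t s) (at s within {a..b})"
    by (auto intro!: derivative_eq_intros u1_deriv[OF assms(2,3)])
  from DERIV_divide[OF assms(1) this] show ?thesis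
    using v_pos[of t s] unfolding psi_def[abs_def] v_sq[symmetric] by simp
qed

text \<open>The evolution equations of slope and curvature, obtained by differentiating
  \<open>u_t = psi - m / u + h v\<close> once and twice in \<open>s\<close> and commuting derivatives.  They are kept in factored
  form, since the barrier computations are purely algebraic.\<close>

lemma derivative_relations:
  obtains u1t u2t u3 psi1 psi2 psit where
    "d_time u1 u1t" "d_space u2 u3" "d_space psi psi1" "d_space psi1 psi2" "d_time psi psit"
    "\<forall>t\<in>{0<..<T}. \<forall>s\<in>{a..b}. u3 t s = psi1 t s * (v t s)\<^sup>2 + 2 * u1 t s * psi t s * u2 t s"
    "\<forall>t\<in>{0<..<T}. \<forall>s\<in>{a..b}. u1t t s = psi1 t s + m * u1 t s / (u t s)\<^sup>2 + h t * u1 t s * psi t s * v t s"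
    "\<forall>t\<in>{0<..<T}. \<forall>s\<in>{a..b}. u2t t s = psi2 t s + m * u2 t s / (u t s)\<^sup>2 - 2 * real m * (u1 t s)\<^sup>2 / u t s ^ 3
       + h t * (u2 t s * psi t s * v t s + u1 t s * psi1 t s * v t s + u1 t s * psi t s * (u1 t s * u2 t s / v t s))"
    "\<forall>t\<in>{0<..<T}. \<forall>s\<in>{a..b}. psit t s = u2t t s / (v t s)\<^sup>2 - 2 * u1 t s * u2 t s * u1t t s / ((v t s)\<^sup>2)\<^sup>2"
proof -
  obtain u1t where u1t: "smooth2 u1t" "d_time u1 u1t" "d_space ut u1t"
    by (rule u1_time_derivative)
  obtain u2t u3 where u3: "smooth2 u2t" "smooth2 u3" "d_time u2 u2t" "d_space u2 u3"
    using smooth2_partials[OF smooth_u2] by metis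
  obtain u4 where u4: "d_space u3 u4"
    using smooth2_partials[OF u3(2)] by metis
  have u1t': "d_space u1t u2t"
    using mixed_partials_commute[OF d_space_u1 u1t(2) u3(3) smooth_u2 u3(1)] .
  define psi1 where "psi1 = (\<lambda>t s. (u3 t s * (v t s)\<^sup>2 - u2 t s * (2 * u1 t s * u2 t s)) / ((v t s)\<^sup>2 * (v t s)\<^sup>2))"
  define psi2 where "psi2 = (\<lambda>t s. SOME D. (psi1 t has_real_derivative D) (at s within {a..b}))"
  define psit where "psit = (\<lambda>t s. u2t t s / (v t s)\<^sup>2 - 2 * u1 t s * u2 t s * u1t t s / ((v t s)\<^sup>2)\<^sup>2)"
  have D: "(u t has_real_derivative u1 t s) (at s within {a..b})" "(u1 t has_real_derivative u2 t s) (at s within {a..b})"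
    "(u2 t has_real_derivative u3 t s) (at s within {a..b})" "(u3 t has_real_derivative u4 t s) (at s within {a..b})"
    "(v t has_real_derivative u1 t s * u2 t s / v t s) (at s within {a..b})" "u t s > 0"
    if "t \<in> {0<..<T}" "s \<in> {a..b}" for t s
    using that u_deriv u1_deriv u3(4) u4 v_space_deriv u_pos unfolding d_space_def by auto
  have p1: "d_space psi psi1"
    unfolding d_space_def psi1_def
    using psi_space_deriv_value D(3) by auto
  have ex: "\<exists>D. (psi1 t has_real_derivative D) (at s within {a..b})" if ts: "t \<in> {0<..<T}" "s \<in> {a..b}" for t s
  proof -
    have "(v t s)\<^sup>2 * (v t s)\<^sup>2 \<noteq> 0" using v_pos[of t s] by simp
    then show ?thesis
      unfolding psi1_def
      by (intro exI) (rule DERIV_divide DERIV_diff DERIV_mult DERIV_power DERIV_const D[OF ts] | assumption)+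
  qed
  have p2: "d_space psi1 psi2"
    unfolding d_space_def psi2_def by (intro ballI someI_ex[OF ex])
  have pt: "d_time psi psit"
    unfolding d_time_def
  proof (intro ballI)
    fix t s assume ts: "t \<in> {0<..<T}" "s \<in> {a..b}"
    have "((\<lambda>\<tau>. u1 \<tau> s) has_real_derivative u1t t s) (at t)" and z: "((\<lambda>\<tau>. u2 \<tau> s) has_real_derivative u2t t s) (at t)"
      using u1t(2) u3(3) ts unfolding d_time_def by blast+
    then have w: "((\<lambda>\<tau>. 1 + (u1 \<tau> s)\<^sup>2) has_real_derivative 2 * u1 t s * u1t t s) (at t)"
      by (auto intro!: derivative_eq_intros)
    have "(u2t t s * (v t s)\<^sup>2 - u2 t s * (2 * u1 t s * u1t t s)) / ((v t s)\<^sup>2 * (v t s)\<^sup>2) = psit t s"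
      using v_pos[of t s] unfolding psit_def by (simp add: diff_divide_distrib power2_eq_square mult_ac)
    then show "((\<lambda>\<tau>. psi \<tau> s) has_real_derivative psit t s) (at t)"
      using DERIV_divide[OF z w] v_pos[of t s] unfolding psi_def v_sq[symmetric] by simp
  qed
  have e3: "u3 t s = psi1 t s * (v t s)\<^sup>2 + 2 * u1 t s * psi t s * u2 t s" for t s
  proof -
    have "psi1 t s * (v t s)\<^sup>2 = u3 t s - u2 t s * (2 * u1 t s * u2 t s) / (v t s)\<^sup>2"
    proof -
      have "(x * V - y) / (V * V) * V = x - y / V" if "V \<noteq> 0" for x y V :: real
        using that by (simp add: field_simps)
      moreover have "(v t s)\<^sup>2 \<noteq> 0" using v_pos[of t s] by simp
      ultimately show ?thesis unfolding psi1_def by blast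
    qed
    then show ?thesis unfolding psi_eq by (simp add: mult_ac)
  qed
  let ?E = "\<lambda>t s. psi1 t s + m * u1 t s / (u t s)\<^sup>2 + h t * u1 t s * psi t s * v t s"
  have "d_space ut ?E"
    unfolding d_space_def
  proof (intro ballI)
    fix t s assume ts: "t \<in> {0<..<T}" "s \<in> {a..b}"
    have p: "(psi t has_real_derivative psi1 t s) (at s within {a..b})"
      using p1 ts unfolding d_space_def by blast
    have "((\<lambda>s. psi t s - m / u t s + h t * v t s) has_real_derivative
        psi1 t s - (0 * u t s - m * u1 t s) / (u t s * u t s) + h t * (u1 t s * u2 t s / v t s)) (at s within {a..b})"
      using D(6)[OF ts] by (intro DERIV_add DERIV_diff p DERIV_divide DERIV_const D[OF ts] DERIV_cmult) auto
    then have "(ut t has_real_derivative psi1 t s - (0 * u t s - m * u1 t s) / (u t s * u t s)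
        + h t * (u1 t s * u2 t s / v t s)) (at s within {a..b})"
      unfolding ut_def[abs_def] .
    then show "(ut t has_real_derivative ?E t s) (at s within {a..b})"
    proof (rule DERIV_cong)
      have "x * (p * y\<^sup>2) / y = x * p * y" if "y \<noteq> 0" for x p y :: real
        using that by (simp add: power2_eq_square)
      then have "u1 t s * u2 t s / v t s = u1 t s * psi t s * v t s"
        using v_pos[of t s] by (subst u2_eq) simp
      then show "psi1 t s - (0 * u t s - m * u1 t s) / (u t s * u t s) + h t * (u1 t s * u2 t s / v t s) = ?E t s"
        by (simp only: power2_eq_square) simp
    qed
  qed
  then have e1: "u1t t s = ?E t s" if "t \<in> {0<..<T}" "s \<in> {a..b}" for t s
    using d_space_unique[OF u1t(3)] that by blast
  let ?E2 = "\<lambda>t s. psi2 t s + m * u2 t s / (u t s)\<^sup>2 - 2 * real m * (u1 t s)\<^sup>2 / u t s ^ 3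
       + h t * (u2 t s * psi t s * v t s + u1 t s * psi1 t s * v t s + u1 t s * psi t s * (u1 t s * u2 t s / v t s))"
  have "d_space ?E ?E2"
    unfolding d_space_def
  proof (intro ballI)
    fix t s assume ts: "t \<in> {0<..<T}" "s \<in> {a..b}"
    have p: "(psi t has_real_derivative psi1 t s) (at s within {a..b})" "(psi1 t has_real_derivative psi2 t s) (at s within {a..b})"
      using p1 p2 ts unfolding d_space_def by blast+
    have nz: "(u t s)\<^sup>2 \<noteq> 0" using D(6)[OF ts] by simp
    from DERIV_add[OF DERIV_add[OF p(2) DERIV_divide[OF DERIV_cmult[OF D(2)[OF ts], of "real m"] DERIV_power[OF D(1)[OF ts], of 2] nz]]
       DERIV_mult[OF DERIV_mult[OF DERIV_cmult[OF D(2)[OF ts], of "h t"] p(1)] D(5)[OF ts]]]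
    show "(?E t has_real_derivative ?E2 t s) (at s within {a..b})"
      by (rule DERIV_cong) (use D(6)[OF ts] in \<open>simp add: field_simps power2_eq_square power3_eq_cube\<close>)
  qed
  then have "d_space u1t ?E2"
    by (rule d_space_cong[rotated]) (simp add: e1)
  then have e2: "u2t t s = ?E2 t s" if "t \<in> {0<..<T}" "s \<in> {a..b}" for t s
    using d_space_unique[OF u1t'] that by blast
  show ?thesis
    by (rule that[OF u1t(2) u3(4) p1 p2 pt, of u2t]) (use e1 e2 e3 in \<open>auto simp: psit_def\<close>)
qed

end

section \<open>Bounds away from the axis\<close>

context graph_flow
begin

lemma cont_v: "continuous_on ({0..<T} \<times> {a..b}) (\<lambda>(t, s). v t s)"
  using u1_cont unfolding v_def case_prod_beta' by (intro continuous_intros)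

lemma cont_psi: "continuous_on ({0..<T} \<times> {a..b}) (\<lambda>(t, s). psi t s)"
proof -
  have "1 + (u1 t s)\<^sup>2 \<noteq> 0" for t s by (simp add: add_nonneg_eq_0_iff)
  then show ?thesis
    using u1_cont u2_cont unfolding psi_def case_prod_beta' by (intro continuous_intros) auto
qed

lemma bounded_on_slice:
  assumes "continuous_on {a..b} (f :: real \<Rightarrow> real)"
  obtains M where "M \<ge> 0" "\<And>s. s \<in> {a..b} \<Longrightarrow> \<bar>f s\<bar> \<le> M"
proof -
  have "bounded (f ` {a..b})"
    using compact_imp_bounded[OF compact_continuous_image[OF assms compact_Icc]] .
  then obtain M where "\<forall>y\<in>f ` {a..b}. norm y \<le> M" unfolding bounded_iff by blast
  then show ?thesis by (intro that[of "max M 0"]) (auto intro: max.coboundedI1)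
qed

text \<open>Solves the differential inequality \<open>K' \<ge> K (lam + mu h\<^sup>2)\<close> by a function bounded up to time \<open>T\<close>.\<close>

lemma exponential_barrier:
  assumes K0: "K0 > 0" and lam: "lam \<ge> 0" and mu: "mu \<ge> 0"
  obtains K K' C where "\<And>t. t \<in> {0<..<T} \<Longrightarrow> (K has_real_derivative K' t) (at t)"
    "\<And>t. t \<in> {0<..<T} \<Longrightarrow> K' t \<ge> K t * (lam + mu * (h t)\<^sup>2)"
    "\<And>t. t \<in> {0..<T} \<Longrightarrow> K0 \<le> K t" "\<And>t. t \<in> {0..<T} \<Longrightarrow> K t \<le> C" "continuous_on {0..<T} K"
proof -
  obtain B B' C where B: "\<And>t. t \<in> {0<..<T} \<Longrightarrow> (B has_real_derivative B' t) (at t)"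
    "\<And>t. t \<in> {0<..<T} \<Longrightarrow> (h t)\<^sup>2 \<le> B' t"
    "\<And>t. t \<in> {0..<T} \<Longrightarrow> 0 \<le> B t" "\<And>t. t \<in> {0..<T} \<Longrightarrow> B t \<le> C" "continuous_on {0..<T} B"
    by (rule energy_barrier) blast
  let ?K = "\<lambda>t. K0 * exp (lam * t + mu * B t)"
  show ?thesis
  proof (rule that[of ?K "\<lambda>t. ?K t * (lam + mu * B' t)" "K0 * exp (lam * T + mu * C)"])
    show "(?K has_real_derivative ?K t * (lam + mu * B' t)) (at t)" if "t \<in> {0<..<T}" for t
      using B(1)[OF that] by (auto intro!: derivative_eq_intros)
    show "?K t * (lam + mu * B' t) \<ge> ?K t * (lam + mu * (h t)\<^sup>2)" if "t \<in> {0<..<T}" for t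
      using B(2)[OF that] mu K0 by (intro mult_left_mono add_left_mono) auto
    show "K0 \<le> ?K t" if "t \<in> {0..<T}" for t
    proof -
      have "0 \<le> lam * t + mu * B t" using B(3)[OF that] lam mu that by simp
      then have "K0 * 1 \<le> ?K t" using K0 by (intro mult_left_mono) auto
      then show ?thesis by simp
    qed
    show "?K t \<le> K0 * exp (lam * T + mu * C)" if "t \<in> {0..<T}" for t
      using B(4)[OF that] lam mu K0 that by (auto intro!: mult_left_mono add_mono)
    show "continuous_on {0..<T} ?K" using B(5) by (intro continuous_intros)
  qed
qed

text \<open>The cut-off \<open>max (u - d) 0\<close> makes the compared function continuous on the whole strip while a
  touching point can only occur where \<open>u > d\<close>.  A point with vanishing slope cannot touch, because
  \<open>u\<close> lies below the barrier; this covers the ends of the interval.\<close>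

lemma gradient_bound:
  assumes d: "d > 0"
  obtains W where "W \<ge> 1" "\<And>t s. t \<in> {0..<T} \<Longrightarrow> s \<in> {a..b} \<Longrightarrow> u t s > d \<Longrightarrow> v t s * (u t s - d) \<le> W"
proof -
  obtain u1t u2t u3 psi1 psi2 psit where R:
    "d_time u1 u1t" "d_space u2 u3" "d_space psi psi1" "d_space psi1 psi2" "d_time psi psit"
    "\<forall>t\<in>{0<..<T}. \<forall>s\<in>{a..b}. u3 t s = psi1 t s * (v t s)\<^sup>2 + 2 * u1 t s * psi t s * u2 t s"
    "\<forall>t\<in>{0<..<T}. \<forall>s\<in>{a..b}. u1t t s = psi1 t s + m * u1 t s / (u t s)\<^sup>2 + h t * u1 t s * psi t s * v t s"
    by (rule derivative_relations)
  have T0: "0 \<in> {0..<T}" using T by simp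
  obtain M where M: "M \<ge> 0" "\<And>s. s \<in> {a..b} \<Longrightarrow> \<bar>v 0 s\<bar> \<le> M"
    using bounded_on_slice[OF slice_cont(4)[OF T0]] by blast
  have U: "U \<ge> 1" by (simp add: U_def)
  \<comment> \<open>above \<open>U\<close>, so that points of zero slope cannot touch; above \<open>M * U\<close>, so that the barrier dominates the initial values\<close>
  define K0 where "K0 = 1 + U + M * U"
  have K0: "K0 > 0" "K0 \<ge> 1" "K0 > U" "K0 > M * U" using M U by (auto simp: K0_def add_pos_nonneg)
  obtain K K' C where K: "\<And>t. t \<in> {0<..<T} \<Longrightarrow> (K has_real_derivative K' t) (at t)"
    "\<And>t. t \<in> {0<..<T} \<Longrightarrow> K' t \<ge> K t * ((m / d\<^sup>2 + 1) + 1 * (h t)\<^sup>2)"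
    "\<And>t. t \<in> {0..<T} \<Longrightarrow> K0 \<le> K t" "\<And>t. t \<in> {0..<T} \<Longrightarrow> K t \<le> C" "continuous_on {0..<T} K"
    by (rule exponential_barrier[OF K0(1), of "m / d\<^sup>2 + 1" 1]) auto
  let ?F = "\<lambda>t s. v t s * max (u t s - d) 0 - K t"
  have neg: "?F t s < 0" if ts: "t \<in> {0..<T}" "s \<in> {a..b}" for t s
  proof (rule negative_unless_touching_zero[where F = ?F, OF _ _ _ ts])
    have "continuous_on ({0..<T} \<times> {a..b}) (\<lambda>q. K (fst q))"
      by (rule continuous_on_compose2[OF K(5)]) (auto intro: continuous_intros)
    then show "continuous_on ({0..<T} \<times> {a..b}) (\<lambda>(t, s). ?F t s)"
      using cont_v u_cont unfolding case_prod_beta' by (intro continuous_intros)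
    show "?F 0 s < 0" if s: "s \<in> {a..b}" for s
    proof -
      have "v 0 s * max (u 0 s - d) 0 \<le> M * U"
        using M(2)[OF s] v_pos[of 0 s] u_le_U[OF T0 s] d M(1) U by (intro mult_mono) auto
      then show ?thesis using K0 K(3)[OF T0] by linarith
    qed
  next
    fix t s assume t: "t \<in> {0<..<T}" and s: "s \<in> {a..b}" and F0: "?F t s = 0"
      and Fle: "\<forall>\<tau>\<in>{0..t}. \<forall>\<sigma>\<in>{a..b}. ?F \<tau> \<sigma> \<le> 0"
    have t0: "t \<in> {0..<T}" using t by auto
    have Kt: "K t \<ge> 1" "K t > U" using K0 K(3)[OF t0] by auto
    have ud: "u t s > d"
      using F0 Kt by (cases "u t s > d") auto
    then have G0: "v t s * (u t s - d) = K t" using F0 by simp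
    have w: "u1 t s \<noteq> 0"
    proof
      assume "u1 t s = 0"
      then have "v t s = 1" by (simp add: v_def)
      then show False using G0 u_le_U[OF t0 s] Kt d by simp
    qed
    obtain e where e: "e > 0" "\<And>\<tau> \<sigma>. \<tau> \<in> {0..<T} \<Longrightarrow> \<sigma> \<in> {a..b} \<Longrightarrow> \<bar>\<tau> - t\<bar> < e \<Longrightarrow> \<bar>\<sigma> - s\<bar> < e \<Longrightarrow> u \<tau> \<sigma> - d > 0"
    proof (rule continuous_pos_nbhd[where f = "\<lambda>t s. u t s - d", OF _ t0 s])
      show "continuous_on ({0..<T} \<times> {a..b}) (\<lambda>(t, s). u t s - d)"
        using u_cont unfolding case_prod_beta' by (intro continuous_intros)
    qed (use ud in auto)
    let ?f = "\<lambda>t s. v t s * (u t s - d) - K t"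
    let ?ft = "\<lambda>t s. u1 t s * u1t t s / v t s * (u t s - d) + v t s * ut t s - K' t"
    let ?f1 = "\<lambda>t s. (u1 t s * u2 t s / v t s) * (u t s - d) + v t s * u1 t s"
    let ?f2 = "\<lambda>t s. (u1 t s * u3 t s / v t s + (u2 t s)\<^sup>2 / v t s ^ 3) * (u t s - d)
        + 2 * (u1 t s * u2 t s / v t s * u1 t s) + v t s * u2 t s"
    have dt: "d_time ?f ?ft"
      unfolding d_time_def
    proof (intro ballI)
      fix t s assume ts: "t \<in> {0<..<T}" "s \<in> {a..b}"
      have "((\<lambda>\<tau>. v \<tau> s) has_real_derivative u1 t s * u1t t s / v t s) (at t)"
        "((\<lambda>\<tau>. u \<tau> s) has_real_derivative ut t s) (at t)"
        using v_d_time[OF R(1)] ut ts unfolding d_time_def by blast+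
      from DERIV_diff[OF DERIV_mult[OF this(1) DERIV_diff[OF this(2) DERIV_const[of d]]] K(1)[OF ts(1)]]
      show "((\<lambda>\<tau>. ?f \<tau> s) has_real_derivative ?ft t s) (at t)"
        by (rule DERIV_cong) simp
    qed
    have ds: "d_space ?f ?f1"
      unfolding d_space_def
    proof (intro ballI)
      fix t s assume ts: "t \<in> {0<..<T}" "s \<in> {a..b}"
      then have t0: "t \<in> {0..<T}" by auto
      from DERIV_diff[OF DERIV_mult[OF v_space_deriv[OF t0 ts(2)] DERIV_diff[OF u_deriv[OF t0 ts(2)] DERIV_const[of d]]] DERIV_const[of "K t"]]
      show "(?f t has_real_derivative ?f1 t s) (at s within {a..b})"
        by (rule DERIV_cong) simp
    qed
    have ds2: "d_space ?f1 ?f2"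
      unfolding d_space_def
    proof (intro ballI)
      fix t s assume ts: "t \<in> {0<..<T}" "s \<in> {a..b}"
      then have t0: "t \<in> {0..<T}" by auto
      have z: "(u2 t has_real_derivative u3 t s) (at s within {a..b})"
        using R(2) ts unfolding d_space_def by blast
      have V: "v t s \<noteq> 0" using v_pos[of t s] by simp
      note D = u_deriv[OF t0 ts(2)] u1_deriv[OF t0 ts(2)] v_space_deriv[OF t0 ts(2)]
      from DERIV_add[OF DERIV_mult[OF DERIV_divide[OF DERIV_mult[OF D(2) z] D(3) V] DERIV_diff[OF D(1) DERIV_const[of d]]]
          DERIV_mult[OF D(3) D(2)]]
      show "(?f1 t has_real_derivative ?f2 t s) (at s within {a..b})"
      proof (rule DERIV_cong)
        have "((z * z + w * z1) * y - w * z * (w * z / y)) / (y * y) = w * z1 / y + z\<^sup>2 / y ^ 3"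
          if "y > 0" "y\<^sup>2 = 1 + w\<^sup>2" for y w z z1 :: real
        proof -
          have "z * z * y - w * z * (w * z / y) = z\<^sup>2 * (y\<^sup>2 - w\<^sup>2) / y"
            using that(1) by (simp add: field_simps power2_eq_square)
          then have "z * z * y - w * z * (w * z / y) = z\<^sup>2 / y" using that(2) by simp
          then have "(z * z + w * z1) * y - w * z * (w * z / y) = w * z1 * y + z\<^sup>2 / y"
            by (simp add: distrib_right)
          then show ?thesis using that(1) by (simp add: add_divide_distrib power3_eq_cube)
        qed
        from this[OF v_pos v_sq, of "u2 t s" t s "u3 t s"]
        have q: "((u2 t s * u2 t s + u3 t s * u1 t s) * v t s - u1 t s * u2 t s * (u1 t s * u2 t s / v t s)) / (v t s * v t s)
          = u1 t s * u3 t s / v t s + (u2 t s)\<^sup>2 / v t s ^ 3" by (simp only: mult.commute[of "u3 t s"])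
        show "((u2 t s * u2 t s + u3 t s * u1 t s) * v t s - u1 t s * u2 t s * (u1 t s * u2 t s / v t s)) / (v t s * v t s) * (u t s - d) +
            (u1 t s - 0) * (u1 t s * u2 t s / v t s) + (u1 t s * u2 t s / v t s * u1 t s + u2 t s * v t s) = ?f2 t s"
          unfolding q by simp
      qed
    qed
    have f0: "?f t s = 0" using G0 by simp
    have fle: "?f \<tau> \<sigma> \<le> 0" if "\<tau> \<in> {0<..t}" "\<sigma> \<in> {a..b}" "\<bar>\<tau> - t\<bar> < e" "\<bar>\<sigma> - s\<bar> < e" for \<tau> \<sigma>
      using Fle[rule_format, of \<tau> \<sigma>] e(2)[of \<tau> \<sigma>] that t by auto
    have bd: "?f1 t s = 0" if "s = a \<or> s = b" using w neumann[OF t0] that by auto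
    have TP1: "?ft t s \<ge> 0"
      by (rule derivatives_at_touching_point(1)[OF dt ds ds2 t s f0 e(1) fle bd])
    have TP2: "?f1 t s = 0"
      by (rule derivatives_at_touching_point(2)[OF dt ds ds2 t s f0 e(1) fle bd])
    have TP3: "?f2 t s \<le> 0"
      by (rule derivatives_at_touching_point(3)[OF dt ds ds2 t s f0 e(1) fle bd])
    have r3: "u3 t s = psi1 t s * (v t s)\<^sup>2 + 2 * u1 t s * psi t s * u2 t s"
      and r1: "u1t t s = psi1 t s + m * u1 t s / (u t s)\<^sup>2 + h t * u1 t s * psi t s * v t s"
      using R(6,7) t s by blast+
    have K't: "K' t > K t * (m / d\<^sup>2) + \<bar>h t\<bar>"
    proof -
      have "2 * \<bar>h t\<bar> \<le> (h t)\<^sup>2 + 1" using sum_squares_bound[of "\<bar>h t\<bar>" 1] by simp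
      then have "\<bar>h t\<bar> < 1 + (h t)\<^sup>2" using zero_le_power2[of "h t"] by linarith
      also have "\<dots> \<le> K t * (1 + (h t)\<^sup>2)" using mult_right_mono[OF Kt(1), of "1 + (h t)\<^sup>2"] by simp
      finally show ?thesis using K(2)[OF t] by (simp add: algebra_simps)
    qed
    have g1: "(u1 t s * (psi t s * (v t s)\<^sup>2) / v t s) * (u t s - d) + v t s * u1 t s = 0"
      using TP2 by (simp only: u2_eq)
    have g2: "(u1 t s * (psi1 t s * (v t s)\<^sup>2 + 2 * u1 t s * psi t s * (psi t s * (v t s)\<^sup>2)) / v t s
          + (psi t s * (v t s)\<^sup>2)\<^sup>2 / v t s ^ 3) * (u t s - d)
        + 2 * (u1 t s * (psi t s * (v t s)\<^sup>2) / v t s * u1 t s) + v t s * (psi t s * (v t s)\<^sup>2) \<le> 0"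
      using TP3 by (simp only: r3 u2_eq)
    show False
      by (rule gradient_barrier_contradiction[OF v_pos v_sq d ud of_nat_0_le_iff Kt(1) ut_def r1 K't w G0 g1 g2 TP1])
  qed
  show ?thesis
  proof (rule that[of "max 1 C"])
    fix t s assume ts: "t \<in> {0..<T}" "s \<in> {a..b}" "u t s > d"
    then show "v t s * (u t s - d) \<le> max 1 C"
      using neg[OF ts(1,2)] K(4)[OF ts(1)] by simp
  qed simp
qed

text \<open>The barrier factor is \<open>E0 - w\<^sup>2\<close> where \<open>u > d\<close>; the maximum with \<open>E0 / 2\<close> keeps it positive
  elsewhere without changing it there.\<close>

lemma psi_bound_one_sided:
  assumes d: "d > 0" and sg: "sg * sg = (1 :: real)"
    and E0: "E0 \<ge> 1" "\<And>t s. t \<in> {0..<T} \<Longrightarrow> s \<in> {a..b} \<Longrightarrow> u t s > d \<Longrightarrow> 2 * (u1 t s)\<^sup>2 \<le> E0"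
  obtains C where "\<And>t s. t \<in> {0..<T} \<Longrightarrow> s \<in> {a..b} \<Longrightarrow> u t s > d \<Longrightarrow> sg * psi t s * (u t s - d) \<le> C"
proof -
  obtain u1t u2t u3 psi1 psi2 psit where R:
    "d_time u1 u1t" "d_space u2 u3" "d_space psi psi1" "d_space psi1 psi2" "d_time psi psit"
    "\<forall>t\<in>{0<..<T}. \<forall>s\<in>{a..b}. u3 t s = psi1 t s * (v t s)\<^sup>2 + 2 * u1 t s * psi t s * u2 t s"
    "\<forall>t\<in>{0<..<T}. \<forall>s\<in>{a..b}. u1t t s = psi1 t s + m * u1 t s / (u t s)\<^sup>2 + h t * u1 t s * psi t s * v t s"
    "\<forall>t\<in>{0<..<T}. \<forall>s\<in>{a..b}. u2t t s = psi2 t s + m * u2 t s / (u t s)\<^sup>2 - 2 * real m * (u1 t s)\<^sup>2 / u t s ^ 3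
       + h t * (u2 t s * psi t s * v t s + u1 t s * psi1 t s * v t s + u1 t s * psi t s * (u1 t s * u2 t s / v t s))"
    "\<forall>t\<in>{0<..<T}. \<forall>s\<in>{a..b}. psit t s = u2t t s / (v t s)\<^sup>2 - 2 * u1 t s * u2 t s * u1t t s / ((v t s)\<^sup>2)\<^sup>2"
    by (rule derivative_relations)
  have T0: "0 \<in> {0..<T}" using T by simp
  obtain M where M: "M \<ge> 0" "\<And>s. s \<in> {a..b} \<Longrightarrow> \<bar>psi 0 s\<bar> \<le> M"
    using bounded_on_slice[OF slice_cont(5)[OF T0]] by blast
  have U: "U \<ge> 1" by (simp add: U_def)
  have sg1: "\<bar>sg\<bar> = 1" using sg square_eq_1_iff[of sg] by auto
  \<comment> \<open>above \<open>8\<close> to absorb the quadratic terms; above \<open>2 * (M * U)\<close> because \<open>E0 - w\<^sup>2\<close> may be as small as \<open>1 / 2\<close> initially\<close>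
  define K0 where "K0 = 9 + 2 * (M * U)"
  have K0: "K0 > 0" "K0 > 8" "K0 > 2 * (M * U)" using M U by (auto simp: K0_def add_pos_nonneg)
  obtain K K' C where K: "\<And>t. t \<in> {0<..<T} \<Longrightarrow> (K has_real_derivative K' t) (at t)"
    "\<And>t. t \<in> {0<..<T} \<Longrightarrow> K' t \<ge> K t * (5 * real m / d\<^sup>2 + E0 * (h t)\<^sup>2)"
    "\<And>t. t \<in> {0..<T} \<Longrightarrow> K0 \<le> K t" "\<And>t. t \<in> {0..<T} \<Longrightarrow> K t \<le> C" "continuous_on {0..<T} K"
    by (rule exponential_barrier[OF K0(1), of "5 * real m / d\<^sup>2" E0]) (use E0 in auto)
  let ?F = "\<lambda>t s. sg * psi t s * max (u t s - d) 0 - K t * max (E0 / 2) (E0 - (u1 t s)\<^sup>2)"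
  have outside: "?F t s < 0" if "t \<in> {0..<T}" "\<not> u t s > d" for t s
  proof -
    have "K t > 0" using K0 K(3)[OF that(1)] by simp
    moreover have "max (E0 / 2) (E0 - (u1 t s)\<^sup>2) > 0" using E0 by simp
    ultimately have "K t * max (E0 / 2) (E0 - (u1 t s)\<^sup>2) > 0" by (rule mult_pos_pos)
    then show ?thesis using that by simp
  qed
  have inside: "?F t s = sg * psi t s * (u t s - d) - K t * (E0 - (u1 t s)\<^sup>2)"
    if "t \<in> {0..<T}" "s \<in> {a..b}" "u t s > d" for t s
    using E0(2)[OF that] that(3) by (simp add: max_def)
  have neg: "?F t s < 0" if ts: "t \<in> {0..<T}" "s \<in> {a..b}" for t s
  proof (rule negative_unless_touching_zero[where F = ?F, OF _ _ _ ts])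
    have "continuous_on ({0..<T} \<times> {a..b}) (\<lambda>q. K (fst q))"
      by (rule continuous_on_compose2[OF K(5)]) (auto intro: continuous_intros)
    then show "continuous_on ({0..<T} \<times> {a..b}) (\<lambda>(t, s). ?F t s)"
      using cont_psi u_cont u1_cont unfolding case_prod_beta' by (intro continuous_intros)
    show "?F 0 s < 0" if s: "s \<in> {a..b}" for s
    proof -
      have "\<bar>sg * psi 0 s\<bar> \<le> M" using M(2)[OF s] sg1 by (simp add: abs_mult)
      then have "sg * psi 0 s \<le> M" by linarith
      then have 1: "sg * psi 0 s * max (u 0 s - d) 0 \<le> M * U"
        using u_le_U[OF T0 s] d M(1) U by (intro mult_mono) auto
      have "K0 * (1 / 2) \<le> K 0 * max (E0 / 2) (E0 - (u1 0 s)\<^sup>2)"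
      proof (rule mult_mono)
        show "1 / 2 \<le> max (E0 / 2) (E0 - (u1 0 s)\<^sup>2)" using E0(1) by (simp add: le_max_iff_disj)
      qed (use K(3)[OF T0] K0 in auto)
      then show ?thesis using 1 K0 by linarith
    qed
  next
    fix t s assume t: "t \<in> {0<..<T}" and s: "s \<in> {a..b}" and F0: "?F t s = 0"
      and Fle: "\<forall>\<tau>\<in>{0..t}. \<forall>\<sigma>\<in>{a..b}. ?F \<tau> \<sigma> \<le> 0"
    have t0: "t \<in> {0..<T}" using t by auto
    have Kt: "K t > 8" using K0 K(3)[OF t0] by auto
    have ud: "u t s > d"
      using outside[OF t0, of s] F0 by (metis less_irrefl)
    obtain e where e: "e > 0" "\<And>\<tau> \<sigma>. \<tau> \<in> {0..<T} \<Longrightarrow> \<sigma> \<in> {a..b} \<Longrightarrow> \<bar>\<tau> - t\<bar> < e \<Longrightarrow> \<bar>\<sigma> - s\<bar> < e \<Longrightarrow> u \<tau> \<sigma> - d > 0"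
    proof (rule continuous_pos_nbhd[where f = "\<lambda>t s. u t s - d", OF _ t0 s])
      show "continuous_on ({0..<T} \<times> {a..b}) (\<lambda>(t, s). u t s - d)"
        using u_cont unfolding case_prod_beta' by (intro continuous_intros)
    qed (use ud in auto)
    let ?f = "\<lambda>t s. sg * psi t s * (u t s - d) - K t * (E0 - (u1 t s)\<^sup>2)"
    let ?ft = "\<lambda>t s. sg * psit t s * (u t s - d) + sg * psi t s * ut t s - K' t * (E0 - (u1 t s)\<^sup>2) + 2 * K t * u1 t s * u1t t s"
    let ?f1 = "\<lambda>t s. sg * psi1 t s * (u t s - d) + sg * psi t s * u1 t s + 2 * K t * u1 t s * u2 t s"
    let ?f2 = "\<lambda>t s. sg * psi2 t s * (u t s - d) + 2 * sg * psi1 t s * u1 t s + sg * psi t s * u2 t s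
        + 2 * K t * ((u2 t s)\<^sup>2 + u1 t s * u3 t s)"
    have dt: "d_time ?f ?ft"
      unfolding d_time_def
    proof (intro ballI)
      fix t s assume ts: "t \<in> {0<..<T}" "s \<in> {a..b}"
      have "((\<lambda>\<tau>. psi \<tau> s) has_real_derivative psit t s) (at t)" "((\<lambda>\<tau>. u \<tau> s) has_real_derivative ut t s) (at t)"
        "((\<lambda>\<tau>. u1 \<tau> s) has_real_derivative u1t t s) (at t)"
        using R(1,5) ut ts unfolding d_time_def by blast+
      from DERIV_diff[OF DERIV_mult[OF DERIV_cmult[OF this(1), of sg] DERIV_diff[OF this(2) DERIV_const[of d]]]
          DERIV_mult[OF K(1)[OF ts(1)] DERIV_diff[OF DERIV_const[of E0] DERIV_power[OF this(3), of 2]]]]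
      show "((\<lambda>\<tau>. ?f \<tau> s) has_real_derivative ?ft t s) (at t)"
        by (rule DERIV_cong) (simp add: algebra_simps)
    qed
    have D: "(psi t has_real_derivative psi1 t s) (at s within {a..b})" "(psi1 t has_real_derivative psi2 t s) (at s within {a..b})"
      "(u2 t has_real_derivative u3 t s) (at s within {a..b})"
      "(u t has_real_derivative u1 t s) (at s within {a..b})" "(u1 t has_real_derivative u2 t s) (at s within {a..b})"
      if ts: "t \<in> {0<..<T}" "s \<in> {a..b}" for t s
      using R(2,3,4) d_space_u d_space_u1 ts unfolding d_space_def by blast+
    have ds: "d_space ?f ?f1"
      unfolding d_space_def
    proof (intro ballI)
      fix t s assume "t \<in> {0<..<T}" "s \<in> {a..b}"
      note D = D[OF this]
      from DERIV_diff[OF DERIV_mult[OF DERIV_cmult[OF D(1), of sg] DERIV_diff[OF D(4) DERIV_const[of d]]]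
          DERIV_cmult[OF DERIV_diff[OF DERIV_const[of E0] DERIV_power[OF D(5), of 2]], of "K t"]]
      show "(?f t has_real_derivative ?f1 t s) (at s within {a..b})"
        by (rule DERIV_cong) (simp add: algebra_simps)
    qed
    have ds2: "d_space ?f1 ?f2"
      unfolding d_space_def
    proof (intro ballI)
      fix t s assume "t \<in> {0<..<T}" "s \<in> {a..b}"
      note D = D[OF this]
      from DERIV_add[OF DERIV_add[OF DERIV_mult[OF DERIV_cmult[OF D(2), of sg] DERIV_diff[OF D(4) DERIV_const[of d]]]
            DERIV_mult[OF DERIV_cmult[OF D(1), of sg] D(5)]] DERIV_mult[OF DERIV_cmult[OF D(5), of "2 * K t"] D(3)]]
      show "(?f1 t has_real_derivative ?f2 t s) (at s within {a..b})"
        by (rule DERIV_cong) (simp add: algebra_simps power2_eq_square)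
    qed
    have r3: "u3 t s = psi1 t s * (v t s)\<^sup>2 + 2 * u1 t s * psi t s * u2 t s"
      and r1: "u1t t s = psi1 t s + m * u1 t s / (u t s)\<^sup>2 + h t * u1 t s * psi t s * v t s"
      and r2: "u2t t s = psi2 t s + m * u2 t s / (u t s)\<^sup>2 - 2 * real m * (u1 t s)\<^sup>2 / u t s ^ 3
       + h t * (u2 t s * psi t s * v t s + u1 t s * psi1 t s * v t s + u1 t s * psi t s * (u1 t s * u2 t s / v t s))"
      and rp: "psit t s = u2t t s / (v t s)\<^sup>2 - 2 * u1 t s * u2 t s * u1t t s / ((v t s)\<^sup>2)\<^sup>2"
      using R(6-9) t s by blast+
    have G0: "sg * psi t s * (u t s - d) = K t * (E0 - (u1 t s)\<^sup>2)"
      using F0 inside[OF t0 s ud] by simp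
    have f0: "?f t s = 0" using G0 by simp
    have fle: "?f \<tau> \<sigma> \<le> 0" if "\<tau> \<in> {0<..t}" "\<sigma> \<in> {a..b}" "\<bar>\<tau> - t\<bar> < e" "\<bar>\<sigma> - s\<bar> < e" for \<tau> \<sigma>
    proof -
      have \<tau>: "\<tau> \<in> {0..<T}" "\<tau> \<in> {0..t}" using that t by auto
      have "u \<tau> \<sigma> > d" using e(2)[OF \<tau>(1) that(2-4)] by simp
      then show ?thesis using Fle[rule_format, OF \<tau>(2) that(2)] inside[OF \<tau>(1) that(2)] by (simp only:)
    qed
    have bd0: "?f1 t s = 0" if bd: "s = a \<or> s = b"
    proof -
      \<comment> \<open>the Neumann condition, differentiated in time\<close>
      have "((\<lambda>\<tau>. u1 \<tau> s) has_real_derivative 0) (at t)"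
      proof (rule has_field_derivative_transform_within_open[OF DERIV_const open_greaterThanLessThan t])
        fix \<tau> assume "\<tau> \<in> {0<..<T}"
        then show "0 = u1 \<tau> s" using neumann[of \<tau>] bd by auto
      qed
      moreover have "((\<lambda>\<tau>. u1 \<tau> s) has_real_derivative u1t t s) (at t)"
        using R(1) t s unfolding d_time_def by blast
      ultimately have "u1t t s = 0" by (rule DERIV_unique[symmetric])
      moreover have "u1 t s = 0" using bd neumann[OF t0] by auto
      ultimately show ?thesis using r1 by simp
    qed
    have TP1: "?ft t s \<ge> 0"
      by (rule derivatives_at_touching_point(1)[OF dt ds ds2 t s f0 e(1) fle bd0])
    have TP2: "?f1 t s = 0"
      by (rule derivatives_at_touching_point(2)[OF dt ds ds2 t s f0 e(1) fle bd0])
    have TP3: "?f2 t s \<le> 0"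
      by (rule derivatives_at_touching_point(3)[OF dt ds ds2 t s f0 e(1) fle bd0])
    show False
      by (rule curvature_barrier_contradiction[OF v_pos v_sq d ud of_nat_0_le_iff Kt sg E0(2)[OF t0 s ud] E0(1)
            u2_eq r3 ut_def r1 r2 rp K(2)[OF t] G0 TP2 TP3 TP1])
  qed
  show ?thesis
  proof (rule that[of "C * E0"])
    fix t s assume ts: "t \<in> {0..<T}" "s \<in> {a..b}" "u t s > d"
    have "sg * psi t s * (u t s - d) \<le> K t * (E0 - (u1 t s)\<^sup>2)"
      using neg[OF ts(1,2)] inside[OF ts] by simp
    also have "\<dots> \<le> C * E0"
    proof (rule mult_mono)
      show "0 \<le> E0 - (u1 t s)\<^sup>2" using E0(2)[OF ts] zero_le_power2[of "u1 t s"] by linarith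
    qed (use K(3,4)[OF ts(1)] K0 in auto)
    finally show "sg * psi t s * (u t s - d) \<le> C * E0" .
  qed
qed

text \<open>Two nested cut-offs: the slope is bounded where \<open>u > \<epsilon> / 2\<close> by the gradient bound with
  \<open>d = \<epsilon> / 4\<close>, which is the input of the curvature bound with \<open>d = \<epsilon> / 2\<close>.\<close>

lemma slope_and_curvature_bound:
  assumes \<epsilon>: "\<epsilon> > 0"
  obtains C where "\<And>t s. t \<in> {0..<T} \<Longrightarrow> s \<in> {a..b} \<Longrightarrow> u t s \<ge> \<epsilon> \<Longrightarrow> \<bar>psi t s\<bar> \<le> C"
proof -
  obtain W where W: "W \<ge> 1"
    "\<And>t s. t \<in> {0..<T} \<Longrightarrow> s \<in> {a..b} \<Longrightarrow> u t s > \<epsilon> / 4 \<Longrightarrow> v t s * (u t s - \<epsilon> / 4) \<le> W"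
    using gradient_bound[of "\<epsilon> / 4"] \<epsilon> by auto
  define E0 where "E0 = 1 + 2 * (4 * W / \<epsilon>)\<^sup>2"
  have E0: "E0 \<ge> 1" by (simp add: E0_def)
  have w: "2 * (u1 t s)\<^sup>2 \<le> E0" if ts: "t \<in> {0..<T}" "s \<in> {a..b}" "u t s > \<epsilon> / 2" for t s
  proof -
    have "v t s * (\<epsilon> / 4) \<le> v t s * (u t s - \<epsilon> / 4)"
      using v_pos[of t s] ts(3) by (intro mult_left_mono) auto
    also have "\<dots> \<le> W" using W(2)[OF ts(1,2)] ts(3) \<epsilon> by simp
    finally have "v t s \<le> 4 * W / \<epsilon>" using \<epsilon> by (simp add: field_simps)
    then have "\<bar>u1 t s\<bar> \<le> 4 * W / \<epsilon>" using abs_u1_le_v[of t s] by linarith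
    then have "\<bar>u1 t s\<bar>\<^sup>2 \<le> (4 * W / \<epsilon>)\<^sup>2" by (rule power_mono) simp
    then show ?thesis by (simp add: E0_def)
  qed
  have e2: "\<epsilon> / 2 > 0" using \<epsilon> by simp
  obtain C1 where C1: "\<And>t s. t \<in> {0..<T} \<Longrightarrow> s \<in> {a..b} \<Longrightarrow> u t s > \<epsilon> / 2 \<Longrightarrow> 1 * psi t s * (u t s - \<epsilon> / 2) \<le> C1"
    using psi_bound_one_sided[OF e2, of 1 E0, OF _ E0 w] by auto
  obtain C2 where C2: "\<And>t s. t \<in> {0..<T} \<Longrightarrow> s \<in> {a..b} \<Longrightarrow> u t s > \<epsilon> / 2 \<Longrightarrow> (-1) * psi t s * (u t s - \<epsilon> / 2) \<le> C2"
    using psi_bound_one_sided[OF e2, of "-1" E0, OF _ E0 w] by auto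
  show ?thesis
  proof (rule that[of "max C1 C2 / (\<epsilon> / 2)"])
    fix t s assume ts: "t \<in> {0..<T}" "s \<in> {a..b}" "u t s \<ge> \<epsilon>"
    then have u: "u t s > \<epsilon> / 2" using \<epsilon> by simp
    have "\<bar>psi t s\<bar> * (\<epsilon> / 2) \<le> \<bar>psi t s\<bar> * (u t s - \<epsilon> / 2)"
      using ts(3) by (intro mult_left_mono) auto
    also have "\<dots> \<le> max C1 C2"
      using C1[OF ts(1,2) u] C2[OF ts(1,2) u] by (cases "psi t s \<ge> 0") (auto simp: abs_if)
    finally show "\<bar>psi t s\<bar> \<le> max C1 C2 / (\<epsilon> / 2)"
      using e2 by (subst pos_le_divide_eq)
  qed
qed

end

section \<open>From the immersion to its profile\<close>

text \<open>A point moving on the evolving hypersurface satisfies \<open>|y(\<tau>)| = \<rho>(\<tau>, s(\<tau>))\<close>.  Differentiating this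
  relation converts normal speed into vertical speed of the profile, whatever the tangential
  behaviour of the parametrization relative to the profile.\<close>

lemma (in strip) graph_speed:
  fixes c :: "real \<Rightarrow> 'n::finite space"
  assumes \<rho>: "smooth2 \<rho>" and \<rho>1: "d_space \<rho> \<rho>1"
    and t: "t \<in> {0<..<T}" and s: "s \<in> {a..b}" and w: "norm w = 1" and pos: "\<rho> t s > 0"
    and ct: "c t = (s, \<rho> t s *\<^sub>R w)"
    and on: "\<And>\<tau>. \<tau> \<in> {0<..<T} \<Longrightarrow> fst (c \<tau>) \<in> {a..b} \<and> norm (snd (c \<tau>)) = \<rho> \<tau> (fst (c \<tau>))"
    and c': "(c has_vector_derivative k *\<^sub>R (- \<rho>1 t s, w)) (at t)"
  shows "((\<lambda>\<tau>. \<rho> \<tau> s) has_real_derivative k * (1 + (\<rho>1 t s)\<^sup>2)) (at t)"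
proof -
  obtain ft fs where f: "d_total \<rho> ft fs"
    using smooth2_total_derivative[OF \<rho>] by metis
  note fp = d_total_imp_partials[OF f]
  have fs: "fs t s = \<rho>1 t s" by (rule d_space_unique[OF fp(2) \<rho>1 t s])
  have cD: "(c has_derivative (\<lambda>h. h *\<^sub>R (k *\<^sub>R (- \<rho>1 t s, w)))) (at t within {0<..<T})"
    using c' unfolding has_vector_derivative_def by (rule has_derivative_at_withinI)
  have L: "((\<lambda>\<tau>. (\<tau>, fst (c \<tau>))) has_derivative (\<lambda>h. (h, fst (h *\<^sub>R (k *\<^sub>R (- \<rho>1 t s, w)))))) (at t within {0<..<T})"
    by (rule has_derivative_Pair[OF has_derivative_ident has_derivative_fst[OF cD]])
  have im: "(\<lambda>\<tau>. (\<tau>, fst (c \<tau>))) ` {0<..<T} \<subseteq> {0<..<T} \<times> {a..b}" using on by auto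
  have "((\<lambda>(t, s). \<rho> t s) has_derivative (\<lambda>x. fst x * ft t s + snd x * fs t s))
      (at (t, fst (c t)) within {0<..<T} \<times> {a..b})"
    using f t s ct unfolding d_total_def by simp
  from has_derivative_in_compose[OF L has_derivative_subset[OF this im]]
  have A: "((\<lambda>\<tau>. \<rho> \<tau> (fst (c \<tau>))) has_derivative (\<lambda>h. h * (ft t s - k * (\<rho>1 t s)\<^sup>2))) (at t within {0<..<T})"
    by (simp add: fs algebra_simps power2_eq_square)
  have nz: "snd (c t) \<noteq> 0" using ct pos w by auto
  have ww: "w \<bullet> w = 1" using w by (simp add: dot_square_norm)
  have "(norm has_derivative (\<lambda>h. h \<bullet> sgn (snd (c t)))) (at (snd (c t)) within (\<lambda>\<tau>. snd (c \<tau>)) ` {0<..<T})"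
    by (rule has_derivative_at_withinI[OF has_derivative_norm[OF nz]])
  from has_derivative_in_compose[OF has_derivative_snd[OF cD] this]
  have B: "((\<lambda>\<tau>. norm (snd (c \<tau>))) has_derivative (\<lambda>h. h * k)) (at t within {0<..<T})"
    using ct pos w ww by (simp add: sgn_div_norm)
  have "((\<lambda>\<tau>. \<rho> \<tau> (fst (c \<tau>))) has_derivative (\<lambda>h. h * k)) (at t within {0<..<T})"
    by (rule has_derivative_transform[OF t _ B]) (use on in auto)
  then have "(\<lambda>h. h * k) = (\<lambda>h. h * (ft t s - k * (\<rho>1 t s)\<^sup>2))"
    using A t at_within_open[OF t open_greaterThanLessThan] has_derivative_unique by metis
  from fun_cong[OF this, of 1] have "ft t s = k * (1 + (\<rho>1 t s)\<^sup>2)" by (simp add: algebra_simps)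
  then show ?thesis using fp(1) t s unfolding d_time_def by metis
qed

lemma height_le_norm_snd: "height p \<le> norm (snd p)"
proof -
  have "height p \<le> dist p (fst p, 0)"
    unfolding height_def by (rule infdist_le) (auto simp: axis_of_rotation_def)
  then show ?thesis by (cases p) (simp add: dist_Pair_Pair dist_norm)
qed

lemma unit_vector_exists: "\<exists>w :: real ^ 'n. norm w = 1"
  by (rule exI[of _ "axis undefined 1"]) simp

lemma frontier_slab:
  assumes "s = a \<or> s = b" "a < b"
  shows "(s, y) \<in> frontier (slab a b :: 'n::finite space set)"
proof -
  have sl: "slab a b = {a..b} \<times> (UNIV :: (real ^ 'n) set)"
    by (auto simp: slab_def)
  have "interior (slab a b :: 'n space set) = {a<..<b} \<times> UNIV"
    unfolding sl by (simp add: interior_Times)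
  moreover have "closure (slab a b :: 'n space set) = {a..b} \<times> UNIV"
    unfolding sl by (simp add: closure_Times)
  ultimately show ?thesis using assms by (auto simp: frontier_def)
qed

text \<open>Orthogonality to the planes makes the axial component of the normal vanish at the ends.\<close>

lemma (in profile) neumann_slope:
  assumes N: "neumann_condition a b F" and F: "F ` cylinder a b = surf" and s: "s = a \<or> s = b"
  shows "r1 s = 0"
proof -
  obtain w :: "real ^ 'n" where w: "norm w = 1" using unit_vector_exists by blast
  have sab: "s \<in> {a..b}" using s ab by auto
  let ?p = "(s, r s *\<^sub>R w)"
  have "?p \<in> surf" using sab w r_pos[OF sab] by (simp add: surf_iff)
  moreover have "?p \<in> frontier (slab a b)" using s ab by (rule frontier_slab)
  ultimately have "outer_normal surf ?p \<bullet> (1, 0) = 0"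
    using N F unfolding neumann_condition_def by (metis IntI)
  then show ?thesis
    using slope_pos[of s] by (simp add: outer_normal_surf[OF sab w])
qed

theorem proposition4p9:
  fixes a b T \<epsilon> :: real
    and \<rho>0 :: "real \<Rightarrow> real"
    and \<rho> :: "real \<Rightarrow> real \<Rightarrow> real"
    and x :: "real \<Rightarrow> 'n::finite space \<Rightarrow> 'n space"
    and S :: "real \<Rightarrow> 'n space set"
  assumes "0 < a" and "a < b"
    and "smooth_on {a..b} \<rho>0" and "\<forall>s\<in>{a..b}. \<rho>0 s > 0"
    and "(\<rho>0 has_real_derivative 0) (at a within {a..b})"
    and "(\<rho>0 has_real_derivative 0) (at b within {a..b})"
    and "first_singular_time a b \<rho>0 \<rho> x T"
    and "\<epsilon> > 0"
    and "\<forall>t\<in>{0..<T}. S t \<subseteq> x t ` cylinder a b"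
    and "\<forall>t\<in>{0..<T}. \<forall>p\<in>S t. height p \<ge> \<epsilon>"
  shows "\<exists>C. \<forall>t\<in>{0..<T}. \<forall>p\<in>S t. norm_A (x t ` cylinder a b) p \<le> C"
proof -
  have T: "0 < T" and flow: "axisymmetric_vpmcf a b \<rho>0 \<rho> x T"
    using assms(7) unfolding first_singular_time_def by blast+
  from flow obtain \<rho>1 \<rho>2 where
    sm: "smooth_on ({0<..<T} \<times> {a..b}) (\<lambda>(t, s). \<rho> t s)" and
    d: "\<forall>t\<in>{0..<T}. \<forall>s\<in>{a..b}. (\<rho> t has_real_derivative \<rho>1 t s) (at s within {a..b}) \<and>
         (\<rho>1 t has_real_derivative \<rho>2 t s) (at s within {a..b})" and
    c: "continuous_on ({0..<T} \<times> {a..b}) (\<lambda>(t, s). \<rho> t s)"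
      "continuous_on ({0..<T} \<times> {a..b}) (\<lambda>(t, s). \<rho>1 t s)"
      "continuous_on ({0..<T} \<times> {a..b}) (\<lambda>(t, s). \<rho>2 t s)"
    unfolding axisymmetric_vpmcf_def regular_family_def by blast
  have pos: "\<rho> t s > 0" if "t \<in> {0..<T}" "s \<in> {a..b}" for t s
    using flow that unfolding axisymmetric_vpmcf_def by blast
  have img: "x t ` cylinder a b = rotate_graph (\<rho> t) ` cylinder a b"
    and neu: "neumann_condition a b (x t)" if "t \<in> {0..<T}" for t
    using flow that unfolding axisymmetric_vpmcf_def by blast+
  define h where "h = (\<lambda>t. average_mean_curvature TYPE('n) a b (\<rho> t))"
  define m where "m = CARD('n) - 1"
  have motion: "((\<lambda>\<tau>. x \<tau> l) has_vector_derivative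
      - (mean_curvature (x t ` cylinder a b) (x t l) - h t) *\<^sub>R outer_normal (x t ` cylinder a b) (x t l))
      (at t within {0..<T})" if "t \<in> {0..<T}" "l \<in> cylinder a b" for t l
    using flow that unfolding axisymmetric_vpmcf_def h_def by blast
  have P: "profile a b (\<rho> t) (\<rho>1 t) (\<rho>2 t)" if "t \<in> {0..<T}" for t
    by unfold_locales (use assms(2) d pos that in auto)
  let ?M = "\<lambda>t. x t ` cylinder a b"
  have surf: "profile.surf a b (\<rho> t) = ?M t" if "t \<in> {0..<T}" for t
    using profile.surf_def[OF P[OF that], where 'n = 'n] img[OF that] by simp
  interpret strip a b T by unfold_locales (rule assms(2))
  have smooth: "smooth2 \<rho>" unfolding smooth2_def by (rule sm)
  have space: "d_space \<rho> \<rho>1" unfolding d_space_def using d by auto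
  let ?v = "\<lambda>t s. profile.slope (\<rho>1 t) s" and ?H = "\<lambda>t s. profile.prin_k (\<rho>1 t) (\<rho>2 t) s + m * profile.prin_p (\<rho> t) (\<rho>1 t) s"
  have speed: "\<rho>2 t s / (1 + (\<rho>1 t s)\<^sup>2) - m / \<rho> t s + h t * sqrt (1 + (\<rho>1 t s)\<^sup>2) = ?v t s * (h t - ?H t s)"
    if "t \<in> {0..<T}" "s \<in> {a..b}" for t s
  proof -
    interpret profile a b "\<rho> t" "\<rho>1 t" "\<rho>2 t" "TYPE('n)" by (rule P[OF that(1)])
    have v: "slope s > 0" by (rule slope_pos)
    have "\<rho>2 t s / (slope s)\<^sup>2 - m / \<rho> t s + h t * slope s = slope s * (h t - (prin_k s + m * prin_p s))"
      using v pos[OF that] unfolding prin_k_def prin_p_def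
      by (simp add: field_simps power2_eq_square power3_eq_cube)
    then show ?thesis by (simp add: slope_sq) (simp add: slope_def)
  qed
  interpret graph_flow a b T m \<rho> \<rho>1 \<rho>2 h
  proof unfold_locales
    show "0 < T" by (rule T)
    show "smooth2 \<rho>" by (rule smooth)
    fix t assume t: "t \<in> {0..<T}"
    show "\<rho>1 t a = 0" "\<rho>1 t b = 0"
      using profile.neumann_slope[OF P[OF t], of "x t"] neu[OF t] surf[OF t] by auto
  next
    show "d_time \<rho> (\<lambda>t s. \<rho>2 t s / (1 + (\<rho>1 t s)\<^sup>2) - m / \<rho> t s + h t * sqrt (1 + (\<rho>1 t s)\<^sup>2))"
      unfolding d_time_def
    proof (intro ballI)
      fix t s assume t: "t \<in> {0<..<T}" and s: "s \<in> {a..b}"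
      then have t0: "t \<in> {0..<T}" by auto
      interpret profile a b "\<rho> t" "\<rho>1 t" "\<rho>2 t" "TYPE('n)" by (rule P[OF t0])
      obtain w :: "real ^ 'n" where w: "norm w = 1" using unit_vector_exists by blast
      have "(s, \<rho> t s *\<^sub>R w) \<in> ?M t"
        using s w pos[OF t0 s] unfolding surf[OF t0, symmetric] by (simp add: surf_iff)
      then obtain l where l: "l \<in> cylinder a b" "x t l = (s, \<rho> t s *\<^sub>R w)" by (metis imageE)
      let ?k = "(h t - ?H t s) / slope s"
      have "((\<lambda>\<tau>. x \<tau> l) has_vector_derivative ?k *\<^sub>R (- \<rho>1 t s, w)) (at t within {0..<T})"
      proof -
        have vec: "- (H - k) *\<^sub>R (1 / q) *\<^sub>R V = ((k - H) / q) *\<^sub>R V" for H k q :: real and V :: "'n space"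
          by simp
        show ?thesis
          using motion[OF t0 l(1)]
          unfolding l(2) surf[OF t0, symmetric] mean_curvature_surf[OF s w] outer_normal_surf[OF s w] vec m_def
          .
      qed
      moreover have "at t within {0..<T} = at t"
        using t by (intro at_within_interior) (simp add: interior_atLeastLessThan)
      ultimately have c': "((\<lambda>\<tau>. x \<tau> l) has_vector_derivative ?k *\<^sub>R (- \<rho>1 t s, w)) (at t)" by simp
      have on: "fst (x \<tau> l) \<in> {a..b} \<and> norm (snd (x \<tau> l)) = \<rho> \<tau> (fst (x \<tau> l))" if "\<tau> \<in> {0<..<T}" for \<tau>
      proof -
        have \<tau>: "\<tau> \<in> {0..<T}" using that by auto
        have "x \<tau> l \<in> profile.surf a b (\<rho> \<tau>)" unfolding surf[OF \<tau>] using l(1) by blast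
        then show ?thesis using profile.surf_iff[OF P[OF \<tau>], of "fst (x \<tau> l)" "snd (x \<tau> l)"] by simp
      qed
      have "((\<lambda>\<tau>. \<rho> \<tau> s) has_real_derivative ?k * (1 + (\<rho>1 t s)\<^sup>2)) (at t)"
        by (rule graph_speed[OF smooth space t s w pos[OF t0 s] l(2) on c'])
      moreover have "?k * (1 + (\<rho>1 t s)\<^sup>2) = ?v t s * (h t - ?H t s)"
        unfolding slope_sq[symmetric] using slope_pos[of s] by (simp add: power2_eq_square)
      ultimately show "((\<lambda>\<tau>. \<rho> \<tau> s) has_real_derivative
          \<rho>2 t s / (1 + (\<rho>1 t s)\<^sup>2) - m / \<rho> t s + h t * sqrt (1 + (\<rho>1 t s)\<^sup>2)) (at t)"
        unfolding speed[OF t0 s] by simp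
    qed
  next
    fix t assume "t \<in> {0<..<T}"
    then have t0: "t \<in> {0..<T}" by auto
    interpret profile a b "\<rho> t" "\<rho>1 t" "\<rho>2 t" "TYPE('n)" by (rule P[OF t0])
    have cs: "continuous_on {a..b} (\<rho> t)" "continuous_on {a..b} (\<rho>1 t)" "continuous_on {a..b} (\<rho>2 t)"
      using continuous_slice c t0 by blast+
    have nz: "slope s \<noteq> 0" for s using slope_pos[of s] by simp
    have cv: "continuous_on {a..b} slope" unfolding slope_def[abs_def] using cs by (intro continuous_intros)
    have cw: "continuous_on {a..b} (\<lambda>s. \<rho> t s ^ m * slope s)" using cs cv by (intro continuous_intros)
    have "\<rho> t s \<noteq> 0" if "s \<in> {a..b}" for s using pos[OF t0 that] by simp
    then have cH: "continuous_on {a..b} (\<lambda>s. ?H t s * (\<rho> t s ^ m * slope s))"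
      unfolding prin_k_def prin_p_def using cs cv nz by (intro continuous_intros) auto
    let ?A = "integral {a..b} (\<lambda>s. \<rho> t s ^ m * slope s)" and ?I = "integral {a..b} (\<lambda>s. ?H t s * (\<rho> t s ^ m * slope s))"
    have iA: "((\<lambda>s. \<rho> t s ^ m * slope s) has_integral ?A) {a..b}"
      by (intro integrable_integral integrable_continuous_interval cw)
    have iI: "((\<lambda>s. ?H t s * (\<rho> t s ^ m * slope s)) has_integral ?I) {a..b}"
      by (intro integrable_integral integrable_continuous_interval cH)
    have "h t = ?I / ?A"
      unfolding h_def average_mean_curvature_eq[OF cs(3)] m_def ..
    moreover have "?A \<noteq> 0"
    proof
      assume "?A = 0"
      then have i0: "((\<lambda>s. \<rho> t s ^ m * slope s) has_integral 0) (cbox a b)" using iA by simp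
      have ge: "0 \<le> \<rho> t s ^ m * slope s" if "s \<in> {a..b}" for s
        using pos[OF t0 that] slope_pos[of s] by simp
      have "\<rho> t a ^ m * slope a = 0"
        by (rule has_integral_0_cbox_imp_0[OF _ _ i0]) (use cw ge ab in auto)
      then show False using pos[OF t0, of a] slope_pos[of a] ab by simp
    qed
    ultimately have z: "h t * ?A - ?I = 0" by simp
    have i: "((\<lambda>s. h t * (\<rho> t s ^ m * slope s) - ?H t s * (\<rho> t s ^ m * slope s)) has_integral h t * ?A - ?I) {a..b}"
      by (intro has_integral_diff has_integral_mult_right iA iI)
    have eq: "h t * (\<rho> t s ^ m * slope s) - ?H t s * (\<rho> t s ^ m * slope s) = \<rho> t s ^ m *
        (\<rho>2 t s / (1 + (\<rho>1 t s)\<^sup>2) - m / \<rho> t s + h t * sqrt (1 + (\<rho>1 t s)\<^sup>2))" if "s \<in> {a..b}" for s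
      unfolding speed[OF t0 that] by (simp add: algebra_simps)
    show "((\<lambda>s. \<rho> t s ^ m * (\<rho>2 t s / (1 + (\<rho>1 t s)\<^sup>2) - m / \<rho> t s + h t * sqrt (1 + (\<rho>1 t s)\<^sup>2)))
        has_integral 0) {a..b}"
      by (rule has_integral_eq[OF eq i[unfolded z]])
  qed (use d pos c in auto)
  obtain C where C: "\<And>t s. t \<in> {0..<T} \<Longrightarrow> s \<in> {a..b} \<Longrightarrow> \<rho> t s \<ge> \<epsilon> \<Longrightarrow> \<bar>psi t s\<bar> \<le> C"
    using slope_and_curvature_bound[OF assms(8)] by blast
  show ?thesis
  proof (intro exI[of _ "CARD('n) * (2 * (1 / \<epsilon>) + C)"] ballI)
    fix t p assume t: "t \<in> {0..<T}" and p: "p \<in> S t"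
    interpret profile a b "\<rho> t" "\<rho>1 t" "\<rho>2 t" "TYPE('n)" by (rule P[OF t])
    have "p \<in> ?M t" using assms(9) t p by blast
    then obtain s y where sy: "p = (s, y)" "s \<in> {a..b}" "norm y = \<rho> t s"
      unfolding surf[OF t, symmetric] by (cases p) (auto simp: surf_iff)
    have "\<epsilon> \<le> height p" using assms(10) t p by blast
    then have le: "\<epsilon> \<le> \<rho> t s" using height_le_norm_snd[of p] sy by simp
    define w where "w = (1 / \<rho> t s) *\<^sub>R y"
    have r0: "\<rho> t s > 0" using pos[OF t sy(2)] .
    have w: "norm w = 1" "p = (s, \<rho> t s *\<^sub>R w)" using sy r0 by (auto simp: w_def)
    have sl: "slope s \<ge> 1" unfolding slope_def by simp
    have "\<bar>prin_p s\<bar> \<le> 1 / \<epsilon>"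
    proof -
      have "\<epsilon> * 1 \<le> \<rho> t s * slope s" using le sl r0 by (intro mult_mono) auto
      then show ?thesis using assms(8) r0 sl unfolding prin_p_def by (simp add: frac_le)
    qed
    moreover have "\<bar>prin_k s\<bar> \<le> C"
    proof -
      have "\<bar>prin_k s\<bar> = \<bar>psi t s\<bar> / slope s"
        unfolding prin_k_def psi_def slope_sq[symmetric] using sl
        by (simp add: abs_mult power2_eq_square power3_eq_cube)
      also have "\<dots> \<le> \<bar>psi t s\<bar> / 1" using sl by (intro divide_left_mono) auto
      also have "\<dots> \<le> C" using C[OF t sy(2) le] by simp
      finally show ?thesis .
    qed
    ultimately have "CARD('n) * (2 * \<bar>prin_p s\<bar> + \<bar>prin_k s\<bar>) \<le> CARD('n) * (2 * (1 / \<epsilon>) + C)"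
      by (intro mult_left_mono) auto
    then show "norm_A (?M t) p \<le> CARD('n) * (2 * (1 / \<epsilon>) + C)"
      using norm_A_surf_le[OF sy(2) w(1)] unfolding surf[OF t] w(2) by linarith
  qed
qed

end
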